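(* Let $M$ be a smooth closed manifold of dimension $2n+1$ admitting two cosymplectic structures $(\omega_0,\eta_0)$ and $(\omega_1,\eta_1)$. Assume that $\{\eta_t\}_{t\in[0,1]}$ is a smooth family of closed $1$-forms with endpoints $\eta_0$ and $\eta_1$, and $\{\omega_t\}_{t\in[0,1]}$ is a smooth family of closed $2$-forms with endpoints $\omega_0$ and $\omega_1$, such that $(M,\omega_t,\eta_t)$ is a cosymplectic manifold for each $t$. Put $\xi_t:=\widetilde I_{\eta_t,\omega_t}^{-1}(\eta_t)$, and assume that there are smooth families of $1$-forms $\{\alpha_t\}$ and of smooth functions $\{f_t\}$ on $M$ such that for each $t$: (i) $\frac{\partial}{\partial t}\omega_t=d\alpha_t$ (so that $\frac{\partial}{\partial t}[\omega_t]=[\frac{\partial}{\partial t}\omega_t]=[d\alpha_t]=0$); (ii) $\frac{\partial}{\partial t}\eta_t=df_t$ (so that $\frac{\partial}{\partial t}[\eta_t]=[\frac{\partial}{\partial t}\eta_t]=[df_t]=0$); (iii) $d(\alpha_t(\xi_t))=0$. Then there exists a smooth isotopy $\{\phi_t\}$ of $M$ such that $\phi_t^\ast(\omega_t)=\omega_0$ and $\phi_t^\ast(\eta_t)=\eta_0$ for all $t\in[0,1]$.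
   Context: For a $1$-form $\eta$ and a $2$-form $\omega$ on a manifold $M$, let $\widetilde I_{\eta,\omega}:\chi(M)\to\Omega^1(M)$, $\widetilde I_{\eta,\omega}(X)=\imath_X\omega+\eta(X)\eta$, from smooth vector fields to $1$-forms. A cosymplectic structure on $M$ is a pair $(\omega,\eta)$ of a closed $2$-form $\omega$ and a closed $1$-form $\eta$ such that at each $x\in M$, $\eta_x\neq 0$ and the linear map $T_xM\to T_x^*M$, $Y\mapsto \imath_Y\omega_x+\eta_x(Y)\eta_x$, is bijective; then $\widetilde I_{\eta,\omega}$ is an isomorphism and $(M,\omega,\eta)$ is called a cosymplectic manifold. Square brackets denote de Rham cohomology classes. An isotopy is a smooth family $\{\phi_t\}_{t\in[0,1]}$ of diffeomorphisms of $M$ with $\phi_0=\mathrm{id}_M$. *)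

theory Defs
  imports "HOL-Analysis.Analysis"
begin

section \<open>Smooth maps between Euclidean spaces\<close>

text \<open>\<open>Ck_on k S f\<close> is only meant for open \<open>S\<close>: \<open>f\<close> is continuous for \<open>k = 0\<close>, and
  differentiable with all directional derivatives of class \<open>C^(k-1)\<close> otherwise.\<close>

primrec Ck_on ::
  "nat \<Rightarrow> 'a::euclidean_space set \<Rightarrow> ('a \<Rightarrow> 'b::real_normed_vector) \<Rightarrow> bool" where
  "Ck_on 0 S f \<longleftrightarrow> continuous_on S f"
| "Ck_on (Suc k) S f \<longleftrightarrow>
     (\<forall>x\<in>S. f differentiable (at x)) \<and>
     (\<forall>v. Ck_on k S (\<lambda>x. frechet_derivative f (at x) v))"

text \<open>A map on an arbitrary subset is smooth if it locally extends to a \<open>C^\<infinity>\<close> map on an open set.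
  For open \<open>S\<close> this is ordinary smoothness; for \<open>{0..1} \<times> V\<close> with \<open>V\<close> open it is smoothness up to
  the boundary, which is what a smooth family indexed by \<open>t \<in> [0,1]\<close> means.\<close>

definition smooth_on ::
  "'a::euclidean_space set \<Rightarrow> ('a \<Rightarrow> 'b::real_normed_vector) \<Rightarrow> bool" where
  "smooth_on S f \<longleftrightarrow>
     (\<forall>x\<in>S. \<exists>U g. open U \<and> x \<in> U \<and> (\<forall>k. Ck_on k U g) \<and> (\<forall>y\<in>U \<inter> S. g y = f y))"


section \<open>Manifolds\<close>

text \<open>The manifold is the whole type \<open>'m\<close>, with its type class topology; its smooth structure is
  given by an atlas, which need not be maximal. A chart is a domain together with a map into the
  model space \<open>'e\<close>; the values of the map outside the domain are irrelevant.\<close>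

type_synonym ('m, 'e) chart = "'m set \<times> ('m \<Rightarrow> 'e)"

abbreviation cdom :: "('m, 'e) chart \<Rightarrow> 'm set" where "cdom c \<equiv> fst c"
abbreviation cmap :: "('m, 'e) chart \<Rightarrow> 'm \<Rightarrow> 'e" where "cmap c \<equiv> snd c"
abbreviation cimg :: "('m, 'e) chart \<Rightarrow> 'e set" where "cimg c \<equiv> cmap c ` cdom c"
abbreviation cinv :: "('m, 'e) chart \<Rightarrow> 'e \<Rightarrow> 'm" where "cinv c \<equiv> inv_into (cdom c) (cmap c)"

definition is_chart :: "('m::topological_space, 'e::euclidean_space) chart \<Rightarrow> bool" where
  "is_chart c \<longleftrightarrow>
     open (cdom c) \<and> open (cimg c) \<and> homeomorphism (cdom c) (cimg c) (cmap c) (cinv c)"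

definition smooth_atlas :: "('m::topological_space, 'e::euclidean_space) chart set \<Rightarrow> bool" where
  "smooth_atlas A \<longleftrightarrow>
     (\<forall>c\<in>A. is_chart c) \<and> (\<Union>c\<in>A. cdom c) = UNIV \<and>
     (\<forall>c\<in>A. \<forall>d\<in>A. smooth_on (cmap c ` (cdom c \<inter> cdom d)) (cmap d \<circ> cinv c))"

text \<open>Compact, Hausdorff, without boundary; second countability follows from compactness.\<close>

definition closed_manifold :: "('m::t2_space, 'e::euclidean_space) chart set \<Rightarrow> bool" where
  "closed_manifold A \<longleftrightarrow> smooth_atlas A \<and> compact (UNIV :: 'm set)"

text \<open>Pointwise constructions below that need coordinates use this chart around the point; on a
  smooth atlas their values do not depend on the choice.\<close>

definition chart_at :: "('m, 'e) chart set \<Rightarrow> 'm \<Rightarrow> ('m, 'e) chart" where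
  "chart_at A p = (SOME c. c \<in> A \<and> p \<in> cdom c)"


section \<open>Tangent vectors\<close>

text \<open>A tangent vector at \<open>p\<close> is the family of its coordinate vectors in all charts around \<open>p\<close>; the
  coordinate vectors are related by the derivatives of the transition maps. The entries at all other
  indices are set to \<open>0\<close>. The vector operations are pointwise.\<close>

type_synonym ('m, 'e) tvec = "('m, 'e) chart \<Rightarrow> 'e"

definition tangent_space ::
  "('m, 'e::euclidean_space) chart set \<Rightarrow> 'm \<Rightarrow> ('m, 'e) tvec set" where
  "tangent_space A p =
     {v. (\<forall>c\<in>A. \<forall>d\<in>A. p \<in> cdom c \<inter> cdom d \<longrightarrow>
            v d = frechet_derivative (cmap d \<circ> cinv c) (at (cmap c p)) (v c)) \<and>
         (\<forall>c. \<not> (c \<in> A \<and> p \<in> cdom c) \<longrightarrow> v c = 0)}"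

text \<open>The tangent vector at \<open>p\<close> whose coordinate vector in the chart \<open>c\<close> is \<open>w\<close>.\<close>

definition tvec_of ::
  "('m, 'e::euclidean_space) chart set \<Rightarrow> ('m, 'e) chart \<Rightarrow> 'm \<Rightarrow> 'e \<Rightarrow> ('m, 'e) tvec" where
  "tvec_of A c p w =
     (\<lambda>d. if d \<in> A \<and> p \<in> cdom d
          then frechet_derivative (cmap d \<circ> cinv c) (at (cmap c p)) w else 0)"

definition vector_fields ::
  "('m, 'e::euclidean_space) chart set \<Rightarrow> ('m \<Rightarrow> ('m, 'e) tvec) set" where
  "vector_fields A =
     {X. (\<forall>p. X p \<in> tangent_space A p) \<and> (\<forall>c\<in>A. smooth_on (cimg c) (\<lambda>x. X (cinv c x) c))}"


section \<open>Differential forms\<close>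

text \<open>A \<open>k\<close>-form at \<open>p\<close> is a function of \<open>k\<close> tangent vectors at \<open>p\<close>. To make equality of forms
  equality of functions, it takes the value \<open>0\<close> as soon as an argument is not tangent at \<open>p\<close>.\<close>

type_synonym ('m, 'e) form1 = "'m \<Rightarrow> ('m, 'e) tvec \<Rightarrow> real"
type_synonym ('m, 'e) form2 = "'m \<Rightarrow> ('m, 'e) tvec \<Rightarrow> ('m, 'e) tvec \<Rightarrow> real"
type_synonym ('m, 'e) form3 =
  "'m \<Rightarrow> ('m, 'e) tvec \<Rightarrow> ('m, 'e) tvec \<Rightarrow> ('m, 'e) tvec \<Rightarrow> real"

definition cotangent_space ::
  "('m, 'e::euclidean_space) chart set \<Rightarrow> 'm \<Rightarrow> (('m, 'e) tvec \<Rightarrow> real) set" where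
  "cotangent_space A p =
     {l. (\<forall>u\<in>tangent_space A p. \<forall>v\<in>tangent_space A p. \<forall>a b.
            l (\<lambda>c. a *\<^sub>R u c + b *\<^sub>R v c) = a * l u + b * l v) \<and>
         (\<forall>v. v \<notin> tangent_space A p \<longrightarrow> l v = 0)}"

text \<open>Linearity in the second argument follows from the alternating property below.\<close>

definition alternating2 ::
  "('m, 'e::euclidean_space) chart set \<Rightarrow> 'm
    \<Rightarrow> (('m, 'e) tvec \<Rightarrow> ('m, 'e) tvec \<Rightarrow> real) set" where
  "alternating2 A p =
     {b. (\<forall>v. (\<lambda>u. b u v) \<in> cotangent_space A p) \<and> (\<forall>u v. b u v = - b v u)}"

text \<open>Coordinate expressions: \<open>w\<close>, \<open>u\<close>, \<open>v\<close> are constant vectors in the model space.\<close>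

definition local1 ::
  "('m, 'e::euclidean_space) chart set \<Rightarrow> ('m, 'e) chart \<Rightarrow> ('m, 'e) form1 \<Rightarrow> 'e \<Rightarrow> 'e \<Rightarrow> real"
  where
  "local1 A c \<alpha> w x = \<alpha> (cinv c x) (tvec_of A c (cinv c x) w)"

definition local2 ::
  "('m, 'e::euclidean_space) chart set \<Rightarrow> ('m, 'e) chart \<Rightarrow> ('m, 'e) form2
    \<Rightarrow> 'e \<Rightarrow> 'e \<Rightarrow> 'e \<Rightarrow> real" where
  "local2 A c \<omega> u v x =
     \<omega> (cinv c x) (tvec_of A c (cinv c x) u) (tvec_of A c (cinv c x) v)"

definition forms1 :: "('m, 'e::euclidean_space) chart set \<Rightarrow> ('m, 'e) form1 set" where
  "forms1 A =
     {\<alpha>. (\<forall>p. \<alpha> p \<in> cotangent_space A p) \<and> (\<forall>c\<in>A. \<forall>w. smooth_on (cimg c) (local1 A c \<alpha> w))}"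

definition forms2 :: "('m, 'e::euclidean_space) chart set \<Rightarrow> ('m, 'e) form2 set" where
  "forms2 A =
     {\<omega>. (\<forall>p. \<omega> p \<in> alternating2 A p) \<and>
         (\<forall>c\<in>A. \<forall>u v. smooth_on (cimg c) (local2 A c \<omega> u v))}"

text \<open>Exterior derivatives of functions, 1-forms and 2-forms, by the usual coordinate formulas:
  \<open>df(u) = D\<^sub>u f\<close>, \<open>d\<alpha>(u,v) = D\<^sub>u \<alpha>(v) - D\<^sub>v \<alpha>(u)\<close> and
  \<open>d\<omega>(u,v,w) = D\<^sub>u \<omega>(v,w) - D\<^sub>v \<omega>(u,w) + D\<^sub>w \<omega>(u,v)\<close>, where the arguments that are not being
  used as directions are kept constant in the chart.\<close>

definition d0 :: "('m, 'e::euclidean_space) chart set \<Rightarrow> ('m \<Rightarrow> real) \<Rightarrow> ('m, 'e) form1" where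
  "d0 A f p u =
     (if u \<in> tangent_space A p
      then let c = chart_at A p in frechet_derivative (f \<circ> cinv c) (at (cmap c p)) (u c)
      else 0)"

definition d1 :: "('m, 'e::euclidean_space) chart set \<Rightarrow> ('m, 'e) form1 \<Rightarrow> ('m, 'e) form2" where
  "d1 A \<alpha> p u v =
     (if u \<in> tangent_space A p \<and> v \<in> tangent_space A p
      then let c = chart_at A p; x = cmap c p in
             frechet_derivative (local1 A c \<alpha> (v c)) (at x) (u c)
           - frechet_derivative (local1 A c \<alpha> (u c)) (at x) (v c)
      else 0)"

definition d2 :: "('m, 'e::euclidean_space) chart set \<Rightarrow> ('m, 'e) form2 \<Rightarrow> ('m, 'e) form3" where
  "d2 A \<omega> p u v w =
     (if u \<in> tangent_space A p \<and> v \<in> tangent_space A p \<and> w \<in> tangent_space A p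
      then let c = chart_at A p; x = cmap c p in
             frechet_derivative (local2 A c \<omega> (v c) (w c)) (at x) (u c)
           - frechet_derivative (local2 A c \<omega> (u c) (w c)) (at x) (v c)
           + frechet_derivative (local2 A c \<omega> (u c) (v c)) (at x) (w c)
      else 0)"

definition closed1 :: "('m, 'e::euclidean_space) chart set \<Rightarrow> ('m, 'e) form1 \<Rightarrow> bool" where
  "closed1 A \<alpha> \<longleftrightarrow> \<alpha> \<in> forms1 A \<and> d1 A \<alpha> = (\<lambda>p u v. 0)"

definition closed2 :: "('m, 'e::euclidean_space) chart set \<Rightarrow> ('m, 'e) form2 \<Rightarrow> bool" where
  "closed2 A \<omega> \<longleftrightarrow> \<omega> \<in> forms2 A \<and> d2 A \<omega> = (\<lambda>p u v w. 0)"


section \<open>Smooth families indexed by the unit interval\<close>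

definition smooth_family0 ::
  "('m, 'e::euclidean_space) chart set \<Rightarrow> (real \<Rightarrow> 'm \<Rightarrow> real) \<Rightarrow> bool" where
  "smooth_family0 A f \<longleftrightarrow> (\<forall>c\<in>A. smooth_on ({0..1} \<times> cimg c) (\<lambda>(t, x). f t (cinv c x)))"

definition smooth_family1 ::
  "('m, 'e::euclidean_space) chart set \<Rightarrow> (real \<Rightarrow> ('m, 'e) form1) \<Rightarrow> bool" where
  "smooth_family1 A \<alpha> \<longleftrightarrow>
     (\<forall>t\<in>{0..1}. \<alpha> t \<in> forms1 A) \<and>
     (\<forall>c\<in>A. \<forall>w. smooth_on ({0..1} \<times> cimg c) (\<lambda>(t, x). local1 A c (\<alpha> t) w x))"

definition smooth_family2 ::
  "('m, 'e::euclidean_space) chart set \<Rightarrow> (real \<Rightarrow> ('m, 'e) form2) \<Rightarrow> bool" where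
  "smooth_family2 A \<omega> \<longleftrightarrow>
     (\<forall>t\<in>{0..1}. \<omega> t \<in> forms2 A) \<and>
     (\<forall>c\<in>A. \<forall>u v. smooth_on ({0..1} \<times> cimg c) (\<lambda>(t, x). local2 A c (\<omega> t) u v x))"

text \<open>\<open>\<partial>/\<partial>t \<alpha>\<^sub>t = \<beta>\<^sub>t\<close> on \<open>[0,1]\<close>, one-sided at the endpoints.\<close>

definition time_derivative1 ::
  "(real \<Rightarrow> ('m, 'e) form1) \<Rightarrow> (real \<Rightarrow> ('m, 'e) form1) \<Rightarrow> bool" where
  "time_derivative1 \<alpha> \<beta> \<longleftrightarrow>
     (\<forall>t\<in>{0..1}. \<forall>p u.
        ((\<lambda>s. \<alpha> s p u) has_real_derivative \<beta> t p u) (at t within {0..1}))"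

definition time_derivative2 ::
  "(real \<Rightarrow> ('m, 'e) form2) \<Rightarrow> (real \<Rightarrow> ('m, 'e) form2) \<Rightarrow> bool" where
  "time_derivative2 \<omega> \<sigma> \<longleftrightarrow>
     (\<forall>t\<in>{0..1}. \<forall>p u v.
        ((\<lambda>s. \<omega> s p u v) has_real_derivative \<sigma> t p u v) (at t within {0..1}))"


section \<open>Cosymplectic structures\<close>

text \<open>The pointwise map \<open>Y \<mapsto> \<iota>\<^sub>Y \<omega> + \<eta>(Y) \<eta>\<close> from tangent to cotangent vectors at \<open>p\<close>, and the
  induced map on vector fields. Since forms vanish on arguments that are not tangent at \<open>p\<close>, so do
  the values of these maps.\<close>

definition flat ::
  "('m, 'e) form1 \<Rightarrow> ('m, 'e) form2 \<Rightarrow> 'm \<Rightarrow> ('m, 'e) tvec \<Rightarrow> ('m, 'e) tvec \<Rightarrow> real" where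
  "flat \<eta> \<omega> p Y = (\<lambda>v. \<omega> p Y v + \<eta> p Y * \<eta> p v)"

definition Itilde ::
  "('m, 'e) form1 \<Rightarrow> ('m, 'e) form2 \<Rightarrow> ('m \<Rightarrow> ('m, 'e) tvec) \<Rightarrow> ('m, 'e) form1" where
  "Itilde \<eta> \<omega> X = (\<lambda>p. flat \<eta> \<omega> p (X p))"

definition cosymplectic ::
  "('m, 'e::euclidean_space) chart set \<Rightarrow> ('m, 'e) form2 \<Rightarrow> ('m, 'e) form1 \<Rightarrow> bool" where
  "cosymplectic A \<omega> \<eta> \<longleftrightarrow>
     closed2 A \<omega> \<and> closed1 A \<eta> \<and>
     (\<forall>p. \<eta> p \<noteq> (\<lambda>v. 0) \<and>
          bij_betw (flat \<eta> \<omega> p) (tangent_space A p) (cotangent_space A p))"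

text \<open>\<open>\<xi> = Itilde\<^sup>-\<^sup>1(\<eta>)\<close>, the inverse being taken on smooth vector fields.\<close>

definition reeb ::
  "('m, 'e::euclidean_space) chart set \<Rightarrow> ('m, 'e) form2 \<Rightarrow> ('m, 'e) form1
    \<Rightarrow> 'm \<Rightarrow> ('m, 'e) tvec" where
  "reeb A \<omega> \<eta> = the_inv_into (vector_fields A) (Itilde \<eta> \<omega>) \<eta>"


section \<open>Diffeomorphisms, isotopies and pullbacks\<close>

definition smooth_map ::
  "('m::topological_space, 'e::euclidean_space) chart set \<Rightarrow> ('m \<Rightarrow> 'm) \<Rightarrow> bool" where
  "smooth_map A F \<longleftrightarrow>
     continuous_on UNIV F \<and>
     (\<forall>c\<in>A. \<forall>d\<in>A. smooth_on {x \<in> cimg c. F (cinv c x) \<in> cdom d} (cmap d \<circ> F \<circ> cinv c))"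

definition diffeomorphism ::
  "('m::topological_space, 'e::euclidean_space) chart set \<Rightarrow> ('m \<Rightarrow> 'm) \<Rightarrow> bool" where
  "diffeomorphism A F \<longleftrightarrow> bij F \<and> smooth_map A F \<and> smooth_map A (inv F)"

definition isotopy ::
  "('m::topological_space, 'e::euclidean_space) chart set \<Rightarrow> (real \<Rightarrow> 'm \<Rightarrow> 'm) \<Rightarrow> bool" where
  "isotopy A \<phi> \<longleftrightarrow>
     (\<forall>t\<in>{0..1}. diffeomorphism A (\<phi> t)) \<and> \<phi> 0 = id \<and>
     continuous_on ({0..1} \<times> UNIV) (\<lambda>(t, p). \<phi> t p) \<and>
     (\<forall>c\<in>A. \<forall>d\<in>A.
        smooth_on {(t, x). t \<in> {0..1} \<and> x \<in> cimg c \<and> \<phi> t (cinv c x) \<in> cdom d}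
          (\<lambda>(t, x). cmap d (\<phi> t (cinv c x))))"

text \<open>The differential of \<open>F\<close> at \<open>p\<close>.\<close>

definition tangent_map ::
  "('m, 'e::euclidean_space) chart set \<Rightarrow> ('m \<Rightarrow> 'm) \<Rightarrow> 'm \<Rightarrow> ('m, 'e) tvec \<Rightarrow> ('m, 'e) tvec"
  where
  "tangent_map A F p v =
     (\<lambda>d. if d \<in> A \<and> F p \<in> cdom d
          then let c = chart_at A p in
                 frechet_derivative (cmap d \<circ> F \<circ> cinv c) (at (cmap c p)) (v c)
          else 0)"

definition pullback1 ::
  "('m, 'e::euclidean_space) chart set \<Rightarrow> ('m \<Rightarrow> 'm) \<Rightarrow> ('m, 'e) form1 \<Rightarrow> ('m, 'e) form1" where
  "pullback1 A F \<alpha> p u =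
     (if u \<in> tangent_space A p then \<alpha> (F p) (tangent_map A F p u) else 0)"

definition pullback2 ::
  "('m, 'e::euclidean_space) chart set \<Rightarrow> ('m \<Rightarrow> 'm) \<Rightarrow> ('m, 'e) form2 \<Rightarrow> ('m, 'e) form2" where
  "pullback2 A F \<omega> p u v =
     (if u \<in> tangent_space A p \<and> v \<in> tangent_space A p
      then \<omega> (F p) (tangent_map A F p u) (tangent_map A F p v) else 0)"

end

(*
The Moser trick. Let xi_t be the Reeb field and g_t = alpha_t(xi_t). The time-dependent vector
field X_t determined by flat(X_t) = -alpha_t + (g_t - f_t) eta_t satisfies eta_t(X_t) = -f_t and
i_(X_t) omega_t = -alpha_t + g_t eta_t: evaluate on xi_t and use eta_t(xi_t) = 1 and
i_(xi_t) omega_t = 0, which hold because omega_t has a kernel in odd dimension. As d g_t = 0 by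
(iii), L_(X_t) omega_t = -d alpha_t and L_(X_t) eta_t = -d f_t, so the pullbacks of omega_t and
eta_t by the flow of X_t are constant in t.

Solutions of ordinary differential equations on short intervals come from Picard iteration. The
derivative of the flow in the initial value solves the linearised equation, and every higher
derivative solves a linear equation with the same linear part, hence exists on the same interval.
Compactness of [0,1] x M gives a uniform lifetime for the local flows, so integral curves extend
to [0,1].
*)

theory Submission
  imports Defs
begin

section \<open>Calculus of \<open>C^k\<close> maps\<close>

text \<open>Families are smooth on \<open>[0,1]\<close> up to the boundary, so in a chart the field
  is first extended to an open set of times. Equations are solved on open intervals with two-sided
  derivatives, and only the part over \<open>[0,1]\<close> is kept; uniqueness of integral curves
  inside \<open>[0,1]\<close> makes the result independent of the extension.

  Estimates on solutions use intervals so short that the Lipschitz constant times the length is at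
  most a half, or a quarter where a derivative is estimated. \<open>Ck_on\<close> controls
  derivatives in fixed directions only, which is why families of linear maps are expanded in
  \<open>Basis\<close> again and again.

  Cartan's formula appears in coordinates only. The value of the pulled-back form is a function of
  the moving point and the transported vectors; the latter obey the variational equation, so its
  time derivative involves only first derivatives of the field. The cancellation follows by
  differentiating the two equations satisfied by \<open>X\<close> and by closedness. As the exterior
  derivatives are defined through \<open>chart_at\<close>, this is computed in the chart assigned to
  the moving point at the time considered.\<close>

lemma Ck_on_subset: "Ck_on k S f \<Longrightarrow> T \<subseteq> S \<Longrightarrow> Ck_on k T f"
  by (induction k arbitrary: f) (auto intro: continuous_on_subset)

lemma Ck_on_SucD:
  assumes "Ck_on (Suc k) S f" "x \<in> S"
  shows "(f has_derivative frechet_derivative f (at x)) (at x)"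
  using assms by (simp add: frechet_derivative_works[symmetric])

text \<open>Openness of \<open>S\<close> is the point: derivatives at points of \<open>S\<close>
  then depend only on values in \<open>S\<close>, so the recursion passes from \<open>f\<close> to
  \<open>g\<close>.\<close>

lemma Ck_on_cong:
  assumes "open S" "\<And>x. x \<in> S \<Longrightarrow> f x = g x" "Ck_on k S f"
  shows "Ck_on k S g"
  using assms(2,3)
proof (induction k arbitrary: f g)
  case 0
  then show ?case by (simp cong: continuous_on_cong)
next
  case (Suc k)
  have d: "(g has_derivative frechet_derivative f (at x)) (at x)" if "x \<in> S" for x
    by (rule has_derivative_transform_within_open[OF Ck_on_SucD[OF Suc.prems(2) that] assms(1)
        that])
      (use Suc.prems in auto)
  have e: "frechet_derivative f (at x) = frechet_derivative g (at x)" if "x \<in> S" for x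
    by (rule frechet_derivative_at[OF d[OF that]])
  have "Ck_on k S (\<lambda>x. frechet_derivative g (at x) v)" for v
    by (rule Suc.IH[of "\<lambda>x. frechet_derivative f (at x) v"]) (use Suc.prems e in auto)
  then show ?case
    using d by (auto intro: differentiableI)
qed

text \<open>Any derivative found by the calculus rules may stand in for
  \<open>frechet_derivative\<close>, since full derivatives are unique. Most regularity proofs below
  go through this rule.\<close>

lemma Ck_on_SucI:
  assumes "open S" "\<And>x. x \<in> S \<Longrightarrow> (f has_derivative f' x) (at x)"
    and "\<And>v. Ck_on k S (\<lambda>x. f' x v)"
  shows "Ck_on (Suc k) S f"
proof -
  have "frechet_derivative f (at x) = f' x" if "x \<in> S" for x
    using frechet_derivative_at[OF assms(2)[OF that]] by simp
  then have "Ck_on k S (\<lambda>x. frechet_derivative f (at x) v)" for v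
    by (intro Ck_on_cong[OF assms(1) _ assms(3)[of v]]) auto
  then show ?thesis
    using assms(2) by (auto intro: differentiableI)
qed

lemma Ck_on_imp_continuous_on:
  assumes "Ck_on k S f"
  shows "continuous_on S f"
proof (cases k)
  case (Suc j)
  with assms have "isCont f x" if "x \<in> S" for x
    using that by (simp add: differentiable_imp_continuous_within)
  then show ?thesis by (simp add: continuous_at_imp_continuous_on)
qed (use assms in simp)

lemma Ck_on_Suc_imp: "Ck_on (Suc k) S f \<Longrightarrow> Ck_on k S f"
proof (induction k arbitrary: f)
  case 0
  then show ?case using Ck_on_imp_continuous_on[OF 0] by simp
next
  case (Suc k)
  then show ?case by simp
qed

lemma Ck_on_mono: "Ck_on k S f \<Longrightarrow> j \<le> k \<Longrightarrow> Ck_on j S f"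
proof (induction k)
  case (Suc k)
  then show ?case using Ck_on_Suc_imp[of k S f] by (cases "j = Suc k") auto
qed auto

lemma Ck_on_const [simp]: "Ck_on k S (\<lambda>x. c)"
  by (induction k arbitrary: c) auto

lemma Ck_on_bounded_linear:
  assumes "bounded_linear f"
  shows "Ck_on k S f"
proof (cases k)
  case 0
  then show ?thesis using assms by (simp add: linear_continuous_on)
next
  case (Suc j)
  have d: "(f has_derivative f) (at x)" for x
    using assms by (rule bounded_linear_imp_has_derivative)
  then have "frechet_derivative f (at x) = f" for x
    using frechet_derivative_at by metis
  with d show ?thesis using Suc by (auto simp: differentiable_def)
qed

lemma Ck_on_add:
  assumes "open S" "Ck_on k S f" "Ck_on k S g"
  shows "Ck_on k S (\<lambda>x. f x + g x)"
  using assms(2,3)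
proof (induction k arbitrary: f g)
  case 0
  then show ?case by (simp add: continuous_on_add)
next
  case (Suc k)
  show ?case
    by (rule Ck_on_SucI[OF assms(1), where
          f' = "\<lambda>x v. frechet_derivative f (at x) v + frechet_derivative g (at x) v"])
      (use Suc in \<open>auto intro!: has_derivative_add Ck_on_SucD\<close>)
qed

lemma Ck_on_sum:
  assumes "open S" "\<And>i. i \<in> I \<Longrightarrow> Ck_on k S (f i)"
  shows "Ck_on k S (\<lambda>x. \<Sum>i\<in>I. f i x)"
  using assms(2)
  by (induction I rule: infinite_finite_induct) (auto intro!: Ck_on_add[OF assms(1)])

text \<open>One Leibniz induction serves scalar multiples, real products and inner products. Each
  summand pairs a factor with a derivative of the other, so the induction generalizes over
  both.\<close>

lemma Ck_on_bilinear:
  assumes "bounded_bilinear prd" "open S" "Ck_on k S f" "Ck_on k S g"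
  shows "Ck_on k S (\<lambda>x. prd (f x) (g x))"
  using assms(3,4)
proof (induction k arbitrary: f g)
  case 0
  then show ?case
    using bounded_bilinear.continuous_on[OF assms(1)] by auto
next
  case (Suc k)
  show ?case
  proof (rule Ck_on_SucI[OF assms(2), where
        f' = "\<lambda>x v. prd (f x) (frechet_derivative g (at x) v) + prd (frechet_derivative f (at x)
            v) (g x)"])
    show "((\<lambda>x. prd (f x) (g x)) has_derivative
          (\<lambda>v. prd (f x) (frechet_derivative g (at x) v) + prd (frechet_derivative f (at x) v) (g
              x))) (at x)"
      if "x \<in> S" for x
      using bounded_bilinear.FDERIV[OF assms(1) Ck_on_SucD[OF Suc.prems(1) that]
          Ck_on_SucD[OF Suc.prems(2) that]] .
    show "Ck_on k S (\<lambda>x. prd (f x) (frechet_derivative g (at x) v)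
        + prd (frechet_derivative f (at x) v) (g x))" for v
      by (intro Ck_on_add[OF assms(2)] Suc.IH)
        (use Suc.prems Ck_on_Suc_imp in auto)
  qed
qed

text \<open>\<open>Ck_on\<close> and the smoothness of forms control linear families one fixed
  argument at a time. This expansion turns a varying argument into a finite sum of such
  functions.\<close>

lemma linear_expand_Basis:
  fixes f :: "'a::euclidean_space \<Rightarrow> 'b::real_vector"
  assumes "linear f"
  shows "f v = (\<Sum>b\<in>Basis. (v \<bullet> b) *\<^sub>R f b)"
proof -
  have "f v = f (\<Sum>b\<in>Basis. (v \<bullet> b) *\<^sub>R b)"
    by (simp add: euclidean_representation)
  also have "\<dots> = (\<Sum>b\<in>Basis. (v \<bullet> b) *\<^sub>R f b)"
    using assms by (simp add: linear_sum linear_scale)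
  finally show ?thesis .
qed

lemma Ck_on_compose:
  fixes f :: "'a::euclidean_space \<Rightarrow> 'b::euclidean_space" and g :: "'b \<Rightarrow> 'c::real_normed_vector"
  assumes "open S" "f ` S \<subseteq> T" "Ck_on k S f" "Ck_on k T g"
  shows "Ck_on k S (\<lambda>x. g (f x))"
  using assms(3,4)
proof (induction k arbitrary: g)
  case 0
  then show ?case using continuous_on_compose2[of T g S f] assms(2) by auto
next
  case (Suc k)
  have fx: "f x \<in> T" if "x \<in> S" for x
    using that assms(2) by auto
  have g': "(g has_derivative frechet_derivative g (at (f x))) (at (f x))" if "x \<in> S" for x
    using Suc.prems(2) fx[OF that] by (rule Ck_on_SucD)
  show ?case
  proof (rule Ck_on_SucI[OF assms(1), where
        f' = "\<lambda>x v. frechet_derivative g (at (f x)) (frechet_derivative f (at x) v)"])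
    show "((\<lambda>x. g (f x)) has_derivative
        (\<lambda>v. frechet_derivative g (at (f x)) (frechet_derivative f (at x) v))) (at x)"
      if "x \<in> S" for x
      using has_derivative_compose[OF Ck_on_SucD[OF Suc.prems(1) that] g'[OF that]] .
    show "Ck_on k S (\<lambda>x. frechet_derivative g (at (f x)) (frechet_derivative f (at x) v))" for v
    \<comment> \<open>The direction in which \<open>g\<close> is differentiated moves with
      \<open>x\<close>, whereas the induction hypothesis speaks of fixed directions; the expansion
      in \<open>Basis\<close> reconciles the two.\<close>
    proof (rule Ck_on_cong[OF assms(1)])
      show "(\<Sum>b\<in>Basis. (frechet_derivative f (at x) v \<bullet> b) *\<^sub>R frechet_derivative g (at (f x)) b)
        = frechet_derivative g (at (f x)) (frechet_derivative f (at x) v)" if "x \<in> S" for x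
        using linear_expand_Basis[OF has_derivative_linear[OF g'[OF that]]] by metis
      show "Ck_on k S (\<lambda>x. \<Sum>b\<in>Basis. (frechet_derivative f (at x) v \<bullet> b) *\<^sub>R
          frechet_derivative g (at (f x)) b)"
        by (intro Ck_on_sum[OF assms(1)] Ck_on_bilinear[OF bounded_bilinear_scaleR assms(1)]
            Ck_on_bilinear[OF bounded_bilinear_inner assms(1)] Suc.IH)
          (use Suc.prems in \<open>auto simp: Ck_on_Suc_imp\<close>)
    qed
  qed
qed

lemma Ck_on_linear_comp:
  assumes "bounded_linear L" "open S" "Ck_on k S f"
  shows "Ck_on k S (\<lambda>x. L (f x))"
  using assms(3)
proof (induction k arbitrary: f)
  case 0
  then show ?case using bounded_linear.continuous_on[OF assms(1)] by auto
next
  case (Suc k)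
  show ?case
    by (rule Ck_on_SucI[OF assms(2), where f' = "\<lambda>x v. L (frechet_derivative f (at x) v)"])
      (use Suc in \<open>auto intro!: bounded_linear.has_derivative[OF assms(1)] Ck_on_SucD\<close>)
qed

lemma Ck_on_Pair:
  assumes "open S" "Ck_on k S f" "Ck_on k S g"
  shows "Ck_on k S (\<lambda>x. (f x, g x))"
proof -
  have "bounded_linear (\<lambda>x. (x, 0))" "bounded_linear (Pair 0)"
    by (auto intro: bounded_linear_Pair bounded_linear_ident bounded_linear_zero)
  from Ck_on_add[OF assms(1) Ck_on_linear_comp[OF this(1) assms(1,2)]
      Ck_on_linear_comp[OF this(2) assms(1,3)]]
  show ?thesis by simp
qed

lemma Ck_on_local:
  assumes "\<And>x. x \<in> S \<Longrightarrow> \<exists>U. open U \<and> x \<in> U \<and> Ck_on k U f"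
  shows "Ck_on k S f"
  using assms
proof (induction k arbitrary: f)
  case 0
  have "isCont f x" if "x \<in> S" for x
    using 0[OF that] by (auto simp: continuous_on_eq_continuous_at)
  then show ?case by (simp add: continuous_at_imp_continuous_on)
next
  case (Suc k)
  have "f differentiable at x" if "x \<in> S" for x
    using Suc.prems[OF that] by auto
  moreover have "Ck_on k S (\<lambda>x. frechet_derivative f (at x) v)" for v
  proof (rule Suc.IH)
    fix x assume "x \<in> S"
    then obtain U where "open U" "x \<in> U" "Ck_on (Suc k) U f" using Suc.prems by blast
    then show "\<exists>U. open U \<and> x \<in> U \<and> Ck_on k U (\<lambda>x. frechet_derivative f (at x) v)" by auto
  qed
  ultimately show ?case by simp
qed

section \<open>Smooth maps on arbitrary sets, by local extension\<close>

lemma smooth_on_openI: "open S \<Longrightarrow> (\<And>k. Ck_on k S f) \<Longrightarrow> smooth_on S f"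
  unfolding smooth_on_def by blast

text \<open>Over an open set a local extension agrees with \<open>f\<close> on a whole
  neighbourhood, so its regularity is that of \<open>f\<close>; and \<open>Ck_on\<close> is a local
  property.\<close>

lemma smooth_on_open_iff:
  assumes "open S"
  shows "smooth_on S f \<longleftrightarrow> (\<forall>k. Ck_on k S f)"
proof
  assume L: "smooth_on S f"
  show "\<forall>k. Ck_on k S f"
  proof
    fix k
    show "Ck_on k S f"
    proof (rule Ck_on_local)
      fix x assume "x \<in> S"
      then obtain U g where U: "open U" "x \<in> U" "Ck_on k U g" "\<forall>y\<in>U \<inter> S. g y = f y"
        using L unfolding smooth_on_def by meson
      have "Ck_on k (U \<inter> S) f"
        using Ck_on_cong[of "U \<inter> S" g f k] Ck_on_subset[OF U(3), of "U \<inter> S"] U(1,4) assms by auto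
      with U \<open>x \<in> S\<close> assms show "\<exists>U. open U \<and> x \<in> U \<and> Ck_on k U f" by blast
    qed
  qed
qed (simp add: assms smooth_on_openI)

lemma smooth_onE:
  assumes "smooth_on S f" "x \<in> S"
  obtains U g where "open U" "x \<in> U" "\<forall>k. Ck_on k U g" "\<forall>y\<in>U \<inter> S. g y = f y"
  using assms unfolding smooth_on_def by meson

lemma smooth_onI:
  assumes "\<And>x. x \<in> S \<Longrightarrow> \<exists>U g. open U \<and> x \<in> U \<and> (\<forall>k. Ck_on k U g) \<and> (\<forall>y\<in>U \<inter> S. g y = f y)"
  shows "smooth_on S f"
  using assms unfolding smooth_on_def by blast

lemma local_extensionI:
  assumes "open U" "x \<in> U" "\<And>k. Ck_on k U g" "\<And>y. y \<in> U \<Longrightarrow> y \<in> S \<Longrightarrow> g y = f y"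
  shows "\<exists>U g. open U \<and> x \<in> U \<and> (\<forall>k. Ck_on k U g) \<and> (\<forall>y\<in>U \<inter> S. g y = f y)"
  using assms by (intro exI[of _ U] exI[of _ g]) simp

lemma smooth_on_subset:
  assumes "smooth_on S f" "T \<subseteq> S"
  shows "smooth_on T f"
proof (rule smooth_onI)
  fix x assume "x \<in> T"
  with assms have "x \<in> S" by auto
  from assms(1) this obtain U g
    where U: "open U" "x \<in> U" "\<forall>k. Ck_on k U g" "\<forall>y\<in>U \<inter> S. g y = f y"
    by (rule smooth_onE)
  show "\<exists>U g. open U \<and> x \<in> U \<and> (\<forall>k. Ck_on k U g) \<and> (\<forall>y\<in>U \<inter> T. g y = f y)"
    by (rule local_extensionI[of U x g]) (use U assms(2) in auto)
qed

lemma smooth_on_cong: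
  assumes "smooth_on S f" "\<And>x. x \<in> S \<Longrightarrow> f x = g x"
  shows "smooth_on S g"
proof (rule smooth_onI)
  fix x assume "x \<in> S"
  from assms(1) this obtain U h
    where U: "open U" "x \<in> U" "\<forall>k. Ck_on k U h" "\<forall>y\<in>U \<inter> S. h y = f y"
    by (rule smooth_onE)
  show "\<exists>U h. open U \<and> x \<in> U \<and> (\<forall>k. Ck_on k U h) \<and> (\<forall>y\<in>U \<inter> S. h y = g y)"
    by (rule local_extensionI[of U x h]) (use U assms(2) in auto)
qed

lemma smooth_on_local:
  assumes "\<And>x. x \<in> S \<Longrightarrow> \<exists>U. open U \<and> x \<in> U \<and> smooth_on (U \<inter> S) f"
  shows "smooth_on S f"
proof (rule smooth_onI)
  fix x assume x: "x \<in> S"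
  then obtain U where U: "open U" "x \<in> U" "smooth_on (U \<inter> S) f" using assms by blast
  then have "x \<in> U \<inter> S" using x by simp
  with U(3) obtain V g where V: "open V" "x \<in> V" "\<forall>k. Ck_on k V g"
    "\<forall>y\<in>V \<inter> (U \<inter> S). g y = f y"
    by (rule smooth_onE)
  have "Ck_on k (U \<inter> V) g" for k
    using Ck_on_subset[OF V(3)[rule_format]] by simp
  then show "\<exists>U g. open U \<and> x \<in> U \<and> (\<forall>k. Ck_on k U g) \<and> (\<forall>y\<in>U \<inter> S. g y = f y)"
    by (intro local_extensionI[of "U \<inter> V" x g]) (use U(1,2) V(1,2,4) in auto)
qed

lemma smooth_on_compose:
  fixes f :: "'a::euclidean_space \<Rightarrow> 'b::euclidean_space" and g :: "'b \<Rightarrow> 'c::real_normed_vector"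
  assumes "smooth_on S f" "smooth_on T g" "f ` S \<subseteq> T"
  shows "smooth_on S (\<lambda>x. g (f x))"
proof (rule smooth_onI)
  fix x assume x: "x \<in> S"
  obtain U f' where U: "open U" "x \<in> U" "\<forall>k. Ck_on k U f'" "\<forall>y\<in>U \<inter> S. f' y = f y"
    using smooth_onE[OF assms(1) x] by metis
  obtain V g' where V: "open V" "f x \<in> V" "\<forall>k. Ck_on k V g'" "\<forall>y\<in>V \<inter> T. g' y = g y"
    using smooth_onE[OF assms(2), of "f x"] x assms(3) by blast
  \<comment> \<open>Shrinking to the preimage of \<open>V\<close> keeps the extension
    \<open>f'\<close> inside the domain of \<open>g'\<close>, also at points outside
    \<open>S\<close>.\<close>
  define W where "W = U \<inter> f' -` V"
  have W: "open W" unfolding W_def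
    using U(1) V(1) Ck_on_imp_continuous_on[OF U(3)[rule_format, of 0]] continuous_open_preimage
        by blast
  have xW: "x \<in> W" using U(2,4) V(2) x by (auto simp: W_def)
  have CW: "Ck_on k W (\<lambda>x. g' (f' x))" for k
  proof (rule Ck_on_compose[OF W _ _ V(3)[rule_format]])
    show "f' ` W \<subseteq> V" "Ck_on k W f'"
      using Ck_on_subset[OF U(3)[rule_format], of W] by (auto simp: W_def)
  qed
  have eq: "g' (f' y) = g (f y)" if "y \<in> W" "y \<in> S" for y
  proof -
    have y: "y \<in> U" "f' y \<in> V" "y \<in> S" using that by (auto simp: W_def)
    then have "f' y = f y" "f y \<in> T" using U(4) assms(3) by auto
    with V(4) y(2) show ?thesis by (metis IntI)
  qed
  show "\<exists>U h. open U \<and> x \<in> U \<and> (\<forall>k. Ck_on k U h) \<and> (\<forall>y\<in>U \<inter> S. h y = g (f y))"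
    by (rule local_extensionI[of W x "\<lambda>x. g' (f' x)"]) (fact W xW CW eq)+
qed

lemma smooth_on_Pair:
  assumes "smooth_on S f" "smooth_on S g"
  shows "smooth_on S (\<lambda>x. (f x, g x))"
proof (rule smooth_onI)
  fix x assume x: "x \<in> S"
  obtain U f' where U: "open U" "x \<in> U" "\<forall>k. Ck_on k U f'" "\<forall>y\<in>U \<inter> S. f' y = f y"
    using smooth_onE[OF assms(1) x] by metis
  obtain V g' where V: "open V" "x \<in> V" "\<forall>k. Ck_on k V g'" "\<forall>y\<in>V \<inter> S. g' y = g y"
    using smooth_onE[OF assms(2) x] by metis
  have "Ck_on k (U \<inter> V) (\<lambda>x. (f' x, g' x))" for k
    using U(1) V(1) Ck_on_subset[OF U(3)[rule_format], of "U \<inter> V"] Ck_on_subset[OF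
        V(3)[rule_format], of "U \<inter> V"]
    by (intro Ck_on_Pair) auto
  then show "\<exists>U h. open U \<and> x \<in> U \<and> (\<forall>k. Ck_on k U h) \<and> (\<forall>y\<in>U \<inter> S. h y = (f y, g y))"
    by (intro local_extensionI[of "U \<inter> V" x "\<lambda>x. (f' x, g' x)"])
      (use U(1,2,4) V(1,2,4) in auto)
qed

lemma smooth_on_bounded_linear: "bounded_linear f \<Longrightarrow> smooth_on S f"
  by (rule smooth_on_subset[OF smooth_on_openI[OF open_UNIV Ck_on_bounded_linear]]) simp_all

lemma smooth_on_const: "smooth_on S (\<lambda>x. c)"
  by (rule smooth_on_subset[OF smooth_on_openI[OF open_UNIV Ck_on_const]]) simp

lemma smooth_on_bilinear:
  fixes f :: "'a::euclidean_space \<Rightarrow> 'b::euclidean_space" and g :: "'a \<Rightarrow> 'c::euclidean_space"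
    and prd :: "'b \<Rightarrow> 'c \<Rightarrow> 'd::real_normed_vector"
  assumes "bounded_bilinear prd" "smooth_on S f" "smooth_on S g"
  shows "smooth_on S (\<lambda>x. prd (f x) (g x))"
proof -
  have "smooth_on UNIV (\<lambda>p. prd (fst p) (snd p))"
    by (intro smooth_on_openI Ck_on_bilinear[OF assms(1)] Ck_on_bounded_linear
        bounded_linear_fst bounded_linear_snd) auto
  from smooth_on_compose[OF smooth_on_Pair[OF assms(2,3)] this] show ?thesis by simp
qed

lemma smooth_on_linear_comp:
  fixes f :: "'a::euclidean_space \<Rightarrow> 'b::euclidean_space"
  assumes "bounded_linear L" "smooth_on S f"
  shows "smooth_on S (\<lambda>x. L (f x))"
  using smooth_on_compose[OF assms(2) smooth_on_bounded_linear[OF assms(1), of UNIV]] by simp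

lemma smooth_on_add:
  fixes f g :: "'a::euclidean_space \<Rightarrow> 'b::euclidean_space"
  assumes "smooth_on S f" "smooth_on S g"
  shows "smooth_on S (\<lambda>x. f x + g x)"
  using smooth_on_linear_comp[OF bounded_linear_add[OF bounded_linear_fst bounded_linear_snd]
      smooth_on_Pair[OF assms]] by simp

lemma smooth_on_minus:
  fixes f g :: "'a::euclidean_space \<Rightarrow> 'b::euclidean_space"
  assumes "smooth_on S f" "smooth_on S g"
  shows "smooth_on S (\<lambda>x. f x - g x)"
  using smooth_on_linear_comp[OF bounded_linear_sub[OF bounded_linear_fst bounded_linear_snd]
      smooth_on_Pair[OF assms]] by simp

lemma smooth_on_sum:
  fixes f :: "'i \<Rightarrow> 'a::euclidean_space \<Rightarrow> 'b::euclidean_space"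
  assumes "\<And>i. i \<in> I \<Longrightarrow> smooth_on S (f i)"
  shows "smooth_on S (\<lambda>x. \<Sum>i\<in>I. f i x)"
  using assms
  by (induction I rule: infinite_finite_induct) (auto intro!: smooth_on_add smooth_on_const)

section \<open>Linear systems depending on a parameter\<close>

lemma norm_linear_diff_le:
  fixes f g :: "'a::euclidean_space \<Rightarrow> 'b::real_normed_vector"
  assumes "linear f" "linear g"
  shows "norm (f w - g w) \<le> (\<Sum>b\<in>Basis. norm (f b - g b)) * norm w"
proof -
  have "f w - g w = (\<Sum>b\<in>Basis. (w \<bullet> b) *\<^sub>R (f b - g b))"
    unfolding linear_expand_Basis[OF assms(1), of w] linear_expand_Basis[OF assms(2), of w]
    by (simp add: sum_subtractf scaleR_diff_right)
  also have "norm \<dots> \<le> (\<Sum>b\<in>Basis. norm (f b - g b) * norm w)"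
    by (intro sum_norm_le) (simp add: Basis_le_norm mult.commute mult_right_mono)
  finally show ?thesis by (simp add: sum_distrib_right)
qed

text \<open>Injectivity gives a lower bound \<open>B\<close> at \<open>x0\<close>. Continuity of the
  columns keeps the difference of the maps below \<open>B / 2\<close> in norm near
  \<open>x0\<close>, so half of the bound survives. This replaces a bound on the inverse
  matrices.\<close>

lemma linear_family_bounded_below:
  fixes M :: "'a::t2_space \<Rightarrow> 'e::euclidean_space \<Rightarrow> 'e"
  assumes "\<And>x. x \<in> S \<Longrightarrow> linear (M x)" "x0 \<in> S" "inj (M x0)"
    and "\<And>b. b \<in> Basis \<Longrightarrow> continuous (at x0 within S) (\<lambda>x. M x b)"
  shows "\<exists>c>0. \<forall>\<^sub>F x in at x0 within S. \<forall>w. c * norm w \<le> norm (M x w)"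
proof -
  obtain B where B: "B > 0" "\<And>w. B * norm w \<le> norm (M x0 w)"
    using linear_inj_bounded_below_pos[OF assms(1)[OF assms(2)] assms(3)] by metis
  have "((\<lambda>x. \<Sum>b\<in>Basis. norm (M x b - M x0 b)) \<longlongrightarrow> (\<Sum>b\<in>Basis. norm (M x0 b - M x0 b)))
      (at x0 within S)"
    using assms(4) by (intro tendsto_intros) (simp add: continuous_within)
  then have "((\<lambda>x. \<Sum>b\<in>Basis. norm (M x b - M x0 b)) \<longlongrightarrow> 0) (at x0 within S)" by simp
  then have "\<forall>\<^sub>F x in at x0 within S. (\<Sum>b\<in>Basis. norm (M x b - M x0 b)) < B / 2"
    using B(1) by (intro order_tendstoD(2)) auto
  moreover have "\<forall>\<^sub>F x in at x0 within S. x \<in> S"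
    by (simp add: eventually_at_filter)
  ultimately have "\<forall>\<^sub>F x in at x0 within S. \<forall>w. B / 2 * norm w \<le> norm (M x w)"
  proof eventually_elim
    case (elim x)
    show ?case
    proof
      fix w
      have "norm (M x w - M x0 w) \<le> B / 2 * norm w"
        using norm_linear_diff_le[OF assms(1)[OF elim(2)] assms(1)[OF assms(2)], of w] elim(1)
        by (meson less_imp_le mult_right_mono norm_ge_zero order_trans)
      with B(2)[of w] norm_triangle_ineq2[of "M x0 w" "M x w"]
      show "B / 2 * norm w \<le> norm (M x w)" by (simp add: norm_minus_commute)
    qed
  qed
  with B(1) show ?thesis by (intro exI[of _ "B / 2"]) auto
qed

text \<open>Implicit differentiation of \<open>M x (X x) = \<beta> x\<close>: the product rule
  dictates the candidate \<open>L\<close>, and the lower bound on \<open>M\<close> turns a small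
  residual into a small error in \<open>X\<close>.\<close>

lemma linear_solve_has_derivative:
  fixes M :: "'a::euclidean_space \<Rightarrow> 'e::euclidean_space \<Rightarrow> 'e"
  assumes S: "open S" "x0 \<in> S"
    and lin: "\<And>x. x \<in> S \<Longrightarrow> linear (M x)" and inj: "inj (M x0)"
    and sol: "\<And>x. x \<in> S \<Longrightarrow> M x (X x) = \<beta> x"
    and M': "\<And>b. b \<in> Basis \<Longrightarrow> ((\<lambda>x. M x b) has_derivative M' b) (at x0)"
    and \<beta>': "(\<beta> has_derivative \<beta>') (at x0)"
    and L: "linear L" "\<And>h. M x0 (L h) = \<beta>' h - (\<Sum>b\<in>Basis. (X x0 \<bullet> b) *\<^sub>R M' b h)"
  shows "(X has_derivative L) (at x0)"
proof -
  \<comment> \<open>The residual of the linear prediction \<open>X x0 + L (y - x0)\<close> in the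
    equation at \<open>y\<close>. It vanishes to first order at \<open>x0\<close> by the choice of
    \<open>L\<close>.\<close>
  define R where "R y = \<beta> y - (\<Sum>b\<in>Basis. ((X x0 + L (y - x0)) \<bullet> b) *\<^sub>R M y b)" for y
  have L': "bounded_linear L" using L(1) by (rule linear_conv_bounded_linear[THEN iffD1])
  have dL: "((\<lambda>y. L (y - x0)) has_derivative L) (at x0)"
    by (rule bounded_linear.has_derivative[OF L']) (auto intro!: derivative_eq_intros)
  have "(R has_derivative (\<lambda>h. \<beta>' h - (\<Sum>b\<in>Basis. ((X x0 + L (x0 - x0)) \<bullet> b) *\<^sub>R M' b h
      + (L h \<bullet> b) *\<^sub>R M x0 b))) (at x0)"
    unfolding R_def by (rule derivative_eq_intros \<beta>' M' dL refl | assumption | simp)+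
  moreover have "\<beta>' h - (\<Sum>b\<in>Basis. ((X x0 + L (x0 - x0)) \<bullet> b) *\<^sub>R M' b h
      + (L h \<bullet> b) *\<^sub>R M x0 b) = 0" for h
    using L(2)[of h] linear_expand_Basis[OF lin[OF S(2)], of "L h"]
    by (simp add: linear_0[OF L(1)] sum.distrib)
  ultimately have "(R has_derivative (\<lambda>h. 0)) (at x0)" by simp
  moreover have R0: "R x0 = 0"
    using linear_expand_Basis[OF lin[OF S(2)], of "X x0"] sol[OF S(2)]
    by (simp add: R_def linear_0[OF L(1)])
  ultimately have Rlim: "((\<lambda>y. norm (R y) / norm (y - x0)) \<longlongrightarrow> 0) (at x0)"
    unfolding has_derivative_iff_norm by simp
  have "continuous (at x0) (\<lambda>x. M x b)" if "b \<in> Basis" for b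
    using M'[OF that] by (rule has_derivative_continuous)
  from linear_family_bounded_below[OF lin S(2) inj continuous_at_imp_continuous_at_within[OF this]]
  obtain c where c: "c > 0" "\<forall>\<^sub>F x in at x0 within S. \<forall>w. c * norm w \<le> norm (M x w)" by blast
  have c2: "\<forall>\<^sub>F x in at x0. x \<in> S \<and> (\<forall>w. c * norm w \<le> norm (M x w))"
    using c(2) S at_within_open[OF S(2,1)] eventually_at_in_open'[OF S]
    by (simp add: eventually_conj)
  have le: "\<forall>\<^sub>F y in at x0. norm (norm (X y - X x0 - L (y - x0)) / norm (y - x0))
      \<le> norm (R y) / norm (y - x0) * (1 / c)"
    using c2
  proof eventually_elim
    case (elim y)
    then have ly: "linear (M y)" and y: "y \<in> S" using lin by auto
    have "M y (X y - X x0 - L (y - x0)) = \<beta> y - M y (X x0 + L (y - x0))"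
      using linear_diff[OF ly, of "X y" "X x0 + L (y - x0)"] sol[OF y] by (simp add: algebra_simps)
    also have "\<dots> = R y"
      by (simp only: R_def linear_expand_Basis[OF ly, of "X x0 + L (y - x0)"])
    finally have "c * norm (X y - X x0 - L (y - x0)) \<le> norm (R y)"
      using elim by metis
    then have "norm (X y - X x0 - L (y - x0)) \<le> norm (R y) / c"
      using c(1) by (simp add: field_simps)
    then have "norm (X y - X x0 - L (y - x0)) / norm (y - x0) \<le> norm (R y) / c / norm (y - x0)"
      by (rule divide_right_mono) simp
    then show ?case by (simp add: field_simps)
  qed
  have "((\<lambda>y. norm (X y - X x0 - L (y - x0)) / norm (y - x0)) \<longlongrightarrow> 0) (at x0)"
    by (rule Lim_null_comparison[OF le]) (use tendsto_mult_right[OF Rlim, of "1 / c"] in simp)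
  then show ?thesis
    unfolding has_derivative_iff_norm using L' by simp
qed

text \<open>Each directional derivative of \<open>X\<close> solves a system with the same matrix
  \<open>M\<close> and the new right-hand side \<open>\<gamma>\<close>, so the induction generalizes
  over \<open>X\<close> and \<open>\<beta>\<close> only.\<close>

lemma Ck_on_linear_solve:
  fixes M :: "'a::euclidean_space \<Rightarrow> 'e::euclidean_space \<Rightarrow> 'e"
  assumes S: "open S"
    and lin: "\<And>x. x \<in> S \<Longrightarrow> linear (M x)" and inj: "\<And>x. x \<in> S \<Longrightarrow> inj (M x)"
    and M: "\<And>b. Ck_on k S (\<lambda>x. M x b)" and sol: "\<And>x. x \<in> S \<Longrightarrow> M x (X x) = \<beta> x"
    and \<beta>: "Ck_on k S \<beta>"
  shows "Ck_on k S X"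
  using M sol \<beta>
proof (induction k arbitrary: X \<beta>)
  case 0
  have "isCont X x0" if "x0 \<in> S" for x0
  proof -
    have cM: "isCont (\<lambda>x. M x b) x0" for b
      using 0(1)[of b] S that by (simp add: continuous_on_eq_continuous_at)
    from linear_family_bounded_below[OF lin that inj[OF that]
        continuous_at_imp_continuous_at_within[OF cM]]
    obtain c where c: "c > 0" "\<forall>\<^sub>F x in at x0 within S. \<forall>w. c * norm w \<le> norm (M x w)" by blast
    have c2: "\<forall>\<^sub>F x in at x0. x \<in> S \<and> (\<forall>w. c * norm w \<le> norm (M x w))"
      using c(2) S at_within_open[OF that S] eventually_at_in_open'[OF S that]
      by (simp add: eventually_conj)
    have le: "\<forall>\<^sub>F y in at x0. norm (X y - X x0) \<le> norm (\<beta> y - M y (X x0)) * (1 / c)"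
      using c2
    proof eventually_elim
      case (elim y)
      then have ly: "linear (M y)" and y: "y \<in> S" using lin by auto
      have "c * norm (X y - X x0) \<le> norm (\<beta> y - M y (X x0))"
        using elim linear_diff[OF ly, of "X y" "X x0"] 0(2)[OF y] by metis
      then show ?case using c(1) by (simp add: field_simps)
    qed
    have "((\<lambda>y. norm (\<beta> y - M y (X x0))) \<longlongrightarrow> norm (\<beta> x0 - M x0 (X x0))) (at x0)"
      using 0(3) S that cM[of "X x0"]
      by (intro tendsto_intros) (simp_all add: continuous_on_eq_continuous_at isCont_def)
    from tendsto_mult_right[OF this, of "1 / c"]
    have "((\<lambda>y. norm (\<beta> y - M y (X x0)) * (1 / c)) \<longlongrightarrow> 0) (at x0)"
      using 0(2)[OF that] by simp
    from Lim_null_comparison[OF le this] show ?thesis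
      by (simp add: isCont_def LIM_zero_iff)
  qed
  then show ?case by (simp add: continuous_at_imp_continuous_on)
next
  case (Suc k)
  let ?M' = "\<lambda>x b. frechet_derivative (\<lambda>x. M x b) (at x)"
  define \<gamma> where "\<gamma> x h = frechet_derivative \<beta> (at x) h - (\<Sum>b\<in>Basis. (X x \<bullet> b) *\<^sub>R ?M' x b h)" for
      x h
  define L where "L x h = inv (M x) (\<gamma> x h)" for x h
  have Mk: "Ck_on k S (\<lambda>x. M x b)" for b using Suc.prems(1) by (rule Ck_on_Suc_imp)
  have Xk: "Ck_on k S X"
    using Mk Suc.prems(2) Ck_on_Suc_imp[OF Suc.prems(3)] by (rule Suc.IH)
  have lin_\<gamma>: "linear (\<gamma> x)" if "x \<in> S" for x
    unfolding \<gamma>_def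
    by (intro linear_compose_sub linear_compose_sum ballI linear_compose_scale_right
        has_derivative_linear[OF Ck_on_SucD[OF Suc.prems(3) that]]
        has_derivative_linear[OF Ck_on_SucD[OF Suc.prems(1) that]])
  have bijM: "bij (M x)" if "x \<in> S" for x
    using linear_injective_imp_surjective[OF lin[OF that] inj[OF that]] inj[OF that] by (simp add:
        bij_def)
  have solL: "M x (L x h) = \<gamma> x h" if "x \<in> S" for x h
    unfolding L_def using bijM[OF that] by (simp add: bij_is_surj surj_f_inv_f)
  have linL: "linear (L x)" if "x \<in> S" for x
  proof -
    have "linear (inv (M x))"
      using lin[OF that] bijM[OF that] by (simp add: bij_is_inj linear_injective_left_inverse
          inj_linear_imp_inv_linear)
    from linear_compose[OF lin_\<gamma>[OF that] this] show ?thesis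
      unfolding L_def[abs_def] o_def .
  qed
  show ?case
  proof (rule Ck_on_SucI[OF S, where f' = L])
    show "(X has_derivative L x) (at x)" if "x \<in> S" for x
      using linear_solve_has_derivative[OF S that lin inj[OF that] Suc.prems(2)
          Ck_on_SucD[OF Suc.prems(1) that] Ck_on_SucD[OF Suc.prems(3) that] linL[OF that]]
        solL[OF that] unfolding \<gamma>_def by blast
    show "Ck_on k S (\<lambda>x. L x v)" for v
    proof (rule Suc.IH[OF Mk solL])
      have "Ck_on k S (\<lambda>x. frechet_derivative \<beta> (at x) v
          + (\<Sum>b\<in>Basis. - ((X x \<bullet> b) *\<^sub>R ?M' x b v)))"
        using Suc.prems(1,3)
        by (intro Ck_on_add[OF S] Ck_on_sum[OF S]
            Ck_on_linear_comp[OF bounded_linear_minus[OF bounded_linear_ident] S]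
            Ck_on_bilinear[OF bounded_bilinear_scaleR S] Ck_on_bilinear[OF bounded_bilinear_inner
                S] Xk)
          auto
      then show "Ck_on k S (\<lambda>x. \<gamma> x v)" by (simp add: \<gamma>_def sum_negf)
    qed
  qed
qed

text \<open>The matrix and the right-hand side are extended beyond \<open>S\<close>, and the
  extended system is solved on a neighbourhood where it is still injective. Injectivity makes the
  new solution an extension of \<open>X\<close>.\<close>

lemma smooth_on_linear_solve:
  fixes M :: "'a::euclidean_space \<Rightarrow> 'e::euclidean_space \<Rightarrow> 'e"
  assumes lin: "\<And>x. x \<in> S \<Longrightarrow> linear (M x)" and inj: "\<And>x. x \<in> S \<Longrightarrow> inj (M x)"
    and M: "\<And>b. b \<in> Basis \<Longrightarrow> smooth_on S (\<lambda>x. M x b)" and sol: "\<And>x. x \<in> S \<Longrightarrow> M x (X x) = \<beta> x"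
    and \<beta>: "smooth_on S \<beta>"
  shows "smooth_on S X"
proof (rule smooth_onI)
  fix x0 assume x0: "x0 \<in> S"
  have "\<forall>b\<in>Basis. \<exists>U g. open U \<and> x0 \<in> U \<and> (\<forall>k. Ck_on k U g) \<and> (\<forall>y\<in>U \<inter> S. g y = M y b)"
    using M x0 unfolding smooth_on_def by simp
  then obtain U m where U: "\<forall>b\<in>Basis. open (U b) \<and> x0 \<in> U b \<and> (\<forall>k. Ck_on k (U b) (m b)) \<and>
      (\<forall>y\<in>U b \<inter> S. m b y = M y b)" by metis
  obtain V \<beta>' where V: "open V" "x0 \<in> V" "\<forall>k. Ck_on k V \<beta>'" "\<forall>y\<in>V \<inter> S. \<beta>' y = \<beta> y"
    using \<beta> x0 by (rule smooth_onE)
  define W where "W = V \<inter> (\<Inter>b\<in>Basis. U b)"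
  \<comment> \<open>Only the columns are extended; rebuilding the map from them keeps it linear
    outside \<open>S\<close>.\<close>
  define M' where "M' y w = (\<Sum>b\<in>Basis. (w \<bullet> b) *\<^sub>R m b y)" for y w
  have W: "open W" "x0 \<in> W" using U V by (auto simp: W_def intro!: open_Int open_INT)
  have lin': "linear (M' y)" for y
    unfolding M'_def by (intro linearI) (simp_all add: inner_add_left scaleR_add_left sum.distrib
        scaleR_sum_right)
  have eqM: "M' y = M y" if "y \<in> W" "y \<in> S" for y
  proof
    fix w show "M' y w = M y w"
      unfolding linear_expand_Basis[OF lin[OF that(2)], of w] M'_def
      using that U by (auto simp: W_def)
  qed
  have mk: "Ck_on k W (m b)" if "b \<in> Basis" for k b
    using U that by (intro Ck_on_subset[of k "U b" "m b" W]) (auto simp: W_def)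
  have M'k: "Ck_on k W (\<lambda>y. M' y w)" for k w
    unfolding M'_def
    by (intro Ck_on_sum[OF W(1)] Ck_on_bilinear[OF bounded_bilinear_scaleR W(1)] mk) auto
  have "continuous (at x0 within W) (\<lambda>x. M' x b)" for b
    using Ck_on_imp_continuous_on[OF M'k[of 0 b]] W by (simp add:
        continuous_on_eq_continuous_within)
  from linear_family_bounded_below[OF lin' W(2) _ this]
  obtain c where c: "c > 0" "\<forall>\<^sub>F x in at x0 within W. \<forall>w. c * norm w \<le> norm (M' x w)"
    using inj[OF x0] eqM[OF W(2) x0] by auto
  then obtain T where T: "open T" "x0 \<in> T" "\<And>x w. x \<in> T \<Longrightarrow> x \<noteq> x0 \<Longrightarrow> x \<in> W \<Longrightarrow> c * norm w \<le> norm (M' x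
      w)"
    unfolding eventually_at_topological by metis
  define N where "N = T \<inter> W"
  have injN: "inj (M' x)" if "x \<in> N" for x
  \<comment> \<open>The eventual lower bound is about punctured neighbourhoods, hence the separate
    case.\<close>
  proof (cases "x = x0")
    case True
    then show ?thesis using inj[OF x0] eqM[OF W(2) x0] by simp
  next
    case False
    have "w = 0" if "M' x w = 0" for w
    proof -
      have "c * norm w \<le> 0" using T(3)[of x w] False \<open>x \<in> N\<close> that by (simp add: N_def)
      with c(1) show ?thesis by (simp add: mult_le_0_iff)
    qed
    then show ?thesis using linear_injective_0[OF lin'] by blast
  qed
  define X' where "X' y = inv (M' y) (\<beta>' y)" for y
  have sol': "M' y (X' y) = \<beta>' y" if "y \<in> N" for y
    unfolding X'_def using linear_injective_imp_surjective[OF lin' injN[OF that]]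
    by (simp add: surj_f_inv_f)
  have "open N" "x0 \<in> N" "N \<subseteq> W" "N \<subseteq> V" using T W by (auto simp: N_def W_def)
  have "Ck_on k N X'" for k
    by (rule Ck_on_linear_solve[OF \<open>open N\<close> lin' injN _ sol'])
      (use Ck_on_subset[OF M'k \<open>N \<subseteq> W\<close>] Ck_on_subset[OF V(3)[rule_format] \<open>N \<subseteq> V\<close>] in auto)
  moreover have "X' y = X y" if "y \<in> N" "y \<in> S" for y
  proof -
    have "M' y (X' y) = M' y (X y)"
    proof -
      have "M' y = M y" "\<beta>' y = \<beta> y"
        using eqM[of y] V(4) that \<open>N \<subseteq> W\<close> \<open>N \<subseteq> V\<close> by auto
      then show ?thesis using sol'[OF that(1)] sol[OF that(2)] by simp
    qed
    then show ?thesis using injN[OF that(1)] by (simp add: inj_eq)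
  qed
  ultimately show "\<exists>U g. open U \<and> x0 \<in> U \<and> (\<forall>k. Ck_on k U g) \<and> (\<forall>y\<in>U \<inter> S. g y = X y)"
    using \<open>open N\<close> \<open>x0 \<in> N\<close> by (intro local_extensionI[of N x0 X']) auto
qed

section \<open>Ordinary differential equations on short intervals\<close>

lemma vector_derivative_bound:
  fixes f :: "real \<Rightarrow> 'b::real_normed_vector"
  assumes "convex S" "\<And>t. t \<in> S \<Longrightarrow> (f has_vector_derivative f' t) (at t within S)"
    and "\<And>t. t \<in> S \<Longrightarrow> norm (f' t) \<le> B" "x \<in> S" "y \<in> S"
  shows "norm (f x - f y) \<le> B * \<bar>x - y\<bar>"
proof -
  have "norm (f x - f y) \<le> B * norm (x - y)"
  proof (rule differentiable_bound[OF assms(1), where f' = "\<lambda>t h. h *\<^sub>R f' t"])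
    show "onorm (\<lambda>h. h *\<^sub>R f' t) \<le> B" if "t \<in> S" for t
      by (rule onorm_le) (use assms(3)[OF that] in \<open>simp add: mult.commute[of B] mult_left_mono\<close>)
  qed (use assms in \<open>auto simp: has_vector_derivative_def\<close>)
  then show ?thesis by simp
qed

text \<open>On a short interval the supremum of \<open>norm z\<close> can be absorbed, so no exponential is needed.\<close>

lemma gronwall_short:
  fixes z :: "real \<Rightarrow> 'b::real_normed_vector"
  assumes z': "\<And>r. r \<in> closed_segment s t \<Longrightarrow>
      (z has_vector_derivative z' r) (at r within closed_segment s t)"
    and bd: "\<And>r. r \<in> closed_segment s t \<Longrightarrow> norm (z' r) \<le> L * norm (z r) + c"
    and L: "L * \<bar>t - s\<bar> \<le> 1 / 2" "0 \<le> L" "0 \<le> c"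
  shows "norm (z t) \<le> 2 * (norm (z s) + c * \<bar>t - s\<bar>)"
proof -
  let ?I = "closed_segment s t"
  have "continuous_on ?I (\<lambda>r. norm (z r))"
    using z' by (intro continuous_on_norm) (meson continuous_on_eq_continuous_within
        has_vector_derivative_continuous)
  from continuous_attains_sup[OF compact_segment _ this]
  obtain m where m: "m \<in> ?I" "\<And>r. r \<in> ?I \<Longrightarrow> norm (z r) \<le> norm (z m)" by auto
  have "norm (z' r) \<le> L * norm (z m) + c" if "r \<in> ?I" for r
    using bd[OF that] m(2)[OF that] L(2) by (meson add_mono mult_left_mono order_refl order_trans)
  then have "norm (z m - z s) \<le> (L * norm (z m) + c) * \<bar>m - s\<bar>"
    by (intro vector_derivative_bound[OF convex_closed_segment z']) (use m in auto)
  also have "\<dots> \<le> (L * norm (z m) + c) * \<bar>t - s\<bar>"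
    using m(1) L by (intro mult_left_mono add_nonneg_nonneg mult_nonneg_nonneg)
      (auto simp: closed_segment_eq_real_ivl split: if_splits)
  also have "\<dots> = (L * \<bar>t - s\<bar>) * norm (z m) + c * \<bar>t - s\<bar>" by (simp add: algebra_simps)
  also have "\<dots> \<le> 1 / 2 * norm (z m) + c * \<bar>t - s\<bar>"
    by (intro add_right_mono mult_right_mono L(1)) simp
  finally have "norm (z m) - norm (z s) \<le> 1 / 2 * norm (z m) + c * \<bar>t - s\<bar>"
    using norm_triangle_ineq2[of "z m" "z s"] by linarith
  with m(2)[of t] show ?thesis by simp
qed

text \<open>The length of the interval makes the integral operator a contraction with factor
  \<open>1 / 2\<close> in the plain supremum norm. As \<open>s\<close> may be any point of the
  interval, solutions run in both time directions.\<close>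

lemma picard_compact:
  fixes H :: "real \<Rightarrow> 'e::euclidean_space \<Rightarrow> 'e"
  assumes s: "s \<in> {a..b}"
    and cont: "continuous_on ({a..b} \<times> UNIV) (\<lambda>(t, z). H t z)"
    and lip: "\<And>t z w. t \<in> {a..b} \<Longrightarrow> norm (H t z - H t w) \<le> L * norm (z - w)"
    and L: "0 \<le> L" "L * (b - a) \<le> 1 / 2"
  shows "\<exists>z. z s = y \<and> (\<forall>t\<in>{a..b}. (z has_vector_derivative H t (z t)) (at t within {a..b}))"
proof -
  define I where "I u t = integral {a..t} (\<lambda>r. H r (u r))" for u :: "real \<Rightarrow> 'e" and t
  \<comment> \<open>Clamping the time turns functions on \<open>{a..b}\<close> into bounded
    continuous functions on the whole line, which form the complete space \<open>bcontfun\<close>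
    for the fixed point.\<close>
  define cl where "cl t = max a (min b t)" for t :: real
  have cl: "cl t \<in> {a..b}" for t using s by (auto simp: cl_def)
  have cl_id: "cl t = t" if "t \<in> {a..b}" for t using that by (auto simp: cl_def)
  have ccl: "continuous_on UNIV cl" unfolding cl_def by (intro continuous_intros)
  have Hu: "continuous_on {a..b} (\<lambda>r. H r (u r))" if "continuous_on {a..b} u" for u
    using continuous_on_compose2[OF cont continuous_on_Pair[OF continuous_on_id that]] by auto
  have I': "(I u has_vector_derivative H t (u t)) (at t within {a..b})"
    if "continuous_on {a..b} u" "t \<in> {a..b}" for u t
    unfolding I_def using integral_has_vector_derivative[OF Hu[OF that(1)] that(2)] .
  \<comment> \<open>The primitive starts at \<open>a\<close>; subtracting its value at
    \<open>s\<close> moves the initial condition there, also for times before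
    \<open>s\<close>.\<close>
  define T where "T u t = y + (I u (cl t) - I u s)" for u t
  have T_bc: "T u \<in> bcontfun" if u: "continuous_on {a..b} u" for u
  proof -
    have "continuous_on {a..b} (I u)"
      using I'[OF u] by (meson continuous_on_eq_continuous_within has_vector_derivative_continuous)
    then have cI: "continuous_on {a..b} (\<lambda>t. y + (I u t - I u s))" by (intro continuous_intros)
    have "T u = (\<lambda>t. y + (I u t - I u s)) \<circ> cl" by (auto simp: T_def)
    moreover have "continuous_on UNIV ((\<lambda>t. y + (I u t - I u s)) \<circ> cl)"
      by (rule continuous_on_compose[OF ccl], rule continuous_on_subset[OF cI]) (use cl in auto)
    moreover have "bounded (range ((\<lambda>t. y + (I u t - I u s)) \<circ> cl))"
      by (rule bounded_subset[OF compact_imp_bounded[OF compact_continuous_image[OF cI]]])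
        (use cl in auto)
    ultimately show ?thesis by (simp add: bcontfun_def)
  qed
  define TT where "TT u = Bcontfun (T (apply_bcontfun u))" for u :: "real \<Rightarrow>\<^sub>C 'e"
  have TT: "apply_bcontfun (TT u) = T (apply_bcontfun u)" for u
    unfolding TT_def by (intro Bcontfun_inverse T_bc continuous_on_apply_bcontfun)
  have "dist (TT u) (TT v) \<le> 1 / 2 * dist u v" for u v
  proof (rule dist_bound)
    fix t
    have "norm ((I u (cl t) - I v (cl t)) - (I u s - I v s)) \<le> (L * dist u v) * \<bar>cl t - s\<bar>"
    proof (rule vector_derivative_bound[of "{a..b}"])
      fix r assume r: "r \<in> {a..b}"
      show "((\<lambda>r. I u r - I v r) has_vector_derivative H r (u r) - H r (v r)) (at r within {a..b})"
        by (intro has_vector_derivative_diff I' continuous_on_apply_bcontfun r)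
      have "norm (H r (u r) - H r (v r)) \<le> L * norm (u r - v r)" by (rule lip[OF r])
      also have "\<dots> \<le> L * dist u v"
        using dist_bounded[of u r v] L(1) by (intro mult_left_mono) (auto simp: dist_norm)
      finally show "norm (H r (u r) - H r (v r)) \<le> L * dist u v" .
    qed (use s cl in auto)
    also have "\<dots> \<le> (L * dist u v) * (b - a)"
      using s cl[of t] L(1) by (intro mult_left_mono) auto
    also have "\<dots> = (L * (b - a)) * dist u v" by simp
    also have "\<dots> \<le> 1 / 2 * dist u v" by (intro mult_right_mono L(2)) simp
    finally show "dist (TT u t) (TT v t) \<le> 1 / 2 * dist u v"
      by (simp add: TT T_def dist_norm algebra_simps)
  qed
  then obtain u where u: "TT u = u"
    using banach_fix_type[of "1 / 2" TT] by auto
  have ut: "apply_bcontfun u t = y + (I u (cl t) - I u s)" for t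
    using TT[of u] by (simp add: u T_def fun_eq_iff)
  have "(apply_bcontfun u has_vector_derivative H t (u t)) (at t within {a..b})" if "t \<in> {a..b}"
      for t
  proof -
    have "((\<lambda>t. y + (I u t - I u s)) has_vector_derivative H t (u t)) (at t within {a..b})"
      using has_vector_derivative_add[OF has_vector_derivative_const
          has_vector_derivative_diff[OF I'[OF continuous_on_apply_bcontfun that]
              has_vector_derivative_const]]
      by simp
    then show ?thesis
      by (rule has_vector_derivative_transform[OF that, rotated]) (simp add: ut cl_id)
  qed
  then show ?thesis
    using s by (intro exI[of _ "apply_bcontfun u"]) (simp add: ut[of s] cl_id)
qed

text \<open>The Lipschitz estimate is asked only along the two curves, so it may come from a compact
  set that contains both.\<close>

lemma ode_unique_short:
  fixes z w :: "real \<Rightarrow> 'e::real_normed_vector"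
  assumes z: "\<And>r. r \<in> closed_segment s t \<Longrightarrow> (z has_vector_derivative H r (z r)) (at r within
      closed_segment s t)"
    and w: "\<And>r. r \<in> closed_segment s t \<Longrightarrow> (w has_vector_derivative H r (w r)) (at r within
        closed_segment s t)"
    and lip: "\<And>r. r \<in> closed_segment s t \<Longrightarrow> norm (H r (z r) - H r (w r)) \<le> L * norm (z r - w r)"
    and L: "0 \<le> L" "L * \<bar>t - s\<bar> \<le> 1 / 2" and eq: "z s = w s"
  shows "z t = w t"
proof -
  have "norm (z t - w t) \<le> 2 * (norm (z s - w s) + 0 * \<bar>t - s\<bar>)"
    by (rule gronwall_short[where z' = "\<lambda>r. H r (z r) - H r (w r)" and L = L])
      (use assms in \<open>auto intro!: has_vector_derivative_diff\<close>)
  then show ?thesis using eq by simp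
qed

text \<open>The solution is glued from solutions on compact subintervals around \<open>s\<close>;
  uniqueness makes the value at \<open>t\<close> independent of the subinterval.\<close>

lemma picard_open:
  fixes H :: "real \<Rightarrow> 'e::euclidean_space \<Rightarrow> 'e"
  assumes s: "s \<in> {a<..<b}"
    and cont: "continuous_on ({a<..<b} \<times> UNIV) (\<lambda>(t, z). H t z)"
    and lip: "\<And>t z w. t \<in> {a<..<b} \<Longrightarrow> norm (H t z - H t w) \<le> L * norm (z - w)"
    and L: "0 \<le> L" "L * (b - a) \<le> 1 / 2"
  shows "\<exists>z. z s = y \<and> (\<forall>t\<in>{a<..<b}. (z has_vector_derivative H t (z t)) (at t))"
proof -
  have "\<exists>z. z s = y \<and> (\<forall>t\<in>{c..d}. (z has_vector_derivative H t (z t)) (at t within {c..d}))"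
    if "a < c" "c < s" "s < d" "d < b" for c d
  proof (rule picard_compact[where L = L])
    show "continuous_on ({c..d} \<times> UNIV) (\<lambda>(t, z). H t z)"
      by (rule continuous_on_subset[OF cont]) (use that in auto)
    have "L * (d - c) \<le> L * (b - a)" using that L by (intro mult_left_mono) auto
    then show "L * (d - c) \<le> 1 / 2" using L(2) by simp
  qed (use that lip L in auto)
  then obtain Z where Z: "\<And>c d. a < c \<Longrightarrow> c < s \<Longrightarrow> s < d \<Longrightarrow> d < b \<Longrightarrow> Z c d s = y"
    "\<And>c d t. a < c \<Longrightarrow> c < s \<Longrightarrow> s < d \<Longrightarrow> d < b \<Longrightarrow> t \<in> {c..d} \<Longrightarrow>
      (Z c d has_vector_derivative H t (Z c d t)) (at t within {c..d})" by metis
  \<comment> \<open>Midpoints between an end of the interval and whichever of \<open>s\<close> and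
    \<open>t\<close> is nearest to it: the compact interval between them has both in its
    interior.\<close>
  define lo hi where "lo t = (a + min s t) / 2" and "hi t = (b + max s t) / 2" for t
  have lohi: "a < lo t" "lo t < s" "s < hi t" "hi t < b" "lo t < t" "t < hi t" if "t \<in> {a<..<b}"
      for t
    using that s by (auto simp: lo_def hi_def)
  define z where "z t = Z (lo t) (hi t) t" for t
  have eq: "z t = Z c d t" if cd: "a < c" "c < s" "s < d" "d < b" "t \<in> {c..d}" for c d t
    unfolding z_def
  proof (rule ode_unique_short[where L = L and s = s and H = H and z = "Z (lo t) (hi t)" and w =
      "Z c d"])
    have t: "t \<in> {a<..<b}" using cd by auto
    have "closed_segment s t \<subseteq> {lo t..hi t}" "closed_segment s t \<subseteq> {c..d}" 
      using lohi[OF t] cd by (auto simp: closed_segment_eq_real_ivl split: if_splits)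
    then show "(Z (lo t) (hi t) has_vector_derivative H r (Z (lo t) (hi t) r)) (at r within
        closed_segment s t)"
      "(Z c d has_vector_derivative H r (Z c d r)) (at r within closed_segment s t)"
      "norm (H r (Z (lo t) (hi t) r) - H r (Z c d r)) \<le> L * norm (Z (lo t) (hi t) r - Z c d r)"
      if "r \<in> closed_segment s t" for r
      using that cd lohi[OF t] lip[of r]
      by (auto intro!: has_vector_derivative_within_subset[OF Z(2)])
    have "L * \<bar>t - s\<bar> \<le> L * (b - a)" using cd L s by (intro mult_left_mono) auto
    then show "L * \<bar>t - s\<bar> \<le> 1 / 2" using L(2) by simp
    show "Z (lo t) (hi t) s = Z c d s" using Z(1) lohi[OF t] cd by simp
  qed (use L in auto)
  have "(z has_vector_derivative H t (z t)) (at t)" if t: "t \<in> {a<..<b}" for t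
  proof -
    let ?c = "lo t" and ?d = "hi t"
    have "(Z ?c ?d has_vector_derivative H t (Z ?c ?d t)) (at t within {?c<..<?d})"
      by (rule has_vector_derivative_within_subset[OF Z(2)]) (use lohi[OF t] in auto)
    then have "(Z ?c ?d has_vector_derivative H t (Z ?c ?d t)) (at t)"
      using lohi[OF t] by (simp add: at_within_open[of t "{lo t<..<hi t}"])
    then have "(z has_vector_derivative H t (Z ?c ?d t)) (at t)"
      by (rule has_vector_derivative_transform_within_open[where S = "{?c<..<?d}"])
        (use lohi[OF t] eq in auto)
    then show ?thesis by (simp add: z_def)
  qed
  moreover have "z s = y" using Z(1) lohi[OF s] by (simp add: z_def)
  ultimately show ?thesis by blast
qed

section \<open>Uniform first-order estimates for \<open>C^1\<close> maps\<close>

lemma Ck_on_Suc0_partials: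
  assumes "Ck_on (Suc k) S G" "x \<in> S"
  shows "norm (frechet_derivative G (at x) h) \<le> (\<Sum>b\<in>Basis. norm (frechet_derivative G (at x) b)) *
      norm h"
  using norm_linear_diff_le[OF has_derivative_linear[OF Ck_on_SucD[OF assms]] linear_zero] by simp

text \<open>The partial derivatives vary by less than \<open>e\<close> over displacements below a
  common radius, and the mean value inequality along a segment turns this into a remainder estimate
  uniform in the base point.\<close>

lemma C1_uniform:
  assumes U: "open U" and G: "Ck_on (Suc 0) U G" and K: "compact K" "K \<subseteq> U" and e: "e > 0"
  shows "\<exists>d>0. \<forall>x\<in>K. \<forall>h. norm h < d \<longrightarrow>
    x + h \<in> U \<and> norm (G (x + h) - G x - frechet_derivative G (at x) h) \<le> e * norm h"
proof -
  let ?G' = "\<lambda>x. frechet_derivative G (at x)"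
  obtain d0 where d0: "d0 > 0" "(\<Union>x\<in>K. cball x d0) \<subseteq> U"
    using compact_subset_open_imp_cball_epsilon_subset[OF K(1) U K(2)] by metis
  have xh: "x + h \<in> U" if "x \<in> K" "norm h \<le> d0" for x h
    using d0(2) that by (force simp: dist_norm)
  \<comment> \<open>Uniform continuity of \<open>q\<close> on a compact set, compared with
    \<open>h = 0\<close> where it vanishes, gives one radius for all of \<open>K\<close>.\<close>
  define q where "q = (\<lambda>(x, h). \<Sum>b\<in>Basis. norm (?G' (x + h) b - ?G' x b))"
  have G'c: "continuous_on U (\<lambda>x. ?G' x b)" for b using G by simp
  have "continuous_on (K \<times> cball 0 d0) q"
    unfolding q_def case_prod_beta
    by (intro continuous_intros continuous_on_compose2[OF G'c]) (use xh K(2) in auto)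
  then have "uniformly_continuous_on (K \<times> cball 0 d0) q"
    using K(1) by (intro compact_uniformly_continuous compact_Times compact_cball)
  then obtain d where d: "d > 0" "\<And>x x'. x \<in> K \<times> cball 0 d0 \<Longrightarrow> x' \<in> K \<times> cball 0 d0 \<Longrightarrow>
      dist x' x < d \<Longrightarrow> dist (q x') (q x) < e"
    using e unfolding uniformly_continuous_on_def by metis
  define r where "r = min d d0"
  have "r > 0" using d(1) d0(1) by (simp add: r_def)
  moreover have "x + h \<in> U \<and> norm (G (x + h) - G x - ?G' x h) \<le> e * norm h"
    if x: "x \<in> K" and h: "norm h < r" for x h
  proof
    show "x + h \<in> U" using xh[OF x, of h] h by (simp add: r_def)
    have *: "onorm (?G' y - ?G' x) \<le> e" if y: "y \<in> ball x r" for y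
    proof (rule onorm_le)
      fix w
      have yU: "y \<in> U" using xh[OF x, of "y - x"] y by (auto simp: dist_norm norm_minus_commute
          r_def)
      have "dist (q (x, y - x)) (q (x, 0)) < e"
        using y x d0(1) by (intro d(2)) (auto simp: dist_norm dist_Pair_Pair norm_minus_commute
            r_def)
      then have "(\<Sum>b\<in>Basis. norm (?G' y b - ?G' x b)) \<le> e"
        by (simp add: q_def dist_real_def)
      then show "norm ((?G' y - ?G' x) w) \<le> e * norm w"
        using norm_linear_diff_le[OF has_derivative_linear[OF Ck_on_SucD[OF G yU]]
            has_derivative_linear[OF Ck_on_SucD[OF G]], of x w] x K(2)
        by (simp add: fun_diff_def) (meson mult_right_mono norm_ge_zero order_trans subsetD)
    qed
    have "norm (G (x + h) - G x - ?G' x (x + h - x)) \<le> norm (x + h - x) * e"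
    proof (rule differentiable_bound_linearization[where S = "ball x r"])
      show "x + t *\<^sub>R (x + h - x) \<in> ball x r" if "t \<in> {0..1}" for t
      proof -
        have "norm (t *\<^sub>R h) \<le> norm h"
          using that by (simp add: mult_left_le_one_le)
        then show ?thesis using h by (simp add: dist_norm)
      qed
      show "(G has_derivative ?G' y) (at y within ball x r)" if "y \<in> ball x r" for y
      proof -
        have "norm (y - x) \<le> d0" using that by (simp add: dist_norm norm_minus_commute r_def)
        then have "y \<in> U" using xh[OF x, of "y - x"] by simp
        then show ?thesis by (rule has_derivative_at_withinI[OF Ck_on_SucD[OF G]])
      qed
    qed (use * \<open>r > 0\<close> in auto)
    then show "norm (G (x + h) - G x - ?G' x h) \<le> e * norm h" by (simp add: mult.commute)
  qed
  ultimately show ?thesis by blast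
qed

lemma C1_lipschitz_compact_convex:
  assumes G: "Ck_on (Suc 0) U G" and K: "compact K" "convex K" "K \<subseteq> U"
  shows "\<exists>L\<ge>0. (\<forall>x\<in>K. \<forall>h. norm (frechet_derivative G (at x) h) \<le> L * norm h) \<and>
    (\<forall>x\<in>K. \<forall>y\<in>K. norm (G x - G y) \<le> L * norm (x - y))"
proof -
  let ?G' = "\<lambda>x. frechet_derivative G (at x)"
  have "continuous_on U (\<lambda>x. ?G' x b)" for b using G by simp
  then have "continuous_on K (\<lambda>x. \<Sum>b\<in>Basis. norm (?G' x b))"
    using K(3) by (intro continuous_intros) (auto intro: continuous_on_subset)
  from compact_imp_bounded[OF compact_continuous_image[OF this K(1)]]
  obtain L where L: "L > 0" "\<And>x. x \<in> K \<Longrightarrow> (\<Sum>b\<in>Basis. norm (?G' x b)) \<le> L"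
    unfolding bounded_pos by fastforce
  have b: "norm (?G' x h) \<le> L * norm h" if "x \<in> K" for x h
    using Ck_on_Suc0_partials[OF G, of x h] L(2)[OF that] that K(3)
    by (meson mult_right_mono norm_ge_zero order_trans subsetD)
  have "norm (G x - G y) \<le> L * norm (x - y)" if "x \<in> K" "y \<in> K" for x y
  proof (rule differentiable_bound[OF K(2), where f' = ?G'])
    show "(G has_derivative ?G' x) (at x within K)" if "x \<in> K" for x
      using that K(3) by (auto intro: has_derivative_at_withinI[OF Ck_on_SucD[OF G]])
    show "onorm (?G' x) \<le> L" if "x \<in> K" for x by (rule onorm_le) (rule b[OF that])
  qed (use that in auto)
  with b L(1) show ?thesis by (intro exI[of _ L]) auto
qed

lemma isCont_iff_nhds:
  fixes f :: "'a::t2_space \<Rightarrow> 'b::metric_space"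
  shows "isCont f x \<longleftrightarrow> (\<forall>e>0. \<forall>\<^sub>F y in nhds x. dist (f y) (f x) < e)"
  unfolding isCont_def tendsto_at_iff_tendsto_nhds by (rule tendsto_iff)

text \<open>The difference of the solutions at \<open>y\<close> and \<open>y1\<close> solves the
  equation at \<open>y\<close> with a forcing that is small uniformly in time, so Gronwall's
  inequality applies.\<close>

lemma linear_ode_continuous_on:
  fixes A :: "real \<times> 'p::euclidean_space \<Rightarrow> 'e::euclidean_space \<Rightarrow> 'e"
  assumes s: "s \<in> {a<..<b}" and V: "open V"
    and sol: "\<And>t y. t \<in> {a<..<b} \<Longrightarrow> y \<in> V \<Longrightarrow>
      ((\<lambda>r. w (r, y)) has_vector_derivative A (t, y) (w (t, y)) + B (t, y)) (at t)"
    and lin: "\<And>x. x \<in> {a<..<b} \<times> V \<Longrightarrow> linear (A x)"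
    and bd: "\<And>x u. x \<in> {a<..<b} \<times> V \<Longrightarrow> norm (A x u) \<le> L * norm u"
    and L: "0 \<le> L" "L * (b - a) \<le> 1 / 2"
    and A: "\<And>u. continuous_on ({a<..<b} \<times> V) (\<lambda>x. A x u)"
    and B: "continuous_on ({a<..<b} \<times> V) B" and w0: "continuous_on V (\<lambda>y. w (s, y))"
  shows "continuous_on ({a<..<b} \<times> V) w"
proof -
  let ?J = "{a<..<b}"
  have "isCont w (t1, y1)" if t1: "t1 \<in> ?J" and y1: "y1 \<in> V" for t1 y1
  proof -
    obtain c d where cd: "a < c" "c < s" "c < t1" "s < d" "t1 < d" "d < b"
      using dense[of a "min s t1"] dense[of "max s t1" b] s t1 by auto
    obtain \<rho> where \<rho>: "\<rho> > 0" "cball y1 \<rho> \<subseteq> V" using V y1 open_contains_cball by blast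
    have wt: "isCont (\<lambda>t. w (t, y1)) r" if "r \<in> ?J" for r
      by (rule has_vector_derivative_continuous[OF sol[OF that y1]])
    have wc: "continuous_on {c..d} (\<lambda>t. w (t, y1))"
      using wt cd by (intro continuous_at_imp_continuous_on) auto
    have sub: "{c..d} \<times> cball y1 \<rho> \<subseteq> ?J \<times> V" using cd \<rho> by auto
    \<comment> \<open>The right-hand side along the fixed solution at \<open>y1\<close>, with only
      the coefficients varying. Written through the columns of \<open>A\<close> it is jointly
      continuous, and its variation in \<open>y\<close> is the forcing.\<close>
    define Q where "Q x = (\<Sum>i\<in>Basis. (w (fst x, y1) \<bullet> i) *\<^sub>R A x i) + B x" for x
    have Qeq: "Q x = A x (w (fst x, y1)) + B x" if "x \<in> ?J \<times> V" for x
      unfolding Q_def using linear_expand_Basis[OF lin[OF that]] by metis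
    have "continuous_on ({c..d} \<times> cball y1 \<rho>) Q"
      unfolding Q_def
      by (intro continuous_intros continuous_on_compose2[OF wc] continuous_on_subset[OF A sub]
          continuous_on_subset[OF B sub]) auto
    then have uc: "uniformly_continuous_on ({c..d} \<times> cball y1 \<rho>) Q"
      by (intro compact_uniformly_continuous compact_Times compact_cball) auto
    have est: "\<exists>\<delta>>0. \<forall>y\<in>ball y1 \<delta>. \<forall>t\<in>{c..d}. norm (w (t, y) - w (t, y1)) < e" if e: "e > 0" for e
    proof -
      \<comment> \<open>\<open>\<eta>\<close> is chosen so that the final bound
        \<open>2 * (\<eta> + \<eta> * (b - a))\<close> equals \<open>e / 2\<close>; the summand
        \<open>1\<close> in \<open>D\<close> accounts for the initial difference.\<close>
      define D where "D = 1 + (b - a)"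
      define \<eta> where "\<eta> = e / (4 * D)"
      have ab: "D > 0" using s by (auto simp: D_def)
      have \<eta>: "\<eta> > 0" "2 * (\<eta> + \<eta> * (b - a)) < e"
      proof -
        have "\<eta> + \<eta> * (b - a) = \<eta> * D" by (simp add: D_def algebra_simps)
        also have "\<dots> = e / 4" using ab by (simp add: \<eta>_def)
        finally show "2 * (\<eta> + \<eta> * (b - a)) < e" using e by simp
      qed (use ab e in \<open>simp add: \<eta>_def\<close>)
      obtain \<delta>1 where \<delta>1: "\<delta>1 > 0" "\<And>x x'. x \<in> {c..d} \<times> cball y1 \<rho> \<Longrightarrow> x' \<in> {c..d} \<times> cball y1 \<rho> \<Longrightarrow>
          dist x' x < \<delta>1 \<Longrightarrow> dist (Q x') (Q x) < \<eta>"
        using uc \<eta>(1) unfolding uniformly_continuous_on_def by metis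
      have "isCont (\<lambda>y. w (s, y)) y1" using w0 V y1 by (simp add: continuous_on_eq_continuous_at)
      then have "\<forall>\<^sub>F y in nhds y1. dist (w (s, y)) (w (s, y1)) < \<eta>"
        using \<eta>(1) unfolding isCont_iff_nhds by blast
      then obtain \<delta>2 where \<delta>2: "\<delta>2 > 0" "\<And>y. dist y y1 < \<delta>2 \<Longrightarrow> dist (w (s, y)) (w (s, y1)) < \<eta>"
        unfolding eventually_nhds_metric by blast
      define \<delta> where "\<delta> = min \<rho> (min \<delta>1 \<delta>2)"
      have "norm (w (t, y) - w (t, y1)) < e" if y: "y \<in> ball y1 \<delta>" and t: "t \<in> {c..d}" for y t
      proof -
        have yV: "y \<in> V" "y \<in> cball y1 \<rho>" using y \<rho> by (auto simp: \<delta>_def)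
        have seg: "r \<in> {c..d}" if "r \<in> closed_segment s t" for r
          using that t cd by (auto simp: closed_segment_eq_real_ivl split: if_splits)
        have "norm (w (t, y) - w (t, y1)) \<le> 2 * (norm (w (s, y) - w (s, y1)) + \<eta> * \<bar>t - s\<bar>)"
        proof (rule gronwall_short[where L = L and z = "\<lambda>t. w (t, y) - w (t, y1)" and
              z' = "\<lambda>r. (A (r, y) (w (r, y)) + B (r, y)) - (A (r, y1) (w (r, y1)) + B (r, y1))"])
          fix r assume r: "r \<in> closed_segment s t"
          then have r': "r \<in> ?J" "r \<in> {c..d}" using seg[OF r] cd by auto
          show "((\<lambda>t. w (t, y) - w (t, y1)) has_vector_derivative
              (A (r, y) (w (r, y)) + B (r, y)) - (A (r, y1) (w (r, y1)) + B (r, y1)))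
              (at r within closed_segment s t)"
            by (intro has_vector_derivative_diff has_vector_derivative_at_within[OF sol] r' yV y1)
          have ry: "(r, y) \<in> ?J \<times> V" "(r, y1) \<in> ?J \<times> V" using r' yV y1 by auto
          have "(A (r, y) (w (r, y)) + B (r, y)) - (A (r, y1) (w (r, y1)) + B (r, y1))
              = A (r, y) (w (r, y) - w (r, y1)) + (Q (r, y) - Q (r, y1))"
            using linear_diff[OF lin[OF ry(1)]] by (simp add: Qeq[OF ry(1)] Qeq[OF ry(2)])
          also have "norm \<dots> \<le> L * norm (w (r, y) - w (r, y1)) + \<eta>"
          proof (rule norm_triangle_le[OF add_mono[OF bd[OF ry(1)]]])
            have "dist (Q (r, y)) (Q (r, y1)) < \<eta>"
              using y r' yV \<rho>(1) by (intro \<delta>1(2)) (auto simp: dist_Pair_Pair \<delta>_def dist_commute)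
            then show "norm (Q (r, y) - Q (r, y1)) \<le> \<eta>" by (simp add: dist_norm)
          qed
          finally show "norm ((A (r, y) (w (r, y)) + B (r, y)) - (A (r, y1) (w (r, y1)) + B (r,
              y1)))
            \<le> L * norm (w (r, y) - w (r, y1)) + \<eta>" .
        next
          have "L * \<bar>t - s\<bar> \<le> L * (b - a)" using t cd L s by (intro mult_left_mono) auto
          then show "L * \<bar>t - s\<bar> \<le> 1 / 2" using L(2) by simp
        qed (use L \<eta> in auto)
        also have "\<dots> \<le> 2 * (\<eta> + \<eta> * (b - a))"
        proof (intro mult_left_mono add_mono)
          show "norm (w (s, y) - w (s, y1)) \<le> \<eta>"
            using \<delta>2(2)[of y] y by (simp add: \<delta>_def dist_norm norm_minus_commute)
        qed (use t cd s \<eta>(1) in auto)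
        also have "\<dots> < e" by (rule \<eta>(2))
        finally show ?thesis .
      qed
      moreover have "\<delta> > 0" using \<rho> \<delta>1 \<delta>2 by (simp add: \<delta>_def)
      ultimately show ?thesis by blast
    qed
    \<comment> \<open>Joint continuity in two halves: the estimate uniform in time compares
      \<open>y\<close> with \<open>y1\<close>, and continuity of the single solution at
      \<open>y1\<close> compares the times.\<close>
    show ?thesis
      unfolding isCont_iff_nhds
    proof (intro allI impI)
      fix e :: real assume "e > 0"
      then obtain \<delta> where \<delta>: "\<delta> > 0" "\<And>y t. y \<in> ball y1 \<delta> \<Longrightarrow> t \<in> {c..d} \<Longrightarrow> norm (w (t, y) - w (t,
          y1)) < e / 2"
        using est[of "e / 2"] by auto
      have "\<forall>\<^sub>F t in nhds t1. dist (w (t, y1)) (w (t1, y1)) < e / 2"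
        using wt[OF t1] half_gt_zero[OF \<open>e > 0\<close>] unfolding isCont_iff_nhds by blast
      moreover have "\<forall>\<^sub>F t in nhds t1. t \<in> {c<..<d}"
        using cd by (intro eventually_nhds_in_open) auto
      ultimately have 1: "\<forall>\<^sub>F t in nhds t1. t \<in> {c..d} \<and> dist (w (t, y1)) (w (t1, y1)) < e / 2"
        by eventually_elim auto
      have 2: "\<forall>\<^sub>F y in nhds y1. y \<in> ball y1 \<delta>"
        using \<delta> by (intro eventually_nhds_in_open) auto
      have "\<forall>\<^sub>F x in nhds t1 \<times>\<^sub>F nhds y1. dist (w x) (w (t1, y1)) < e"
        using eventually_prodI[OF 1 2]
      proof eventually_elim
        case (elim x)
        then have "dist (w (fst x, snd x)) (w (fst x, y1)) < e / 2" using \<delta>(2)[of "snd x" "fst x"]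
          by (simp add: dist_norm)
        moreover have "dist (w (fst x, y1)) (w (t1, y1)) < e / 2" using elim by simp
        ultimately show ?case
          using dist_triangle[of "w x" "w (t1, y1)" "w (fst x, y1)"] by simp
      qed
      then show "\<forall>\<^sub>F x in nhds (t1, y1). dist (w x) (w (t1, y1)) < e"
        by (simp add: nhds_prod)
    qed
  qed
  then show ?thesis by (auto intro!: continuous_at_imp_continuous_on)
qed

section \<open>Smooth dependence on parameters\<close>

text \<open>The variation \<open>w v\<close> of the solution in the parameter direction \<open>v\<close> solves the linearised
  equation; the remainder of the first-order expansion is small by Gronwall's inequality.\<close>

lemma param_ode_has_derivative_parameter:
  fixes G :: "real \<times> 'e::euclidean_space \<times> 'p::euclidean_space \<Rightarrow> 'e"
  assumes U: "open U" and G: "Ck_on (Suc 0) U G" and s: "s \<in> {a<..<b}" and V: "open V"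
    and sol: "\<And>t y. t \<in> {a<..<b} \<Longrightarrow> y \<in> V \<Longrightarrow>
      ((\<lambda>r. z (r, y)) has_vector_derivative G (t, z (t, y), y)) (at t)"
    and inU: "\<And>t y. t \<in> {a<..<b} \<Longrightarrow> y \<in> V \<Longrightarrow> (t, z (t, y), y) \<in> U"
    and zc: "continuous_on ({a<..<b} \<times> V) z"
    and bd: "\<And>t y u. t \<in> {a<..<b} \<Longrightarrow> y \<in> V \<Longrightarrow>
      norm (frechet_derivative G (at (t, z (t, y), y)) (0, u, 0)) \<le> L * norm u"
    and L: "0 \<le> L" "L * (b - a) \<le> 1 / 4"
    and z0: "((\<lambda>y. z (s, y)) has_derivative z0') (at y1)" and y1: "y1 \<in> V"
    and w0: "\<And>v. w v s = z0' v"
    and w: "\<And>v t. t \<in> {a<..<b} \<Longrightarrow>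
      (w v has_vector_derivative frechet_derivative G (at (t, z (t, y1), y1)) (0, w v t, v)) (at t)"
    and t1: "t1 \<in> {a<..<b}"
  shows "((\<lambda>y. z (t1, y)) has_derivative (\<lambda>v. w v t1)) (at y1)"
proof -
  let ?J = "{a<..<b}" and ?I = "closed_segment s t1"
  define x where "x r = (r, z (r, y1), y1)" for r
  define DG where "DG r = frechet_derivative G (at (x r))" for r
  have IJ: "r \<in> ?J" if "r \<in> ?I" for r
    using that s t1 by (auto simp: closed_segment_eq_real_ivl split: if_splits)
  have xU: "x r \<in> U" if "r \<in> ?J" for r using inU[OF that y1] by (simp add: x_def)
  have linDG: "linear (DG r)" if "r \<in> ?J" for r
    unfolding DG_def using has_derivative_linear[OF Ck_on_SucD[OF G xU[OF that]]] .
  have DG_split: "DG r (0, u, v) = DG r (0, u, 0) + DG r (0, 0, v)" if "r \<in> ?J" for r u v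
    using linear_add[OF linDG[OF that], of "(0, u, 0)" "(0, 0, v)"] by simp
  have bd': "norm (DG r (0, u, 0)) \<le> L * norm u" if "r \<in> ?J" for r u
    using bd[OF that y1] by (simp add: DG_def x_def)
  have w': "(w v has_vector_derivative DG r (0, w v r, v)) (at r)" if "r \<in> ?J" for r v
    using w[OF that] by (simp add: DG_def x_def)
  have Lt: "L * \<bar>t1 - s\<bar> \<le> 1 / 4"
  proof -
    have "L * \<bar>t1 - s\<bar> \<le> L * (b - a)" using s t1 L by (intro mult_left_mono) auto
    with L(2) show ?thesis by simp
  qed
  \<comment> \<open>Uniqueness for the homogeneous equation. Applied to the defects of additivity
    and homogeneity of \<open>w\<close>, it makes the candidate derivative linear in the
    direction.\<close>
  have uniq: "W t1 = 0" if W: "\<And>r. r \<in> ?J \<Longrightarrow> (W has_vector_derivative DG r (0, W r, 0)) (at r)"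
    "W s = 0" for W
  proof -
    have "norm (W t1) \<le> 2 * (norm (W s) + 0 * \<bar>t1 - s\<bar>)"
      by (rule gronwall_short[where z' = "\<lambda>r. DG r (0, W r, 0)" and L = L])
        (use W(1) IJ bd' L Lt in \<open>auto intro: has_vector_derivative_at_within\<close>)
    with W(2) show ?thesis by simp
  qed
  have lin0: "linear z0'" using z0 by (rule has_derivative_linear)
  have linw: "linear (\<lambda>v. w v t1)"
  proof (rule linearI)
    fix u v
    have "w (u + v) t1 - w u t1 - w v t1 = 0"
    proof (rule uniq[of "\<lambda>r. w (u + v) r - w u r - w v r"])
      fix r assume r: "r \<in> ?J"
      have "DG r (0, w (u + v) r, u + v) - DG r (0, w u r, u) - DG r (0, w v r, v)
          = DG r ((0, w (u + v) r, u + v) - (0, w u r, u) - (0, w v r, v))"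
        by (simp only: linear_diff[OF linDG[OF r]])
      then show "((\<lambda>r. w (u + v) r - w u r - w v r) has_vector_derivative
          DG r (0, w (u + v) r - w u r - w v r, 0)) (at r)"
        using has_vector_derivative_diff[OF has_vector_derivative_diff[OF w'[OF r] w'[OF r]] w'[OF
            r],
            of "u + v" u v] by simp
    qed (simp add: w0 linear_add[OF lin0])
    then show "w (u + v) t1 = w u t1 + w v t1" by (simp add: algebra_simps)
  next
    fix c v
    have "w (c *\<^sub>R v) t1 - c *\<^sub>R w v t1 = 0"
    proof (rule uniq[of "\<lambda>r. w (c *\<^sub>R v) r - c *\<^sub>R w v r"])
      fix r assume r: "r \<in> ?J"
      have "DG r (0, w (c *\<^sub>R v) r, c *\<^sub>R v) - c *\<^sub>R DG r (0, w v r, v)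
          = DG r ((0, w (c *\<^sub>R v) r, c *\<^sub>R v) - c *\<^sub>R (0, w v r, v))"
        by (simp only: linear_diff[OF linDG[OF r]] linear_scale[OF linDG[OF r]])
      moreover have cw: "((\<lambda>r. c *\<^sub>R w v r) has_vector_derivative c *\<^sub>R DG r (0, w v r, v)) (at r)"
        using bounded_linear.has_vector_derivative[OF bounded_linear_scaleR_right w'[OF r]] .
      ultimately show "((\<lambda>r. w (c *\<^sub>R v) r - c *\<^sub>R w v r) has_vector_derivative
          DG r (0, w (c *\<^sub>R v) r - c *\<^sub>R w v r, 0)) (at r)"
        using has_vector_derivative_diff[OF w'[OF r] cw, of "c *\<^sub>R v"] by simp
    qed (simp add: w0 linear_scale[OF lin0])
    then show "w (c *\<^sub>R v) t1 = c *\<^sub>R w v t1" by simp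
  qed
  have zt: "isCont (\<lambda>t. z (t, y1)) r" if "r \<in> ?J" for r
    by (rule has_vector_derivative_continuous[OF sol[OF that y1]])
  have xc: "continuous_on ?I x"
    unfolding x_def using IJ zt by (intro continuous_intros continuous_at_imp_continuous_on) auto
  have GDc: "continuous_on U (\<lambda>x. frechet_derivative G (at x) h)" for h
    using G unfolding Ck_on.simps by blast
  have DGc: "continuous_on ?I (\<lambda>r. DG r h)" for h
    unfolding DG_def
    by (rule continuous_on_compose2[OF GDc xc]) (use xU IJ in auto)
  have Kc: "compact (x ` ?I)" by (rule compact_continuous_image[OF xc compact_segment])
  have KU: "x ` ?I \<subseteq> U" using xU IJ by auto
  have "continuous_on ?I (\<lambda>r. \<Sum>i\<in>Basis. norm (DG r i))"
    by (intro continuous_intros DGc)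
  from compact_imp_bounded[OF compact_continuous_image[OF this compact_segment]]
  obtain B where B: "B > 0" "\<And>r. r \<in> ?I \<Longrightarrow> (\<Sum>i\<in>Basis. norm (DG r i)) \<le> B"
    unfolding bounded_pos by fastforce
  have DGB: "norm (DG r h) \<le> B * norm h" if "r \<in> ?I" for r h
    using Ck_on_Suc0_partials[OF G xU[OF IJ[OF that]], of h] B(2)[OF that]
    unfolding DG_def[symmetric] by (meson mult_right_mono norm_ge_zero order_trans)
  obtain B0 where B0: "B0 > 0" "\<And>v. norm (z0' v) \<le> B0 * norm v"
    using linear_bounded_pos[OF lin0] by blast
  define D where "D = 1 + (b - a)"
  have D: "D > 1" "\<bar>t1 - s\<bar> \<le> D" "b - a < D" using s t1 by (auto simp: D_def)
  \<comment> \<open>Gronwall's bound for the variation: the initial value is at most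
    \<open>B0 * norm v\<close> and the forcing at most \<open>B * norm v\<close>, over a time at
    most \<open>D\<close>.\<close>
  define C where "C = 2 * (B0 + B * D)"
  have C: "C > 0" using B0 B D by (simp add: C_def add_pos_pos)
  have wC: "norm (w v r) \<le> C * norm v" if r: "r \<in> ?I" for v r
  proof -
    have sub: "closed_segment s r \<subseteq> ?I" using r by (simp add: subset_closed_segment)
    have rs: "\<bar>r - s\<bar> \<le> \<bar>t1 - s\<bar>" using r by (auto simp: closed_segment_eq_real_ivl split:
        if_splits)
    have "norm (w v r) \<le> 2 * (norm (w v s) + (B * norm v) * \<bar>r - s\<bar>)"
    proof (rule gronwall_short[where L = L and z' = "\<lambda>r. DG r (0, w v r, v)"])
      fix q assume "q \<in> closed_segment s r"
      then have q: "q \<in> ?I" "q \<in> ?J" using sub IJ by auto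
      show "(w v has_vector_derivative DG q (0, w v q, v)) (at q within closed_segment s r)"
        by (rule has_vector_derivative_at_within[OF w'[OF q(2)]])
      show "norm (DG q (0, w v q, v)) \<le> L * norm (w v q) + B * norm v"
      proof -
        have "norm (DG q (0, 0, v)) \<le> B * norm v"
          using DGB[OF q(1), of "(0, 0, v)"] by (simp add: norm_Pair)
        with bd'[OF q(2), of "w v q"] norm_triangle_ineq[of "DG q (0, w v q, 0)" "DG q (0, 0, v)"]
        show ?thesis unfolding DG_split[OF q(2), of "w v q" v] by linarith
      qed
    next
      have "L * \<bar>r - s\<bar> \<le> L * \<bar>t1 - s\<bar>" using rs L(1) by (rule mult_left_mono)
      then show "L * \<bar>r - s\<bar> \<le> 1 / 2" using Lt by simp
    qed (use L B in auto)
    also have "\<dots> \<le> 2 * (B0 * norm v + (B * norm v) * D)"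
      using B0(2)[of v] rs D B by (intro mult_left_mono add_mono) (auto simp: w0)
    finally show ?thesis by (simp add: C_def algebra_simps)
  qed
  have "\<exists>d>0. \<forall>h. norm h < d \<longrightarrow> norm (z (t1, y1 + h) - z (t1, y1) - w h t1) \<le> e * norm h"
    if e: "e > 0" for e
  proof -
    \<comment> \<open>\<open>E\<close> collects the constants of the last estimate. In the minimum
      below, the first entry keeps \<open>L + \<eta>\<close> times the length within the reach of
      \<open>gronwall_short\<close>, the second makes the total error at most
      \<open>e\<close>.\<close>
    define E where "E = 2 * (1 + (C + 1) * D)"
    have E: "E > 0" using C D by (simp add: E_def add_pos_pos)
    define \<eta> where "\<eta> = min (1 / (4 * D)) (e / E)"
    have \<eta>: "\<eta> > 0" "\<eta> * D \<le> 1 / 4" "\<eta> * E \<le> e"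
    proof -
      show "\<eta> > 0" using e E D by (simp add: \<eta>_def)
      have "\<eta> * D \<le> 1 / (4 * D) * D" using D by (intro mult_right_mono) (auto simp: \<eta>_def)
      then show "\<eta> * D \<le> 1 / 4" using D by simp
      have "\<eta> * E \<le> e / E * E" using E by (intro mult_right_mono) (auto simp: \<eta>_def)
      then show "\<eta> * E \<le> e" using E by simp
    qed
    obtain d1 where d1: "d1 > 0" "\<And>r k. r \<in> ?I \<Longrightarrow> norm k < d1 \<Longrightarrow>
        norm (G (x r + k) - G (x r) - DG r k) \<le> \<eta> * norm k"
      using C1_uniform[OF U G Kc KU \<eta>(1)] unfolding DG_def by blast
    obtain \<rho> where \<rho>: "\<rho> > 0" "cball y1 \<rho> \<subseteq> V" using V y1 open_contains_cball by blast
    have "continuous_on (?I \<times> cball y1 \<rho>) z"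
      by (rule continuous_on_subset[OF zc]) (use IJ \<rho> in auto)
    then have "uniformly_continuous_on (?I \<times> cball y1 \<rho>) z"
      by (intro compact_uniformly_continuous compact_Times compact_segment compact_cball)
    then obtain d2 where d2: "d2 > 0" "\<And>p q. p \<in> ?I \<times> cball y1 \<rho> \<Longrightarrow> q \<in> ?I \<times> cball y1 \<rho> \<Longrightarrow>
        dist q p < d2 \<Longrightarrow> dist (z q) (z p) < d1 / 2"
      using d1(1) unfolding uniformly_continuous_on_def by (metis half_gt_zero)
    obtain d3 where d3: "d3 > 0" "\<And>h. norm h < d3 \<Longrightarrow>
        norm (z (s, y1 + h) - z (s, y1) - z0' h) \<le> \<eta> * norm h"
    proof -
      from z0 \<eta>(1) obtain d3 where "d3 > 0" "\<And>y. norm (y - y1) < d3 \<Longrightarrow>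
          norm (z (s, y) - z (s, y1) - z0' (y - y1)) \<le> \<eta> * norm (y - y1)"
        unfolding has_derivative_at_alt by blast
      from this(1) this(2)[of "y1 + _"] show ?thesis by (intro that[of d3]) auto
    qed
    define d where "d = Min {d1 / 2, d2, d3, \<rho>}"
    have d: "d > 0" "d \<le> d1 / 2" "d \<le> d2" "d \<le> d3" "d \<le> \<rho>"
      using d1 d2 d3 \<rho> by (auto simp: d_def)
    have "norm (z (t1, y1 + h) - z (t1, y1) - w h t1) \<le> e * norm h" if h: "norm h < d" for h
    proof -
      let ?e = "\<lambda>r. z (r, y1 + h) - z (r, y1) - w h r"
      have yV: "y1 + h \<in> cball y1 \<rho>" "y1 + h \<in> V" using h d \<rho> by (auto simp: dist_norm)
      have "norm (?e t1) \<le> 2 * (norm (?e s) + (\<eta> * (C + 1) * norm h) * \<bar>t1 - s\<bar>)"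
      proof (rule gronwall_short[where L = "L + \<eta>" and z = ?e and
            z' = "\<lambda>r. G (r, z (r, y1 + h), y1 + h) - G (r, z (r, y1), y1) - DG r (0, w h r, h)"])
        fix r assume r: "r \<in> ?I"
        note rJ = IJ[OF r]
        show "(?e has_vector_derivative G (r, z (r, y1 + h), y1 + h) - G (r, z (r, y1), y1)
            - DG r (0, w h r, h)) (at r within ?I)"
          by (rule has_vector_derivative_at_within, intro has_vector_derivative_diff sol rJ yV y1
              w')
        \<comment> \<open>First-order expansion of \<open>G\<close> at the increment
          \<open>(0, \<Delta>, h)\<close>, where \<open>\<Delta>\<close> is the error
          \<open>?e r\<close> plus \<open>w h r\<close>. The error part is absorbed by Gronwall's
          inequality, the rest is of order \<open>norm h\<close>.\<close>
        define \<Delta> where "\<Delta> = z (r, y1 + h) - z (r, y1)"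
        have "dist (z (r, y1 + h)) (z (r, y1)) < d1 / 2"
          using r yV \<rho>(1) h d by (intro d2(2)) (auto simp: dist_Pair_Pair dist_norm)
        then have \<Delta>d: "norm \<Delta> < d1 / 2" by (simp add: \<Delta>_def dist_norm)
        have nk: "norm (0::real, \<Delta>, h) \<le> norm \<Delta> + norm h"
          using norm_triangle_ineq[of "(0::real, \<Delta>, 0)" "(0, 0, h)"] by (simp add: norm_Pair)
        then have "norm (0::real, \<Delta>, h) < d1" using \<Delta>d h d by linarith
        from d1(2)[OF r this]
        have 1: "norm (G (r, z (r, y1 + h), y1 + h) - G (r, z (r, y1), y1) - DG r (0, \<Delta>, h))
            \<le> \<eta> * norm (0::real, \<Delta>, h)"
          by (simp add: x_def \<Delta>_def)
        have "DG r (0, \<Delta>, h) - DG r (0, w h r, h) = DG r (0, ?e r, 0)"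
          using linear_diff[OF linDG[OF rJ], of "(0, \<Delta>, h)" "(0, w h r, h)"] by (simp add: \<Delta>_def)
        then have eq: "G (r, z (r, y1 + h), y1 + h) - G (r, z (r, y1), y1) - DG r (0, w h r, h)
          = (G (r, z (r, y1 + h), y1 + h) - G (r, z (r, y1), y1) - DG r (0, \<Delta>, h)) + DG r (0, ?e
              r, 0)"
          by (simp add: algebra_simps)
        have "norm \<Delta> \<le> norm (?e r) + C * norm h"
          using norm_triangle_ineq[of "?e r" "w h r"] wC[OF r, of h] by (simp add: \<Delta>_def)
        then have "norm (0::real, \<Delta>, h) \<le> norm (?e r) + (C + 1) * norm h"
          using nk by (simp add: algebra_simps)
        then have "\<eta> * norm (0::real, \<Delta>, h) \<le> \<eta> * (norm (?e r) + (C + 1) * norm h)"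
          using \<eta>(1) by (intro mult_left_mono) auto
        with 1 have "norm (G (r, z (r, y1 + h), y1 + h) - G (r, z (r, y1), y1) - DG r (0, w h r, h))
            \<le> \<eta> * (norm (?e r) + (C + 1) * norm h) + L * norm (?e r)"
          unfolding eq using bd'[OF rJ, of "?e r"] by (intro norm_triangle_le add_mono) auto
        then show "norm (G (r, z (r, y1 + h), y1 + h) - G (r, z (r, y1), y1) - DG r (0, w h r, h))
            \<le> (L + \<eta>) * norm (?e r) + \<eta> * (C + 1) * norm h"
          by (simp add: algebra_simps)
      next
        have "\<eta> * \<bar>t1 - s\<bar> \<le> \<eta> * D" using \<eta>(1) D by (intro mult_left_mono) auto
        then show "(L + \<eta>) * \<bar>t1 - s\<bar> \<le> 1 / 2" using Lt \<eta>(2) by (simp add: algebra_simps)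
      qed (use L \<eta> C in auto)
      also have "\<dots> \<le> 2 * (\<eta> * norm h + (\<eta> * (C + 1) * norm h) * D)"
        using d3(2)[of h] h d \<eta>(1) C D by (intro mult_left_mono add_mono) (auto simp: w0)
      also have "\<dots> = (\<eta> * E) * norm h" by (simp add: E_def algebra_simps)
      also have "\<dots> \<le> e * norm h" by (intro mult_right_mono \<eta>(3)) simp
      finally show ?thesis .
    qed
    with d(1) show ?thesis by blast
  qed
  then have *: "\<exists>d>0. \<forall>y. norm (y - y1) < d \<longrightarrow>
      norm (z (t1, y) - z (t1, y1) - w (y - y1) t1) \<le> e * norm (y - y1)" if "e > 0" for e
    using that by (metis add.commute diff_add_cancel)
  show ?thesis
    unfolding has_derivative_at_alt using linw * by (simp add: linear_conv_bounded_linear)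
qed

text \<open>The constant \<open>1 / 4\<close> leaves room for adding an arbitrarily small remainder to \<open>L\<close> in
  \<open>gronwall_short\<close>.\<close>

definition param_solution ::
  "(real \<times> 'e::euclidean_space \<times> 'p::euclidean_space) set \<Rightarrow> (real \<times> 'e \<times> 'p \<Rightarrow> 'e) \<Rightarrow>
    real \<Rightarrow> real \<Rightarrow> real \<Rightarrow> 'p set \<Rightarrow> (real \<times> 'p \<Rightarrow> 'e) \<Rightarrow> bool" where
  "param_solution U G a b s V z \<longleftrightarrow>
     open U \<and> Ck_on (Suc 0) U G \<and> s \<in> {a<..<b} \<and> open V \<and>
     (\<forall>t\<in>{a<..<b}. \<forall>y\<in>V. (t, z (t, y), y) \<in> U \<and>
       ((\<lambda>r. z (r, y)) has_vector_derivative G (t, z (t, y), y)) (at t)) \<and>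
     continuous_on ({a<..<b} \<times> V) z \<and> Ck_on (Suc 0) V (\<lambda>y. z (s, y)) \<and>
     (\<exists>L\<ge>0. L * (b - a) \<le> 1 / 4 \<and> (\<forall>t\<in>{a<..<b}. \<forall>y\<in>V. \<forall>u.
       norm (frechet_derivative G (at (t, z (t, y), y)) (0, u, 0)) \<le> L * norm u))"

text \<open>The linear part of the variational equation has the bound \<open>L\<close> of the given
  solution, so the variations live on the same interval. Joint differentiability is assembled from
  the parameter and time derivatives.\<close>

lemma param_solution_variation:
  assumes "param_solution U G a b s V z"
  shows "\<exists>w.
    (\<forall>v. \<forall>y\<in>V. w v (s, y) = frechet_derivative (\<lambda>y. z (s, y)) (at y) v) \<and>
    (\<forall>v. \<forall>t\<in>{a<..<b}. \<forall>y\<in>V. ((\<lambda>r. w v (r, y)) has_vector_derivative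
       frechet_derivative G (at (t, z (t, y), y)) (0, w v (t, y), v)) (at t)) \<and>
    (\<forall>t\<in>{a<..<b}. \<forall>y\<in>V. ((\<lambda>y. z (t, y)) has_derivative (\<lambda>v. w v (t, y))) (at y)) \<and>
    (\<forall>t\<in>{a<..<b}. \<forall>y\<in>V.
       (z has_derivative (\<lambda>h. fst h *\<^sub>R G (t, z (t, y), y) + w (snd h) (t, y))) (at (t, y)))"
proof -
  let ?J = "{a<..<b}"
  from assms obtain L where U: "open U" and G: "Ck_on (Suc 0) U G" and s: "s \<in> ?J" and V: "open V"
    and inU: "\<And>t y. t \<in> ?J \<Longrightarrow> y \<in> V \<Longrightarrow> (t, z (t, y), y) \<in> U"
    and sol: "\<And>t y. t \<in> ?J \<Longrightarrow> y \<in> V \<Longrightarrow>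
      ((\<lambda>r. z (r, y)) has_vector_derivative G (t, z (t, y), y)) (at t)"
    and zc: "continuous_on (?J \<times> V) z" and z0: "Ck_on (Suc 0) V (\<lambda>y. z (s, y))"
    and L: "0 \<le> L" "L * (b - a) \<le> 1 / 4"
    and bd: "\<And>t y u. t \<in> ?J \<Longrightarrow> y \<in> V \<Longrightarrow>
      norm (frechet_derivative G (at (t, z (t, y), y)) (0, u, 0)) \<le> L * norm u"
    unfolding param_solution_def by blast
  define DG where "DG t y = frechet_derivative G (at (t, z (t, y), y))" for t y
  have linDG: "linear (DG t y)" if "t \<in> ?J" "y \<in> V" for t y
    unfolding DG_def using has_derivative_linear[OF Ck_on_SucD[OF G inU[OF that]]] .
  have GDc: "continuous_on U (\<lambda>x. frechet_derivative G (at x) h)" for h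
    using G unfolding Ck_on.simps by blast
  have zt: "isCont (\<lambda>t. z (t, y)) r" if "r \<in> ?J" "y \<in> V" for r y
    by (rule has_vector_derivative_continuous[OF sol[OF that]])
  have "\<exists>u. u s = frechet_derivative (\<lambda>y. z (s, y)) (at y) v \<and>
      (\<forall>t\<in>?J. (u has_vector_derivative DG t y (0, u t, v)) (at t))" if y: "y \<in> V" for y v
  proof (rule picard_open[OF s, where H = "\<lambda>t u. DG t y (0, u, v)"])
    have "continuous_on ?J (\<lambda>t. (t, z (t, y), y))"
      using zt[OF _ y] by (intro continuous_intros continuous_at_imp_continuous_on) auto
    then have DGc: "continuous_on ?J (\<lambda>t. DG t y h)" for h
      unfolding DG_def
      by (rule continuous_on_compose2[OF GDc]) (use inU[OF _ y] in auto)
    have "continuous_on (?J \<times> UNIV) (\<lambda>x. \<Sum>i\<in>Basis. ((0, snd x, v) \<bullet> i) *\<^sub>R DG (fst x) y i)"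
      by (intro continuous_intros continuous_on_compose2[OF DGc]) auto
    moreover have "DG (fst x) y (0, snd x, v) = (\<Sum>i\<in>Basis. ((0, snd x, v) \<bullet> i) *\<^sub>R DG (fst x) y i)"
      if "x \<in> ?J \<times> UNIV" for x
      using linear_expand_Basis[OF linDG[of "fst x" y], of "(0, snd x, v)"] that y by auto
    ultimately show "continuous_on (?J \<times> UNIV) (\<lambda>(t, u). DG t y (0, u, v))"
      by (simp add: case_prod_beta cong: continuous_on_cong)
    show "norm (DG t y (0, u, v) - DG t y (0, u', v)) \<le> L * norm (u - u')" if "t \<in> ?J" for t u u'
      using linear_diff[OF linDG[OF that y], of "(0, u, v)" "(0, u', v)"] bd[OF that y, of "u - u'"]
      by (simp add: DG_def)
  qed (use L in auto)
  then obtain W where W0: "\<And>y v. y \<in> V \<Longrightarrow> W y v s = frechet_derivative (\<lambda>y. z (s, y)) (at y) v"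
    and W: "\<And>y v t. y \<in> V \<Longrightarrow> t \<in> ?J \<Longrightarrow> (W y v has_vector_derivative DG t y (0, W y v t, v)) (at t)"
    by metis
  define w where "w v x = W (snd x) v (fst x)" for v x
  have par: "((\<lambda>y. z (t, y)) has_derivative (\<lambda>v. w v (t, y))) (at y)" if "t \<in> ?J" "y \<in> V" for t y
    unfolding w_def fst_conv snd_conv
    by (rule param_ode_has_derivative_parameter[OF U G s V sol inU zc bd L Ck_on_SucD[OF z0
        that(2)]])
      (use that W0 W[unfolded DG_def] in auto)
  have joint: "(z has_derivative (\<lambda>h. fst h *\<^sub>R G (t, z (t, y), y) + w (snd h) (t, y))) (at (t, y))"
    if t: "t \<in> ?J" and y: "y \<in> V" for t y
  proof -
    have Gc: "continuous_on U G" using Ck_on_imp_continuous_on[OF G] .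
    have zc': "continuous_on (V \<times> ?J) (\<lambda>x. z (snd x, fst x))"
      by (intro continuous_on_compose2[OF zc] continuous_intros) auto
    have "continuous_on (V \<times> ?J) (\<lambda>x. G (snd x, z (snd x, fst x), fst x))"
      by (intro continuous_on_compose2[OF Gc] continuous_intros zc') (use inU in auto)
    then have "continuous_on (V \<times> ?J) (\<lambda>x. blinfun_scaleR_left (G (snd x, z (snd x, fst x), fst
        x)))"
      by (rule bounded_linear.continuous_on[OF bounded_linear_blinfun_scaleR_left])
    then have c: "continuous (at (y, t) within V \<times> ?J)
        (\<lambda>(y, t). blinfun_scaleR_left (G (t, z (t, y), y)))"
      using t y by (simp add: continuous_on_eq_continuous_within case_prod_unfold)
    \<comment> \<open>The rule for partial derivatives asks for continuity of the second partial
      only. The arguments are swapped so that this is the time derivative, which is \<open>G\<close>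
      along the solution.\<close>
    have "((\<lambda>(y, t). z (t, y)) has_derivative
        (\<lambda>(ty, tt). w ty (t, y) + blinfun_apply (blinfun_scaleR_left (G (t, z (t, y), y))) tt))
        (at (y, t) within V \<times> ?J)"
    proof (rule has_derivative_partialsI[OF _ _ c t])
      show "((\<lambda>y. z (t, y)) has_derivative (\<lambda>v. w v (t, y))) (at y within V)"
        by (rule has_derivative_at_withinI[OF par[OF t y]])
      show "((\<lambda>t. z (t, y)) has_derivative blinfun_apply (blinfun_scaleR_left (G (t, z (t, y), y))))
          (at t within ?J)" if "y \<in> V" "t \<in> ?J" for y t
        using has_vector_derivative_at_within[OF sol[OF that(2,1)]]
        by (simp add: has_vector_derivative_def)
    qed simp
    moreover have "at (y, t) within V \<times> ?J = at (y, t)"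
      using t y V by (intro at_within_open open_Times) auto
    ultimately have d: "((\<lambda>(y, t). z (t, y)) has_derivative
        (\<lambda>(ty, tt). w ty (t, y) + tt *\<^sub>R G (t, z (t, y), y))) (at (y, t))" by simp
    have "((\<lambda>x. (snd x, fst x)) has_derivative (\<lambda>h. (snd h, fst h))) (at (t, y))"
      by (auto intro!: derivative_eq_intros)
    moreover have "((\<lambda>p. z (snd p, fst p)) has_derivative
        (\<lambda>p. w (fst p) (t, y) + snd p *\<^sub>R G (t, z (t, y), y))) (at (snd (t, y), fst (t, y)))"
      using d by (simp add: case_prod_unfold)
    ultimately have "((\<lambda>x. z (snd (snd x, fst x), fst (snd x, fst x))) has_derivative
        (\<lambda>h. w (fst (snd h, fst h)) (t, y) + snd (snd h, fst h) *\<^sub>R G (t, z (t, y), y))) (at (t,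
            y))"
      by (rule has_derivative_compose)
    then show ?thesis by (simp add: add.commute)
  qed
  have "\<forall>v. \<forall>t\<in>?J. \<forall>y\<in>V. ((\<lambda>r. w v (r, y)) has_vector_derivative
       frechet_derivative G (at (t, z (t, y), y)) (0, w v (t, y), v)) (at t)"
    using W by (simp add: w_def DG_def)
  moreover have "\<forall>v. \<forall>y\<in>V. w v (s, y) = frechet_derivative (\<lambda>y. z (s, y)) (at y) v"
    using W0 by (simp add: w_def)
  ultimately show ?thesis using par joint by (intro exI[of _ w]) simp
qed

text \<open>Expanding in columns shows that \<open>A' u\<close> is linear in \<open>u\<close> and
  reduces the product rule for evaluation to finitely many scalar multiples.\<close>

lemma linear_family_has_derivative:
  fixes A :: "'a::euclidean_space \<Rightarrow> 'e::euclidean_space \<Rightarrow> 'f::euclidean_space"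
  assumes "open S" "x \<in> S" "\<And>x. x \<in> S \<Longrightarrow> linear (A x)"
    and "\<And>u. ((\<lambda>x. A x u) has_derivative A' u) (at x)"
  shows "((\<lambda>q. A (fst q) (snd q)) has_derivative (\<lambda>h. A' u (fst h) + A x (snd h))) (at (x, u))"
proof -
  have A'u: "A' u h = (\<Sum>i\<in>Basis. (u \<bullet> i) *\<^sub>R A' i h)" for h
  proof -
    have "((\<lambda>x. \<Sum>i\<in>Basis. (u \<bullet> i) *\<^sub>R A x i) has_derivative (\<lambda>h. \<Sum>i\<in>Basis. (u \<bullet> i) *\<^sub>R A' i h))
        (at x)"
      by (intro has_derivative_sum has_derivative_scaleR_right assms(4))
    then have "((\<lambda>x. A x u) has_derivative (\<lambda>h. \<Sum>i\<in>Basis. (u \<bullet> i) *\<^sub>R A' i h)) (at x)"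
      by (rule has_derivative_transform_within_open[OF _ assms(1,2)])
        (use linear_expand_Basis[OF assms(3)] in metis)
    from has_derivative_unique[OF assms(4) this] show ?thesis by metis
  qed
  have "((\<lambda>q. \<Sum>i\<in>Basis. (snd q \<bullet> i) *\<^sub>R A (fst q) i) has_derivative
      (\<lambda>h. \<Sum>i\<in>Basis. (u \<bullet> i) *\<^sub>R A' i (fst h) + (snd h \<bullet> i) *\<^sub>R A x i)) (at (x, u))"
  proof (rule has_derivative_sum)
    fix i :: 'e
    have "((\<lambda>q. A (fst q) i) has_derivative (\<lambda>h. A' i (fst h))) (at (x, u))"
      using has_derivative_compose[OF has_derivative_fst[OF has_derivative_ident], of "\<lambda>x. A x i"
          "A' i" "(x, u)" UNIV]
        assms(4)[of i] by simp
    then show "((\<lambda>q. (snd q \<bullet> i) *\<^sub>R A (fst q) i) has_derivative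
        (\<lambda>h. (u \<bullet> i) *\<^sub>R A' i (fst h) + (snd h \<bullet> i) *\<^sub>R A x i)) (at (x, u))"
      by (auto intro!: derivative_eq_intros)
  qed
  then have "((\<lambda>q. A (fst q) (snd q)) has_derivative
      (\<lambda>h. \<Sum>i\<in>Basis. (u \<bullet> i) *\<^sub>R A' i (fst h) + (snd h \<bullet> i) *\<^sub>R A x i)) (at (x, u))"
    by (rule has_derivative_transform_within_open[of _ _ _ _ "S \<times> UNIV"])
      (use assms(1,2) linear_expand_Basis[OF assms(3)] in \<open>auto simp: open_Times\<close>)
  moreover have "(\<Sum>i\<in>Basis. (u \<bullet> i) *\<^sub>R A' i (fst h) + (snd h \<bullet> i) *\<^sub>R A x i)
      = A' u (fst h) + A x (snd h)" for h
    using linear_expand_Basis[OF assms(3)[OF assms(2)], of "snd h"]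
    by (simp add: sum.distrib A'u[of "fst h"])
  ultimately show ?thesis by simp
qed

lemma linear_family_Ck_on:
  fixes A :: "'a::euclidean_space \<Rightarrow> 'e::euclidean_space \<Rightarrow> 'f::euclidean_space"
  assumes S: "open S" and "\<And>x. x \<in> S \<Longrightarrow> linear (A x)"
    and "\<And>u. Ck_on k S (\<lambda>x. A x u)" and "Ck_on k S c"
  shows "Ck_on k S (\<lambda>x. A x (c x))"
proof (rule Ck_on_cong[OF S])
  show "(\<Sum>i\<in>Basis. (c x \<bullet> i) *\<^sub>R A x i) = A x (c x)" if "x \<in> S" for x
    using linear_expand_Basis[OF assms(2)[OF that], of "c x"] by simp
  show "Ck_on k S (\<lambda>x. \<Sum>i\<in>Basis. (c x \<bullet> i) *\<^sub>R A x i)"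
    by (intro Ck_on_sum[OF S] Ck_on_bilinear[OF bounded_bilinear_scaleR S]
        Ck_on_bilinear[OF bounded_bilinear_inner S] assms Ck_on_const)
qed

text \<open>Every directional derivative of a solution solves a linear equation with the same linear
  part, so the length of the interval does not shrink with \<open>k\<close>.\<close>

lemma linear_ode_Ck_on:
  fixes A :: "real \<times> 'p::euclidean_space \<Rightarrow> 'e::euclidean_space \<Rightarrow> 'e"
  assumes s: "s \<in> {a<..<b}" and V: "open V"
    and lin: "\<And>x. x \<in> {a<..<b} \<times> V \<Longrightarrow> linear (A x)"
    and bd: "\<And>x u. x \<in> {a<..<b} \<times> V \<Longrightarrow> norm (A x u) \<le> L * norm u"
    and L: "0 \<le> L" "L * (b - a) \<le> 1 / 4"
    and A: "\<And>u. Ck_on k ({a<..<b} \<times> V) (\<lambda>x. A x u)"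
    and B: "Ck_on k ({a<..<b} \<times> V) B" and w0: "Ck_on k V (\<lambda>y. w (s, y))"
    and sol: "\<And>t y. t \<in> {a<..<b} \<Longrightarrow> y \<in> V \<Longrightarrow>
      ((\<lambda>r. w (r, y)) has_vector_derivative A (t, y) (w (t, y)) + B (t, y)) (at t)"
  shows "Ck_on k ({a<..<b} \<times> V) w"
  using A B w0 sol
proof (induction k arbitrary: B w)
  case 0
  have L': "L * (b - a) \<le> 1 / 2" using L(2) by simp
  have "continuous_on ({a<..<b} \<times> V) (\<lambda>x. A x u)" for u using 0(1)[of u] by simp
  from linear_ode_continuous_on[OF s V 0(4) lin bd L(1) L' this] 0(2,3)
  show ?case by simp
next
  case (Suc k)
  let ?J = "{a<..<b}"
  let ?S = "?J \<times> V"
  note A = Suc.prems(1) and B = Suc.prems(2) and w0 = Suc.prems(3) and sol = Suc.prems(4)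
  have S: "open ?S" using V by (intro open_Times) auto
  have Ak: "Ck_on k ?S (\<lambda>x. A x u)" for u using A by (rule Ck_on_Suc_imp)
  \<comment> \<open>The induction hypothesis is needed for \<open>w\<close> itself, because the
    forcing in the equation of its variations contains \<open>w\<close>.\<close>
  have wk: "Ck_on k ?S w"
    by (rule Suc.IH[OF Ak Ck_on_Suc_imp[OF B] Ck_on_Suc_imp[OF w0] sol])
  have w_cont: "continuous_on ?S w" using wk by (rule Ck_on_imp_continuous_on)
  \<comment> \<open>The linear equation is recast as a parameter equation, so that
    \<open>param_solution_variation\<close> provides its variations.\<close>
  define G where "G = (\<lambda>q :: real \<times> 'e \<times> 'p. A (fst q, snd (snd q)) (fst (snd q)) + B (fst q, snd
      (snd q)))"
  define U where "U = {q :: real \<times> 'e \<times> 'p. (fst q, snd (snd q)) \<in> ?S}"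
  have "U = ?J \<times> UNIV \<times> V" by (auto simp: U_def)
  then have U: "open U" using V by (simp add: open_Times)
  define Ad where "Ad x u h = frechet_derivative (\<lambda>x. A x u) (at x) h" for x u h
  define Bd where "Bd x h = frechet_derivative B (at x) h" for x h
  have dA: "((\<lambda>x. A x u) has_derivative Ad x u) (at x)" if "x \<in> ?S" for x u
    unfolding Ad_def using Ck_on_SucD[OF A that] .
  have dB: "(B has_derivative Bd x) (at x)" if "x \<in> ?S" for x
    unfolding Bd_def using Ck_on_SucD[OF B that] .
  have dG: "(G has_derivative (\<lambda>h. Ad (t, y) u (fst h, snd (snd h)) + A (t, y) (fst (snd h))
      + Bd (t, y) (fst h, snd (snd h)))) (at (t, u, y))"
    if "(t, y) \<in> ?S" for t u y
  proof -
    have p: "((\<lambda>q::real \<times> 'e \<times> 'p. (fst q, snd (snd q))) has_derivative (\<lambda>h. (fst h, snd (snd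
        h)))) (at (t, u, y))"
      "((\<lambda>q::real \<times> 'e \<times> 'p. ((fst q, snd (snd q)), fst (snd q))) has_derivative
        (\<lambda>h. ((fst h, snd (snd h)), fst (snd h)))) (at (t, u, y))"
      by (auto intro!: derivative_eq_intros)
    have "((\<lambda>q. A (fst q) (snd q)) has_derivative (\<lambda>h. Ad (t, y) u (fst h) + A (t, y) (snd h)))
        (at ((fst (t, u, y), snd (snd (t, u, y))), fst (snd (t, u, y))))"
      using linear_family_has_derivative[OF S that lin dA[OF that], of u] by simp
    note 1 = has_derivative_compose[OF p(2) this]
    have "(B has_derivative Bd (t, y)) (at (fst (t, u, y), snd (snd (t, u, y))))"
      using dB[OF that] by simp
    note 2 = has_derivative_compose[OF p(1) this]
    show ?thesis
      unfolding G_def using has_derivative_add[OF 1 2] by simp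
  qed
  have GC1: "Ck_on (Suc 0) U G"
  proof -
    have p: "Ck_on (Suc 0) U (\<lambda>q. (fst q, snd (snd q)))" "Ck_on (Suc 0) U (\<lambda>q. fst (snd q))"
      by (intro Ck_on_bounded_linear bounded_linear_intros)+
    have im: "(\<lambda>q. (fst q, snd (snd q))) ` U \<subseteq> ?S" by (auto simp: U_def)
    have lq: "linear (A (fst q, snd (snd q)))" if "q \<in> U" for q
      using that lin by (auto simp: U_def)
    have "Ck_on (Suc 0) U (\<lambda>q. A (fst q, snd (snd q)) u)" for u
      by (rule Ck_on_compose[OF U im p(1) Ck_on_mono[OF A]]) simp
    from linear_family_Ck_on[OF U lq this p(2)]
    have "Ck_on (Suc 0) U (\<lambda>q. A (fst q, snd (snd q)) (fst (snd q)))" .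
    moreover have "Ck_on (Suc 0) U (\<lambda>q. B (fst q, snd (snd q)))"
      by (rule Ck_on_compose[OF U im p(1) Ck_on_mono[OF B]]) simp
    ultimately show ?thesis unfolding G_def by (rule Ck_on_add[OF U])
  qed
  have DG: "frechet_derivative G (at (t, u, y)) h = Ad (t, y) u (fst h, snd (snd h))
      + A (t, y) (fst (snd h)) + Bd (t, y) (fst h, snd (snd h))"
    if "(t, y) \<in> ?S" for t u y h
    by (simp only: frechet_derivative_at[OF dG[OF that], symmetric])
  have zero: "Ad x u (0, 0) = 0" "Bd x (0, 0) = 0" if "x \<in> ?S" for x u
    using has_derivative_linear[OF dA[OF that, of u]] has_derivative_linear[OF dB[OF that]]
    by (simp_all add: linear_0 flip: zero_prod_def)
  have "\<forall>t\<in>?J. \<forall>y\<in>V. \<forall>u. norm (frechet_derivative G (at (t, w (t, y), y)) (0, u, 0)) \<le> L * norm u"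
    using zero bd by (simp add: DG)
  then have ex: "\<exists>L\<ge>0. L * (b - a) \<le> 1 / 4 \<and> (\<forall>t\<in>?J. \<forall>y\<in>V. \<forall>u.
      norm (frechet_derivative G (at (t, w (t, y), y)) (0, u, 0)) \<le> L * norm u)"
    using L by blast
  have "\<forall>t\<in>?J. \<forall>y\<in>V. (t, w (t, y), y) \<in> U \<and>
      ((\<lambda>r. w (r, y)) has_vector_derivative G (t, w (t, y), y)) (at t)"
    using sol by (simp add: U_def G_def)
  moreover have "Ck_on (Suc 0) V (\<lambda>y. w (s, y))" using w0 by (rule Ck_on_mono) simp
  ultimately have "param_solution U G a b s V w"
    unfolding param_solution_def using U GC1 s V w_cont ex by simp
  from param_solution_variation[OF this] obtain W where
    W: "(\<forall>v. \<forall>y\<in>V. W v (s, y) = frechet_derivative (\<lambda>y. w (s, y)) (at y) v) \<and>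
    (\<forall>v. \<forall>t\<in>?J. \<forall>y\<in>V. ((\<lambda>r. W v (r, y)) has_vector_derivative
       frechet_derivative G (at (t, w (t, y), y)) (0, W v (t, y), v)) (at t)) \<and>
    (\<forall>t\<in>?J. \<forall>y\<in>V. ((\<lambda>y. w (t, y)) has_derivative (\<lambda>v. W v (t, y))) (at y)) \<and>
    (\<forall>t\<in>?J. \<forall>y\<in>V.
       (w has_derivative (\<lambda>h. fst h *\<^sub>R G (t, w (t, y), y) + W (snd h) (t, y))) (at (t, y)))" ..
  note W0 = W[THEN conjunct1, rule_format]
    and W1 = W[THEN conjunct2, THEN conjunct1, rule_format]
    and W2 = W[THEN conjunct2, THEN conjunct2, THEN conjunct2, rule_format]
  have AB: "Ck_on k ?S (\<lambda>x. A x (w x) + B x)"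
    by (rule Ck_on_add[OF S linear_family_Ck_on[OF S lin Ak wk] Ck_on_Suc_imp[OF B]])
  have Wk: "Ck_on k ?S (W v)" for v
  proof (rule Suc.IH[OF Ak])
    \<comment> \<open>Linearity in \<open>u\<close>, used at \<open>u = w x\<close>, splits the
      forcing into products of functions of class \<open>C^k\<close>.\<close>
    have linAd: "Ad x u h = (\<Sum>i\<in>Basis. (u \<bullet> i) *\<^sub>R Ad x i h)" if "x \<in> ?S" for x u h
    proof -
      have "((\<lambda>x. \<Sum>i\<in>Basis. (u \<bullet> i) *\<^sub>R A x i) has_derivative (\<lambda>h. \<Sum>i\<in>Basis. (u \<bullet> i) *\<^sub>R Ad x i
          h)) (at x)"
        by (intro has_derivative_sum has_derivative_scaleR_right dA that)
      then have "((\<lambda>x. A x u) has_derivative (\<lambda>h. \<Sum>i\<in>Basis. (u \<bullet> i) *\<^sub>R Ad x i h)) (at x)"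
        by (rule has_derivative_transform_within_open[OF _ S that])
          (use linear_expand_Basis[OF lin] in metis)
      from has_derivative_unique[OF dA[OF that] this] show ?thesis by metis
    qed
    have "Ck_on k ?S (\<lambda>x. (\<Sum>i\<in>Basis. (w x \<bullet> i) *\<^sub>R Ad x i (0, v)) + Bd x (0, v))"
      using A B
      by (intro Ck_on_add[OF S] Ck_on_sum[OF S] Ck_on_bilinear[OF bounded_bilinear_scaleR S]
          Ck_on_bilinear[OF bounded_bilinear_inner S] wk Ck_on_const) (simp_all add: Ad_def Bd_def)
    then show "Ck_on k ?S (\<lambda>x. Ad x (w x) (0, v) + Bd x (0, v))"
      by (rule Ck_on_cong[OF S, rotated]) (use linAd in metis)
    have "Ck_on k V (\<lambda>y. frechet_derivative (\<lambda>y. w (s, y)) (at y) v)" using w0 by simp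
    then show "Ck_on k V (\<lambda>y. W v (s, y))" by (rule Ck_on_cong[OF V, rotated]) (simp add: W0)
    show "((\<lambda>r. W v (r, y)) has_vector_derivative A (t, y) (W v (t, y)) +
        (Ad (t, y) (w (t, y)) (0, v) + Bd (t, y) (0, v))) (at t)" if "t \<in> ?J" "y \<in> V" for t y
      using W1[OF that, of v] that by (simp add: DG algebra_simps)
  qed
  show ?case
  proof (rule Ck_on_SucI[OF S])
    show "(w has_derivative (\<lambda>h. fst h *\<^sub>R (A x (w x) + B x) + W (snd h) x)) (at x)" if "x \<in> ?S"
        for x
      using W2[of "fst x" "snd x"] that by (auto simp: G_def)
    show "Ck_on k ?S (\<lambda>x. fst h *\<^sub>R (A x (w x) + B x) + W (snd h) x)" for h
      by (rule Ck_on_add[OF S Ck_on_linear_comp[OF bounded_linear_scaleR_right S AB] Wk])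
  qed
qed

section \<open>Local flows\<close>

text \<open>Both curves start in a compact convex box inside \<open>U\<close>, on which the field is
  Lipschitz, and by continuity stay there for a while. Derivatives are taken within
  \<open>I\<close>, so \<open>s\<close> may be an endpoint.\<close>

lemma ode_unique_near:
  fixes F :: "real \<times> 'e::euclidean_space \<Rightarrow> 'e"
  assumes U: "open U" and F: "Ck_on (Suc 0) U F" and I: "convex I" "s \<in> I"
    and z1: "\<And>t. t \<in> I \<Longrightarrow> (z1 has_vector_derivative F (t, z1 t)) (at t within I)"
    and z2: "\<And>t. t \<in> I \<Longrightarrow> (z2 has_vector_derivative F (t, z2 t)) (at t within I)"
    and eq: "z1 s = z2 s" and sU: "(s, z1 s) \<in> U"
  shows "\<exists>\<delta>>0. \<forall>t\<in>I. \<bar>t - s\<bar> < \<delta> \<longrightarrow> z1 t = z2 t"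
proof -
  obtain A B where "open A" "open B" "(s, z1 s) \<in> A \<times> B" "A \<times> B \<subseteq> U"
    using U sU by (rule open_prod_elim)
  then have AB: "open A" "open B" "s \<in> A" "z1 s \<in> B" "A \<times> B \<subseteq> U" by auto
  obtain r1 where r1: "r1 > 0" "cball s r1 \<subseteq> A"
    using AB(1,3) by (meson open_contains_cball)
  obtain r2 where r2: "r2 > 0" "cball (z1 s) r2 \<subseteq> B"
    using AB(2,4) by (meson open_contains_cball)
  define K where "K = cball s r1 \<times> cball (z1 s) r2"
  have K: "compact K" "convex K" "K \<subseteq> U"
    using AB r1 r2 by (auto simp: K_def intro!: compact_Times convex_Times)
  obtain L where L: "L \<ge> 0" "\<And>x y. x \<in> K \<Longrightarrow> y \<in> K \<Longrightarrow> norm (F x - F y) \<le> L * norm (x - y)"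
    using C1_lipschitz_compact_convex[OF F K] by blast
  have near: "\<exists>\<delta>>0. \<forall>t\<in>I. \<bar>t - s\<bar> < \<delta> \<longrightarrow> z t \<in> cball (z1 s) r2"
    if "(z has_vector_derivative z') (at s within I)" "z s = z1 s" for z z'
  proof -
    have "continuous (at s within I) z" using that(1) by (rule has_vector_derivative_continuous)
    then obtain \<delta> where "\<delta> > 0" "\<forall>t\<in>I. dist t s < \<delta> \<longrightarrow> dist (z t) (z s) < r2"
      using r2(1) unfolding continuous_within_eps_delta by blast
    then show ?thesis using that(2) by (auto simp: dist_real_def dist_commute intro!: exI[of _ \<delta>]
        less_imp_le)
  qed
  obtain \<delta>1 where \<delta>1: "\<delta>1 > 0" "\<And>t. t \<in> I \<Longrightarrow> \<bar>t - s\<bar> < \<delta>1 \<Longrightarrow> z1 t \<in> cball (z1 s) r2"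
    using near[OF z1[OF I(2)]] by auto
  obtain \<delta>2 where \<delta>2: "\<delta>2 > 0" "\<And>t. t \<in> I \<Longrightarrow> \<bar>t - s\<bar> < \<delta>2 \<Longrightarrow> z2 t \<in> cball (z1 s) r2"
    using near[OF z2[OF I(2)]] eq by auto
  \<comment> \<open>\<open>L + 1\<close> instead of \<open>L\<close> avoids a division by zero and
    still gives \<open>L * \<delta> \<le> 1 / 2\<close>.\<close>
  define \<delta> where "\<delta> = Min {r1, \<delta>1, \<delta>2, 1 / (2 * (L + 1))}"
  have \<delta>: "\<delta> > 0" "\<delta> \<le> r1" "\<delta> \<le> \<delta>1" "\<delta> \<le> \<delta>2" "\<delta> \<le> 1 / (2 * (L + 1))"
    using r1 \<delta>1 \<delta>2 L by (auto simp: \<delta>_def)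
  have "z1 t = z2 t" if t: "t \<in> I" "\<bar>t - s\<bar> < \<delta>" for t
  proof (rule ode_unique_short[where H = "\<lambda>r u. F (r, u)" and L = L and s = s and z = z1 and w =
      z2])
    have sub: "closed_segment s t \<subseteq> I" using I t by (simp add: closed_segment_subset)
    fix r assume r: "r \<in> closed_segment s t"
    then have rI: "r \<in> I" using sub by auto
    show "(z1 has_vector_derivative F (r, z1 r)) (at r within closed_segment s t)"
      by (rule has_vector_derivative_within_subset[OF z1[OF rI] sub])
    show "(z2 has_vector_derivative F (r, z2 r)) (at r within closed_segment s t)"
      by (rule has_vector_derivative_within_subset[OF z2[OF rI] sub])
    have rs: "\<bar>r - s\<bar> < \<delta>"
      using r t by (auto simp: closed_segment_eq_real_ivl split: if_splits)
    have "(r, z1 r) \<in> K" "(r, z2 r) \<in> K"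
      using \<delta>1(2)[OF rI] \<delta>2(2)[OF rI] rs \<delta> by (auto simp: K_def dist_real_def)
    from L(2)[OF this] show "norm (F (r, z1 r) - F (r, z2 r)) \<le> L * norm (z1 r - z2 r)"
      by (simp add: norm_Pair)
  next
    have "L * \<bar>t - s\<bar> \<le> (L + 1) * (1 / (2 * (L + 1)))"
      using t \<delta> L(1) by (intro mult_mono) auto
    also have "\<dots> = 1 / 2" using L(1) by (simp add: field_simps)
    finally show "L * \<bar>t - s\<bar> \<le> 1 / 2" .
  qed (use L eq in auto)
  with \<delta>(1) show ?thesis by blast
qed

text \<open>The last conjunct is the variational equation; it gives the time derivative of the tangent map
  of the flow.\<close>

definition flow_box ::
  "(real \<times> 'e::euclidean_space) set \<Rightarrow> (real \<times> 'e \<Rightarrow> 'e) \<Rightarrow> real set \<Rightarrow> 'e set \<Rightarrow> real \<Rightarrow>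
    (real \<times> 'e \<Rightarrow> 'e) \<Rightarrow> bool" where
  "flow_box U F J V s \<Psi> \<longleftrightarrow>
     (\<forall>k. Ck_on k (J \<times> V) \<Psi>) \<and> (\<forall>y\<in>V. \<Psi> (s, y) = y) \<and>
     (\<forall>t\<in>J. \<forall>y\<in>V. (t, \<Psi> (t, y)) \<in> U \<and>
        ((\<lambda>r. \<Psi> (r, y)) has_vector_derivative F (t, \<Psi> (t, y))) (at t) \<and>
        (\<forall>v. ((\<lambda>r. frechet_derivative (\<lambda>y. \<Psi> (r, y)) (at y) v) has_vector_derivative
          frechet_derivative F (at (t, \<Psi> (t, y)))
            (0, frechet_derivative (\<lambda>y. \<Psi> (t, y)) (at y) v)) (at t)))"

text \<open>A bootstrap in \<open>k\<close>: if \<open>\<Psi>\<close> is of class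
  \<open>C^k\<close>, so are the coefficients of the variational equation and hence its solutions.
  Together with the field along \<open>\<Psi>\<close> these make up the derivative of
  \<open>\<Psi>\<close>.\<close>

lemma flow_box_exists:
  fixes F :: "real \<times> 'e::euclidean_space \<Rightarrow> 'e"
  assumes U: "open U" and F: "\<And>k. Ck_on k U F" and V: "open V" and s: "s \<in> {a<..<b}"
    and L: "0 \<le> L" "L * (b - a) \<le> 1 / 4"
    and inU: "\<And>t y. t \<in> {a<..<b} \<Longrightarrow> y \<in> V \<Longrightarrow> (t, \<Psi> (t, y)) \<in> U"
    and sol: "\<And>t y. t \<in> {a<..<b} \<Longrightarrow> y \<in> V \<Longrightarrow>
      ((\<lambda>r. \<Psi> (r, y)) has_vector_derivative F (t, \<Psi> (t, y))) (at t)"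
    and init: "\<And>y. y \<in> V \<Longrightarrow> \<Psi> (s, y) = y"
    and cont: "continuous_on ({a<..<b} \<times> V) \<Psi>"
    and bd: "\<And>t y u. t \<in> {a<..<b} \<Longrightarrow> y \<in> V \<Longrightarrow>
      norm (frechet_derivative F (at (t, \<Psi> (t, y))) (0, u)) \<le> L * norm u"
  shows "flow_box U F {a<..<b} V s \<Psi>"
proof -
  let ?J = "{a<..<b}"
  have S: "open (?J \<times> V)" using V by (simp add: open_Times)
  \<comment> \<open>The parameter is the initial value; it enters only through the condition at
    \<open>s\<close>, so the equation itself ignores it.\<close>
  define G where "G = (\<lambda>q :: real \<times> 'e \<times> 'e. F (fst q, fst (snd q)))"
  define UG where "UG = {q :: real \<times> 'e \<times> 'e. (fst q, fst (snd q)) \<in> U}"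
  have UG: "open UG"
    using open_vimage[OF U, of "\<lambda>q :: real \<times> 'e \<times> 'e. (fst q, fst (snd q))"]
    unfolding UG_def vimage_def by (simp add: continuous_intros)
  have "Ck_on (Suc 0) UG (\<lambda>q. (fst q, fst (snd q)))"
    by (intro Ck_on_bounded_linear bounded_linear_intros)
  then have GC1: "Ck_on (Suc 0) UG G"
    unfolding G_def by (rule Ck_on_compose[OF UG _ _ F, rotated]) (auto simp: UG_def)
  have DG: "frechet_derivative G (at (t, u, y)) h = frechet_derivative F (at (t, u)) (fst h, fst
      (snd h))"
    if "(t, u) \<in> U" for t u y h
  proof -
    have "((\<lambda>q::real \<times> 'e \<times> 'e. (fst q, fst (snd q))) has_derivative (\<lambda>h. (fst h, fst (snd h))))
        (at (t, u, y))"
      by (auto intro!: derivative_eq_intros)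
    moreover have "(F has_derivative frechet_derivative F (at (t, u)))
        (at (fst (t, u, y), fst (snd (t, u, y))))"
      using Ck_on_SucD[OF F that] by simp
    ultimately have "(G has_derivative (\<lambda>h. frechet_derivative F (at (t, u)) (fst h, fst (snd
        h)))) (at (t, u, y))"
      unfolding G_def by (rule has_derivative_compose)
    from frechet_derivative_at[OF this, symmetric] show ?thesis by simp
  qed
  have idC: "Ck_on k V (\<lambda>y. \<Psi> (s, y))" for k
    by (rule Ck_on_cong[OF V _ Ck_on_bounded_linear[OF bounded_linear_ident]]) (simp add: init)
  have "\<forall>t\<in>?J. \<forall>y\<in>V. (t, \<Psi> (t, y), y) \<in> UG \<and>
      ((\<lambda>r. \<Psi> (r, y)) has_vector_derivative G (t, \<Psi> (t, y), y)) (at t)"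
    using inU sol by (simp add: UG_def G_def)
  moreover have "\<exists>L\<ge>0. L * (b - a) \<le> 1 / 4 \<and> (\<forall>t\<in>?J. \<forall>y\<in>V. \<forall>u.
      norm (frechet_derivative G (at (t, \<Psi> (t, y), y)) (0, u, 0)) \<le> L * norm u)"
    using L bd inU by (intro exI[of _ L]) (simp add: DG)
  ultimately have "param_solution UG G a b s V \<Psi>"
    unfolding param_solution_def using UG GC1 s V cont idC[of "Suc 0"] by simp
  from param_solution_variation[OF this] obtain W where
    W: "(\<forall>v. \<forall>y\<in>V. W v (s, y) = frechet_derivative (\<lambda>y. \<Psi> (s, y)) (at y) v) \<and>
    (\<forall>v. \<forall>t\<in>?J. \<forall>y\<in>V. ((\<lambda>r. W v (r, y)) has_vector_derivative
       frechet_derivative G (at (t, \<Psi> (t, y), y)) (0, W v (t, y), v)) (at t)) \<and>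
    (\<forall>t\<in>?J. \<forall>y\<in>V. ((\<lambda>y. \<Psi> (t, y)) has_derivative (\<lambda>v. W v (t, y))) (at y)) \<and>
    (\<forall>t\<in>?J. \<forall>y\<in>V.
       (\<Psi> has_derivative (\<lambda>h. fst h *\<^sub>R G (t, \<Psi> (t, y), y) + W (snd h) (t, y))) (at (t, y)))" ..
  note W0 = W[THEN conjunct1, rule_format]
    and W1 = W[THEN conjunct2, THEN conjunct1, rule_format]
    and W2 = W[THEN conjunct2, THEN conjunct2, THEN conjunct1, rule_format]
    and W3 = W[THEN conjunct2, THEN conjunct2, THEN conjunct2, rule_format]
  define A where "A x u = frechet_derivative F (at (fst x, \<Psi> x)) (0, u)" for x u
  have FU: "(F has_derivative frechet_derivative F (at (fst x, \<Psi> x))) (at (fst x, \<Psi> x))"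
    if "x \<in> ?J \<times> V" for x
    using that inU by (intro Ck_on_SucD[OF F]) auto
  have linA: "linear (A x)" if "x \<in> ?J \<times> V" for x
  proof -
    have "linear (\<lambda>u::'e. (0::real, u))" by (intro linearI) auto
    from linear_compose[OF this has_derivative_linear[OF FU[OF that]]]
    show ?thesis by (simp add: A_def[abs_def] o_def)
  qed
  have A_bd: "norm (A x u) \<le> L * norm u" if "x \<in> ?J \<times> V" for x u
    using that bd[of "fst x" "snd x" u] by (auto simp: A_def)
  have W1': "((\<lambda>r. W v (r, y)) has_vector_derivative A (t, y) (W v (t, y)) + 0) (at t)"
    if "t \<in> ?J" "y \<in> V" for v t y
    using W1[OF that, of v] by (simp add: DG[OF inU[OF that]] A_def)
  have FW: "frechet_derivative (\<lambda>y. \<Psi> (t, y)) (at y) v = W v (t, y)" if "t \<in> ?J" "y \<in> V" for t y v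
    by (simp only: frechet_derivative_at[OF W2[OF that], symmetric])
  have \<Psi>Ck: "Ck_on k (?J \<times> V) \<Psi>" for k
  proof (induction k)
    case 0
    then show ?case using cont by simp
  next
    case (Suc k)
    have im: "(\<lambda>x. (fst x, \<Psi> x)) ` (?J \<times> V) \<subseteq> U" using inU by auto
    have pk: "Ck_on k (?J \<times> V) (\<lambda>x. (fst x, \<Psi> x))"
      by (rule Ck_on_Pair[OF S Ck_on_bounded_linear[OF bounded_linear_fst] Suc])
    have Fk: "Ck_on k (?J \<times> V) (\<lambda>x. F (fst x, \<Psi> x))"
      by (rule Ck_on_compose[OF S im pk F])
    have Ak: "Ck_on k (?J \<times> V) (\<lambda>x. A x u)" for u
    proof -
      have "Ck_on k U (\<lambda>q. frechet_derivative F (at q) (0, u))"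
        using F[of "Suc k"] by simp
      from Ck_on_compose[OF S im pk this] show ?thesis by (simp add: A_def)
    qed
    have Wk: "Ck_on k (?J \<times> V) (W v)" for v
    proof (rule linear_ode_Ck_on[OF s V linA A_bd L Ak Ck_on_const _ W1'])
      have "Ck_on k V (\<lambda>y. frechet_derivative (\<lambda>y. \<Psi> (s, y)) (at y) v)"
        using idC[of "Suc k"] by simp
      then show "Ck_on k V (\<lambda>y. W v (s, y))"
        by (rule Ck_on_cong[OF V, rotated]) (simp add: W0)
    qed
    show ?case
    proof (rule Ck_on_SucI[OF S])
      show "(\<Psi> has_derivative (\<lambda>h. fst h *\<^sub>R F (fst x, \<Psi> x) + W (snd h) x)) (at x)"
        if "x \<in> ?J \<times> V" for x
        using W3[of "fst x" "snd x"] that by (auto simp: G_def)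
      show "Ck_on k (?J \<times> V) (\<lambda>x. fst h *\<^sub>R F (fst x, \<Psi> x) + W (snd h) x)" for h
        by (rule Ck_on_add[OF S Ck_on_linear_comp[OF bounded_linear_scaleR_right S Fk] Wk])
    qed
  qed
  have var: "((\<lambda>r. frechet_derivative (\<lambda>y. \<Psi> (r, y)) (at y) v) has_vector_derivative
      frechet_derivative F (at (t, \<Psi> (t, y))) (0, frechet_derivative (\<lambda>y. \<Psi> (t, y)) (at y) v)) (at
          t)"
    if t: "t \<in> ?J" and y: "y \<in> V" for t y v
  proof -
    have "((\<lambda>r. W v (r, y)) has_vector_derivative A (t, y) (W v (t, y))) (at t)"
      using W1'[OF t y] by simp
    then have "((\<lambda>r. frechet_derivative (\<lambda>y. \<Psi> (r, y)) (at y) v) has_vector_derivative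
        A (t, y) (W v (t, y))) (at t)"
      by (rule has_vector_derivative_transform_within_open[OF _ _ t]) (use FW[OF _ y] in auto)
    then show ?thesis by (simp add: A_def FW[OF t y])
  qed
  show ?thesis
    unfolding flow_box_def using \<Psi>Ck init inU sol var by simp
qed

text \<open>One neighbourhood \<open>V\<close> and one interval serve every initial time
  \<open>s\<close> in the interval. The later compactness argument consumes this uniformity in
  \<open>s\<close>.\<close>

lemma local_flow:
  fixes F :: "real \<times> 'e::euclidean_space \<Rightarrow> 'e"
  assumes U: "open U" and F: "\<And>k. Ck_on k U F" and x0: "(t0, y0) \<in> U"
  shows "\<exists>\<epsilon>>0. \<exists>V. open V \<and> y0 \<in> V \<and>
    (\<forall>s\<in>{t0 - \<epsilon><..<t0 + \<epsilon>}. \<exists>\<Psi>. flow_box U F {t0 - \<epsilon><..<t0 + \<epsilon>} V s \<Psi>)"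
proof -
  obtain A B where "open A" "open B" "(t0, y0) \<in> A \<times> B" "A \<times> B \<subseteq> U"
    using U x0 by (rule open_prod_elim)
  then have AB: "open A" "open B" "t0 \<in> A" "y0 \<in> B" "A \<times> B \<subseteq> U" by auto
  obtain r1 where r1: "r1 > 0" "cball t0 r1 \<subseteq> A"
    using AB(1,3) by (meson open_contains_cball)
  obtain r2 where r2: "r2 > 0" "cball y0 r2 \<subseteq> B"
    using AB(2,4) by (meson open_contains_cball)
  define Y where "Y = cball y0 r2"
  define K where "K = cball t0 r1 \<times> Y"
  have K: "compact K" "convex K" "K \<subseteq> U"
    using AB r1 r2 by (auto simp: K_def Y_def intro!: compact_Times convex_Times)
  obtain L where L: "L \<ge> 0" "\<And>x h. x \<in> K \<Longrightarrow> norm (frechet_derivative F (at x) h) \<le> L * norm h"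
    "\<And>x y. x \<in> K \<Longrightarrow> y \<in> K \<Longrightarrow> norm (F x - F y) \<le> L * norm (x - y)"
    using C1_lipschitz_compact_convex[OF F K] by blast
  have FKc: "continuous_on K F"
    by (rule continuous_on_subset[OF Ck_on_imp_continuous_on[OF F] K(3)])
  obtain B where B: "B > 0" "\<And>x. x \<in> K \<Longrightarrow> norm (F x) \<le> B"
    using compact_imp_bounded[OF compact_continuous_image[OF FKc K(1)]]
    unfolding bounded_pos by fastforce
  \<comment> \<open>The interval has length \<open>2 * \<epsilon>\<close>. The entries keep times
    within \<open>r1\<close>, keep the distance travelled at speed \<open>B\<close> at most
    \<open>r2 / 2\<close>, and make \<open>L\<close> times the length at most
    \<open>1 / 4\<close>.\<close>
  define \<epsilon> where "\<epsilon> = Min {r1, r2 / (4 * B), 1 / (8 * (L + 1))}"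
  have \<epsilon>: "\<epsilon> > 0" "\<epsilon> \<le> r1" "\<epsilon> \<le> r2 / (4 * B)" "\<epsilon> \<le> 1 / (8 * (L + 1))"
    using r1 r2 B L by (auto simp: \<epsilon>_def)
  define a b where "a = t0 - \<epsilon>" and "b = t0 + \<epsilon>"
  have ba: "b - a = 2 * \<epsilon>" by (simp add: a_def b_def)
  have Lba: "L * (b - a) \<le> 1 / 4"
  proof -
    have "L * \<epsilon> \<le> (L + 1) * (1 / (8 * (L + 1)))" using \<epsilon> L(1) by (intro mult_mono) auto
    also have "\<dots> = 1 / 8" using L(1) by (simp add: field_simps)
    finally show ?thesis by (simp add: ba)
  qed
  have Bba: "B * (b - a) \<le> r2 / 2"
    using \<epsilon>(3) B(1) by (simp add: ba field_simps)
  let ?J = "{a<..<b}"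
  define V where "V = ball y0 (r2 / 2)"
  have JK: "(t, y) \<in> K" if "t \<in> ?J" "y \<in> Y" for t y
    using that \<epsilon>(2) by (auto simp: K_def a_def b_def dist_real_def)
  \<comment> \<open>Composing with the projection to the ball makes the field globally Lipschitz.\<close>
  define cp where "cp = closest_point Y"
  have Y: "convex Y" "closed Y" "Y \<noteq> {}" using r2(1) by (auto simp: Y_def)
  have cpY: "cp z \<in> Y" for z unfolding cp_def using Y by (intro closest_point_in_set)
  have cpl: "norm (cp z - cp w) \<le> norm (z - w)" for z w
    using closest_point_lipschitz[OF Y, of z w] by (simp add: cp_def dist_norm)
  have "\<exists>\<Psi>. flow_box U F ?J V s \<Psi>" if s: "s \<in> ?J" for s
  proof -
    have "\<exists>z. z s = y \<and> (\<forall>t\<in>?J. (z has_vector_derivative F (t, cp (z t))) (at t))" for y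
    proof (rule picard_open[OF s, where H = "\<lambda>t z. F (t, cp z)"])
      have "continuous_on UNIV cp"
        unfolding cp_def by (rule continuous_on_closest_point[OF Y])
      then have "continuous_on (?J \<times> UNIV) (\<lambda>x. cp (snd x))"
        by (rule continuous_on_compose2) (auto intro!: continuous_intros)
      then have "continuous_on (?J \<times> UNIV) (\<lambda>x. F (fst x, cp (snd x)))"
        by (intro continuous_on_compose2[OF FKc] continuous_intros) (use JK cpY in auto)
      then show "continuous_on (?J \<times> UNIV) (\<lambda>(t, z). F (t, cp z))"
        by (simp add: case_prod_unfold)
      show "norm (F (t, cp z) - F (t, cp w)) \<le> L * norm (z - w)" if "t \<in> ?J" for t z w
      proof -
        have "norm (F (t, cp z) - F (t, cp w)) \<le> L * norm ((t, cp z) - (t, cp w))"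
          by (rule L(3)[OF JK[OF that cpY] JK[OF that cpY]])
        also have "\<dots> \<le> L * norm (z - w)"
          using cpl L(1) by (intro mult_left_mono) (simp_all add: norm_Pair)
        finally show ?thesis .
      qed
    qed (use L Lba in auto)
    then obtain \<psi> where \<psi>: "\<And>y. \<psi> y s = y"
      "\<And>y t. t \<in> ?J \<Longrightarrow> (\<psi> y has_vector_derivative F (t, cp (\<psi> y t))) (at t)"
      by metis
    have J_conv: "convex ?J" by simp
    have bdF: "norm (F (t, cp z)) \<le> B" if "t \<in> ?J" for t z by (rule B(2)[OF JK[OF that cpY]])
    have \<psi>t: "norm (\<psi> y t - \<psi> y t') \<le> B * \<bar>t - t'\<bar>" if "t \<in> ?J" "t' \<in> ?J" for y t t'
      by (rule vector_derivative_bound[OF J_conv has_vector_derivative_at_within[OF \<psi>(2)] bdF that])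
    have \<psi>Y: "\<psi> y t \<in> Y" if "t \<in> ?J" "y \<in> V" for y t
    proof -
      have "norm (\<psi> y t - y) \<le> B * \<bar>t - s\<bar>" using \<psi>t[OF that(1) s, of y] by (simp add: \<psi>(1))
      also have "\<dots> \<le> B * (b - a)" using that s B(1) by (intro mult_left_mono) auto
      finally have "dist (\<psi> y t) y \<le> r2 / 2" using Bba by (simp add: dist_norm)
      moreover have "dist y0 y < r2 / 2" using that by (simp add: V_def)
      ultimately show ?thesis
        using dist_triangle[of y0 "\<psi> y t" y] by (simp add: Y_def dist_commute)
    qed
    \<comment> \<open>Solutions starting in the ball of half the radius never leave
      \<open>Y\<close>, so for them the truncated field is the original one.\<close>
    have cp\<psi>: "cp (\<psi> y t) = \<psi> y t" if "t \<in> ?J" "y \<in> V" for y t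
      unfolding cp_def by (rule closest_point_self[OF \<psi>Y[OF that]])
    define \<Psi> where "\<Psi> = (\<lambda>(t, y). \<psi> y t)"
    have inK: "(t, \<Psi> (t, y)) \<in> K" if "t \<in> ?J" "y \<in> V" for t y
      using JK[OF that(1) \<psi>Y[OF that]] by (simp add: \<Psi>_def)
    have sol: "((\<lambda>r. \<Psi> (r, y)) has_vector_derivative F (t, \<Psi> (t, y))) (at t)"
      if "t \<in> ?J" "y \<in> V" for t y
      using \<psi>(2)[OF that(1), of y] by (simp add: \<Psi>_def cp\<psi>[OF that])
    have \<psi>y: "norm (\<psi> y t - \<psi> y' t) \<le> 2 * norm (y - y')"
      if t: "t \<in> ?J" and y: "y \<in> V" "y' \<in> V" for t y y'
    proof -
      have seg: "r \<in> ?J" if "r \<in> closed_segment s t" for r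
        using that s t by (auto simp: closed_segment_eq_real_ivl split: if_splits)
      have "norm (\<psi> y t - \<psi> y' t) \<le> 2 * (norm (\<psi> y s - \<psi> y' s) + 0 * \<bar>t - s\<bar>)"
      proof (rule gronwall_short[where L = L and z' = "\<lambda>r. F (r, cp (\<psi> y r)) - F (r, cp (\<psi> y' r))"])
        fix r assume "r \<in> closed_segment s t"
        then have r: "r \<in> ?J" by (rule seg)
        show "((\<lambda>t. \<psi> y t - \<psi> y' t) has_vector_derivative F (r, cp (\<psi> y r)) - F (r, cp (\<psi> y' r)))
            (at r within closed_segment s t)"
          by (rule has_vector_derivative_at_within[OF has_vector_derivative_diff[OF \<psi>(2)[OF r]
              \<psi>(2)[OF r]]])
        have "norm (F (r, cp (\<psi> y r)) - F (r, cp (\<psi> y' r))) \<le>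
            L * norm ((r, cp (\<psi> y r)) - (r, cp (\<psi> y' r)))"
          by (rule L(3)[OF JK[OF r cpY] JK[OF r cpY]])
        also have "\<dots> \<le> L * norm (\<psi> y r - \<psi> y' r)"
          using cpl L(1) by (intro mult_left_mono) (simp_all add: norm_Pair)
        finally show "norm (F (r, cp (\<psi> y r)) - F (r, cp (\<psi> y' r))) \<le> L * norm (\<psi> y r - \<psi> y' r) + 0"
          by simp
      next
        have "L * \<bar>t - s\<bar> \<le> L * (b - a)" using s t L(1) by (intro mult_left_mono) auto
        then show "L * \<bar>t - s\<bar> \<le> 1 / 2" using Lba by simp
      qed (use L in auto)
      then show ?thesis by (simp add: \<psi>(1))
    qed
    have cont: "continuous_on (?J \<times> V) \<Psi>"
    proof (rule lipschitz_on_continuous_on[where L = "B + 2"], rule lipschitz_onI)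
        fix x x' assume x: "x \<in> ?J \<times> V" "x' \<in> ?J \<times> V"
        have "norm (\<Psi> x - \<Psi> x') \<le> norm (\<psi> (snd x) (fst x) - \<psi> (snd x) (fst x')) +
            norm (\<psi> (snd x) (fst x') - \<psi> (snd x') (fst x'))"
          using norm_triangle_ineq[of "\<psi> (snd x) (fst x) - \<psi> (snd x) (fst x')"
              "\<psi> (snd x) (fst x') - \<psi> (snd x') (fst x')"]
          by (simp add: \<Psi>_def case_prod_unfold)
        also have "\<dots> \<le> B * norm (fst x - fst x') + 2 * norm (snd x - snd x')"
          using x by (intro add_mono) (auto intro!: order_trans[OF \<psi>t] \<psi>y)
        also have "\<dots> \<le> B * norm (x - x') + 2 * norm (x - x')"
          using B(1) norm_fst_le[of "fst x - fst x'" "snd x - snd x'"] norm_snd_le[of "snd x - snd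
              x'" "fst x - fst x'"]
          by (intro add_mono mult_left_mono) (auto simp: minus_prod_def)
        finally show "dist (\<Psi> x) (\<Psi> x') \<le> (B + 2) * dist x x'"
          by (simp add: dist_norm algebra_simps)
    qed (use B in auto)
    have "flow_box U F ?J V s \<Psi>"
    proof (rule flow_box_exists[OF U F _ s L(1) Lba _ sol _ cont])
      show "open V" by (simp add: V_def)
      show "(t, \<Psi> (t, y)) \<in> U" if "t \<in> ?J" "y \<in> V" for t y using inK[OF that] K(3) by auto
      show "\<Psi> (s, y) = y" for y by (simp add: \<Psi>_def \<psi>(1))
      show "norm (frechet_derivative F (at (t, \<Psi> (t, y))) (0, u)) \<le> L * norm u"
        if "t \<in> ?J" "y \<in> V" for t y u
        using L(2)[OF inK[OF that], of "(0, u)"] by (simp add: norm_Pair)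
    qed
    then show ?thesis by blast
  qed
  moreover have "open V" "y0 \<in> V" using r2(1) by (auto simp: V_def)
  ultimately show ?thesis
    using \<epsilon>(1) unfolding a_def b_def by blast
qed

section \<open>Charts, tangent vectors and forms in coordinates\<close>

locale smooth_mfd =
  fixes A :: "('m::t2_space, 'e::euclidean_space) chart set"
  assumes atlas: "smooth_atlas A"
begin

lemma chart_open: "c \<in> A \<Longrightarrow> open (cdom c)" "c \<in> A \<Longrightarrow> open (cimg c)"
  using atlas by (auto simp: smooth_atlas_def is_chart_def)

lemma chart_homeo: "c \<in> A \<Longrightarrow> homeomorphism (cdom c) (cimg c) (cmap c) (cinv c)"
  using atlas by (auto simp: smooth_atlas_def is_chart_def)

lemma cinv_cmap [simp]: "c \<in> A \<Longrightarrow> p \<in> cdom c \<Longrightarrow> cinv c (cmap c p) = p"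
  using chart_homeo by (auto simp: homeomorphism_def)

lemma cmap_cinv [simp]: "c \<in> A \<Longrightarrow> x \<in> cimg c \<Longrightarrow> cmap c (cinv c x) = x"
  using chart_homeo by (auto simp: homeomorphism_def)

lemma cinv_in [simp]: "x \<in> cimg c \<Longrightarrow> cinv c x \<in> cdom c"
  by (rule inv_into_into)

lemma cmap_in [simp]: "p \<in> cdom c \<Longrightarrow> cmap c p \<in> cimg c"
  by simp

lemma cmap_cont: "c \<in> A \<Longrightarrow> continuous_on (cdom c) (cmap c)"
  and cinv_cont: "c \<in> A \<Longrightarrow> continuous_on (cimg c) (cinv c)"
  using chart_homeo by (auto simp: homeomorphism_def)

lemma chart_ex: "\<exists>c\<in>A. p \<in> cdom c"
  using atlas by (auto simp: smooth_atlas_def)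

lemma chart_at: "chart_at A p \<in> A" "p \<in> cdom (chart_at A p)"
proof -
  have "\<exists>c. c \<in> A \<and> p \<in> cdom c" using chart_ex by blast
  from someI_ex[OF this] show "chart_at A p \<in> A" "p \<in> cdom (chart_at A p)"
    by (simp_all add: chart_at_def)
qed

lemma open_cimg_vimage:
  assumes "c \<in> A" "open N"
  shows "open {x \<in> cimg c. cinv c x \<in> N}"
proof -
  have "open (cimg c \<inter> cinv c -` N)"
    using continuous_open_preimage[OF cinv_cont chart_open(2)] assms by blast
  then show ?thesis by (simp add: vimage_def Int_def)
qed

lemma open_cdom_vimage:
  assumes "c \<in> A" "open V"
  shows "open {p \<in> cdom c. cmap c p \<in> V}"
proof -
  have "open (cdom c \<inter> cmap c -` V)"
    using continuous_open_preimage[OF cmap_cont chart_open(1)] assms by blast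
  then show ?thesis by (simp add: vimage_def Int_def)
qed

definition overlap :: "('m, 'e) chart \<Rightarrow> ('m, 'e) chart \<Rightarrow> 'e set" where
  "overlap c d = cmap c ` (cdom c \<inter> cdom d)"

lemma overlap_eq: "c \<in> A \<Longrightarrow> overlap c d = {x \<in> cimg c. cinv c x \<in> cdom d}"
  by (force simp: overlap_def)

lemma overlap_open: "c \<in> A \<Longrightarrow> d \<in> A \<Longrightarrow> open (overlap c d)"
  using open_cimg_vimage chart_open by (simp add: overlap_eq)

lemma overlap_in: "p \<in> cdom c \<Longrightarrow> p \<in> cdom d \<Longrightarrow> cmap c p \<in> overlap c d"
  by (simp add: overlap_def)

lemma transition_smooth: "c \<in> A \<Longrightarrow> d \<in> A \<Longrightarrow> smooth_on (overlap c d) (\<lambda>x. cmap d (cinv c x))"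
  using atlas by (auto simp: smooth_atlas_def overlap_def o_def)

section \<open>Transition derivatives and tangent vectors in coordinates\<close>

definition tr :: "('m, 'e) chart \<Rightarrow> ('m, 'e) chart \<Rightarrow> 'm \<Rightarrow> 'e \<Rightarrow> 'e" where
  "tr c d p = frechet_derivative (cmap d \<circ> cinv c) (at (cmap c p))"

lemma transition_derivative:
  assumes "c \<in> A" "d \<in> A" "p \<in> cdom c" "p \<in> cdom d"
  shows "((\<lambda>x. cmap d (cinv c x)) has_derivative tr c d p) (at (cmap c p))"
proof -
  have "Ck_on (Suc 0) (overlap c d) (\<lambda>x. cmap d (cinv c x))"
    using transition_smooth[OF assms(1,2)] smooth_on_open_iff[OF overlap_open[OF assms(1,2)]] by
        blast
  from Ck_on_SucD[OF this overlap_in[OF assms(3,4)]] show ?thesis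
    by (simp add: tr_def o_def)
qed

lemma tr_linear: "c \<in> A \<Longrightarrow> d \<in> A \<Longrightarrow> p \<in> cdom c \<Longrightarrow> p \<in> cdom d \<Longrightarrow> linear (tr c d p)"
  using transition_derivative has_derivative_linear by blast

text \<open>The cocycle rule. With \<open>tr_self\<close> it makes one coordinate vector determine a
  tangent vector, so that \<open>tvec_of\<close> and evaluation in a chart are inverse to each
  other.\<close>

lemma tr_trans:
  assumes "c \<in> A" "d \<in> A" "e \<in> A" "p \<in> cdom c" "p \<in> cdom d" "p \<in> cdom e"
  shows "tr d e p (tr c d p w) = tr c e p w"
proof -
  have "((\<lambda>x. cmap e (cinv d x)) has_derivative tr d e p) (at (cmap d (cinv c (cmap c p))))"
    using transition_derivative[of d e p] assms by simp
  from has_derivative_compose[OF transition_derivative[of c d p] this] assms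
  have "((\<lambda>x. cmap e (cinv d (cmap d (cinv c x)))) has_derivative (\<lambda>w. tr d e p (tr c d p w))) (at
      (cmap c p))"
    by simp
  then have "((\<lambda>x. cmap e (cinv c x)) has_derivative (\<lambda>w. tr d e p (tr c d p w))) (at (cmap c p))"
    by (rule has_derivative_transform_within_open[OF _ overlap_open[of c d] overlap_in])
      (use assms in \<open>auto simp: overlap_def\<close>)
  from has_derivative_unique[OF this transition_derivative[of c e p]] assms show ?thesis
    by (simp add: fun_eq_iff)
qed

lemma tr_self:
  assumes "c \<in> A" "p \<in> cdom c"
  shows "tr c c p w = w"
proof -
  have "((\<lambda>x. x) has_derivative tr c c p) (at (cmap c p))"
    by (rule has_derivative_transform_within_open[OF transition_derivative chart_open(2)])
      (use assms in auto)
  from has_derivative_unique[OF this has_derivative_ident] show ?thesis by (simp add: fun_eq_iff)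
qed

lemma tangent_space_iff:
  "v \<in> tangent_space A p \<longleftrightarrow>
     (\<forall>c\<in>A. \<forall>d\<in>A. p \<in> cdom c \<and> p \<in> cdom d \<longrightarrow> v d = tr c d p (v c)) \<and>
     (\<forall>c. \<not> (c \<in> A \<and> p \<in> cdom c) \<longrightarrow> v c = 0)"
  by (simp add: tangent_space_def tr_def)

lemma tvec_of_eq: "tvec_of A c p w d = (if d \<in> A \<and> p \<in> cdom d then tr c d p w else 0)"
  by (simp add: tvec_of_def tr_def)

lemma tvec_of_tangent: "c \<in> A \<Longrightarrow> p \<in> cdom c \<Longrightarrow> tvec_of A c p w \<in> tangent_space A p"
  by (simp add: tangent_space_iff tvec_of_eq tr_trans)

lemma tvec_of_self [simp]: "c \<in> A \<Longrightarrow> p \<in> cdom c \<Longrightarrow> tvec_of A c p w c = w"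
  by (simp add: tvec_of_eq tr_self)

lemma tvec_of_comp:
  assumes "v \<in> tangent_space A p" "c \<in> A" "p \<in> cdom c"
  shows "tvec_of A c p (v c) = v"
proof
  fix d
  have "d \<in> A \<Longrightarrow> p \<in> cdom d \<Longrightarrow> v d = tr c d p (v c)" "\<not> (d \<in> A \<and> p \<in> cdom d) \<Longrightarrow> v d = 0"
    using assms unfolding tangent_space_iff by blast+
  then show "tvec_of A c p (v c) d = v d" unfolding tvec_of_eq by argo
qed

lemma tvec_of_lin:
  assumes "c \<in> A" "p \<in> cdom c"
  shows "tvec_of A c p (a *\<^sub>R u + b *\<^sub>R v) = (\<lambda>d. a *\<^sub>R tvec_of A c p u d + b *\<^sub>R tvec_of A c p v
      d)"
proof
  fix d
  have "d \<in> A \<Longrightarrow> p \<in> cdom d \<Longrightarrow> tr c d p (a *\<^sub>R u + b *\<^sub>R v) = a *\<^sub>R tr c d p u + b *\<^sub>R tr c d p v"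
    using tr_linear[OF assms(1) _ assms(2), of d] by (simp add: linear_add linear_scale)
  then show "tvec_of A c p (a *\<^sub>R u + b *\<^sub>R v) d = a *\<^sub>R tvec_of A c p u d + b *\<^sub>R tvec_of A c p v
      d"
    by (simp add: tvec_of_eq)
qed

lemma covector_linear:
  assumes "l \<in> cotangent_space A p" "c \<in> A" "p \<in> cdom c"
  shows "linear (\<lambda>w. l (tvec_of A c p w))"
proof (rule linearI)
  have *: "l (tvec_of A c p (a *\<^sub>R u + b *\<^sub>R v)) = a * l (tvec_of A c p u) + b * l (tvec_of A c p
      v)" for a b u v
    using assms tvec_of_tangent by (simp add: tvec_of_lin cotangent_space_def)
  show "l (tvec_of A c p (u + v)) = l (tvec_of A c p u) + l (tvec_of A c p v)" for u v
    using *[of 1 u 1 v] by simp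
  show "l (tvec_of A c p (a *\<^sub>R u)) = a *\<^sub>R l (tvec_of A c p u)" for a u
    using *[of a u 0 u] by simp
qed

lemma local1_linear:
  "\<alpha> \<in> forms1 A \<Longrightarrow> c \<in> A \<Longrightarrow> x \<in> cimg c \<Longrightarrow> linear (\<lambda>w. local1 A c \<alpha> w x)"
  unfolding local1_def by (rule covector_linear) (auto simp: forms1_def)

lemma local2_linear_left:
  assumes "\<omega> \<in> forms2 A" "c \<in> A" "x \<in> cimg c"
  shows "linear (\<lambda>u. local2 A c \<omega> u v x)"
proof -
  have "(\<lambda>u. \<omega> (cinv c x) u w) \<in> cotangent_space A (cinv c x)" for w
    using assms(1) unfolding forms2_def alternating2_def by blast
  from covector_linear[OF this assms(2) cinv_in[OF assms(3)]] show ?thesis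
    unfolding local2_def .
qed

lemma local2_alt:
  "\<omega> \<in> forms2 A \<Longrightarrow> local2 A c \<omega> u v x = - local2 A c \<omega> v u x"
  unfolding local2_def forms2_def alternating2_def by blast

lemma local2_linear_right:
  assumes "\<omega> \<in> forms2 A" "c \<in> A" "x \<in> cimg c"
  shows "linear (\<lambda>v. local2 A c \<omega> u v x)"
proof -
  have "(\<lambda>v. local2 A c \<omega> u v x) = (\<lambda>v. - local2 A c \<omega> v u x)"
    using local2_alt[OF assms(1)] by blast
  then show ?thesis
    using linear_compose_neg[OF local2_linear_left[OF assms, of u]] by simp
qed

lemma smooth_map_id: "smooth_map A (\<lambda>p. p)"
  unfolding smooth_map_def
proof (intro conjI ballI)
  fix c d assume "c \<in> A" "d \<in> A"
  then show "smooth_on {x \<in> cimg c. cinv c x \<in> cdom d} (cmap d \<circ> (\<lambda>p. p) \<circ> cinv c)"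
    using transition_smooth[of c d] by (simp add: overlap_eq o_def)
qed (rule continuous_on_id)

lemma smooth_map_chart_derivative:
  assumes H: "smooth_map A H" and c: "c \<in> A" "p \<in> cdom c" and d: "d \<in> A" "H p \<in> cdom d"
  shows "((\<lambda>x. cmap d (H (cinv c x))) has_derivative
    frechet_derivative (cmap d \<circ> H \<circ> cinv c) (at (cmap c p))) (at (cmap c p))"
proof -
  let ?S = "{x \<in> cimg c. H (cinv c x) \<in> cdom d}"
  have "open {x \<in> cimg c. cinv c x \<in> H -` cdom d}"
    using H by (intro open_cimg_vimage[OF c(1)] open_vimage chart_open(1)[OF d(1)]) (simp add:
        smooth_map_def)
  then have S: "open ?S" by simp
  have "smooth_on ?S (cmap d \<circ> H \<circ> cinv c)" using H c(1) d(1) by (simp add: smooth_map_def)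
  then have "Ck_on (Suc 0) ?S (cmap d \<circ> H \<circ> cinv c)" using smooth_on_open_iff[OF S] by blast
  moreover have "cmap c p \<in> ?S" using c d by simp
  ultimately have "((cmap d \<circ> H \<circ> cinv c) has_derivative
      frechet_derivative (cmap d \<circ> H \<circ> cinv c) (at (cmap c p))) (at (cmap c p))"
    by (rule Ck_on_SucD)
  then show ?thesis unfolding o_def .
qed

end

section \<open>Integral curves and the flow of a time-dependent vector field\<close>

lemma flow_box_mono:
  assumes "flow_box U F J V s \<Psi>" "J' \<subseteq> J" "V' \<subseteq> V"
  shows "flow_box U F J' V' s \<Psi>"
proof -
  have "J' \<times> V' \<subseteq> J \<times> V" using assms by auto
  with assms show ?thesis
    unfolding flow_box_def by (auto intro: Ck_on_subset)
qed

lemma continuous_on_locally: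
  fixes f :: "'a::t2_space \<Rightarrow> 'b::topological_space"
  assumes "\<And>x. x \<in> S \<Longrightarrow> \<exists>W. open W \<and> x \<in> W \<and> continuous_on (S \<inter> W) f"
  shows "continuous_on S f"
  unfolding continuous_on_eq_continuous_within
proof
  fix x assume x: "x \<in> S"
  then obtain W where W: "open W" "x \<in> W" "continuous_on (S \<inter> W) f" using assms by blast
  then have "continuous (at x within S \<inter> W) f" using x by (simp add:
      continuous_on_eq_continuous_within)
  moreover have "at x within S \<inter> W = at x within S"
    by (rule at_within_nhd[OF W(2,1)]) auto
  ultimately show "continuous (at x within S) f" by simp
qed

text \<open>Turns a uniform lifetime into a global statement: every time in \<open>[0,1]\<close> is
  reached from \<open>s\<close>, forwards or backwards, in finitely many steps shorter than
  \<open>d\<close>.\<close>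

lemma step_induct:
  assumes d: "d > 0" and s: "s \<in> {0..1}" and R: "R s"
    and step: "\<And>r t. r \<in> {0..1} \<Longrightarrow> t \<in> {0..1} \<Longrightarrow> R r \<Longrightarrow> \<bar>t - r\<bar> < d \<Longrightarrow> R t"
    and t: "t \<in> {0..1::real}"
  shows "R t"
proof -
  have "\<forall>t\<in>{0..1}. \<bar>t - s\<bar> < real n * d \<longrightarrow> R t" for n
  proof (induction n)
    case (Suc n)
    show ?case
    proof (intro ballI impI)
      fix t assume t: "t \<in> {0..1}" "\<bar>t - s\<bar> < real (Suc n) * d"
      \<comment> \<open>The intermediate time divides the way from \<open>s\<close> to
        \<open>t\<close> in the ratio \<open>n : 1\<close>. The last step is then shorter than
        \<open>d\<close>, and \<open>r\<close> is within reach of the induction hypothesis.\<close>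
      define q where "q = real n / real (Suc n)"
      define r where "r = s + (t - s) * q"
      have u: "0 \<le> q" "q \<le> 1" by (auto simp: q_def)
      have rs: "r = (1 - q) * s + q * t"
        by (simp add: r_def algebra_simps)
      have r: "r \<in> {0..1}"
        using convexD[of "{0..1::real}" s t "1 - q" q] s t u
        unfolding rs by simp
      have tr: "\<bar>t - r\<bar> < d"
      proof -
        have "t - r = (t - s) / real (Suc n)" by (simp add: r_def q_def field_simps)
        then have "\<bar>t - r\<bar> = \<bar>t - s\<bar> / real (Suc n)" by (simp add: abs_divide)
        also have "\<dots> < d" using t(2) by (simp add: field_simps)
        finally show ?thesis .
      qed
      show "R t"
      \<comment> \<open>For \<open>n = 0\<close> the strict bound on
        \<open>\<bar>r - s\<bar>\<close> would read \<open>0 < 0\<close>, although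
        \<open>r = s\<close>; hence the direct step from \<open>s\<close>.\<close>
      proof (cases "n = 0")
        case True
        then show ?thesis using step[OF s t(1) R] t(2) by simp
      next
        case False
        have "\<bar>r - s\<bar> = \<bar>t - s\<bar> * q"
          using u by (simp add: r_def abs_mult)
        also have "\<dots> < (real (Suc n) * d) * q"
          using t(2) False by (intro mult_strict_right_mono) (auto simp: q_def)
        also have "\<dots> = real n * d" by (simp add: q_def)
        finally have "R r" using Suc r by blast
        from step[OF r t(1) this tr] show ?thesis .
      qed
    qed
  qed simp
  moreover obtain n where "\<bar>t - s\<bar> < real n * d" using reals_Archimedean3[OF d] by blast
  ultimately show ?thesis using t by blast
qed

locale time_field = smooth_mfd A
  for A :: "('m::t2_space, 'e::euclidean_space) chart set" +
  fixes X :: "real \<Rightarrow> 'm \<Rightarrow> ('m, 'e) tvec"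
  assumes compact_M: "compact (UNIV :: 'm set)"
    and X_tangent: "t \<in> {0..1} \<Longrightarrow> X t p \<in> tangent_space A p"
    and X_smooth: "c \<in> A \<Longrightarrow> smooth_on ({0..1} \<times> cimg c) (\<lambda>(t, x). X t (cinv c x) c)"
begin

definition icurve :: "real set \<Rightarrow> (real \<Rightarrow> 'm) \<Rightarrow> bool" where
  "icurve I \<gamma> \<longleftrightarrow> continuous_on I \<gamma> \<and>
     (\<forall>t\<in>I. \<forall>c\<in>A. \<gamma> t \<in> cdom c \<longrightarrow>
        ((\<lambda>r. cmap c (\<gamma> r)) has_vector_derivative X t (\<gamma> t) c) (at t within I))"

lemma icurveD:
  assumes "icurve I \<gamma>" "t \<in> I" "c \<in> A" "\<gamma> t \<in> cdom c"
  shows "((\<lambda>r. cmap c (\<gamma> r)) has_vector_derivative X t (\<gamma> t) c) (at t within I)"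
  using assms unfolding icurve_def by blast

lemma icurve_subset:
  assumes "icurve I \<gamma>" "I' \<subseteq> I"
  shows "icurve I' \<gamma>"
  using assms unfolding icurve_def
  by (meson continuous_on_subset has_vector_derivative_within_subset subsetD)

text \<open>A single chart suffices: the chain rule through a transition map and the compatibility
  of the entries of \<open>X t p\<close> give the velocity in every other chart.\<close>

lemma icurveI:
  assumes cont: "continuous_on I \<gamma>" and I: "I \<subseteq> {0..1}" and c: "c \<in> A"
    and dom: "\<And>t. t \<in> I \<Longrightarrow> \<gamma> t \<in> cdom c"
    and der: "\<And>t. t \<in> I \<Longrightarrow> ((\<lambda>r. cmap c (\<gamma> r)) has_vector_derivative X t (\<gamma> t) c) (at t within I)"
  shows "icurve I \<gamma>"
  unfolding icurve_def
proof (intro conjI ballI impI cont)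
  fix t d assume t: "t \<in> I" and d: "d \<in> A" "\<gamma> t \<in> cdom d"
  have "((\<lambda>x. cmap d (cinv c x)) has_derivative tr c d (\<gamma> t)) (at (cmap c (\<gamma> t)))"
    by (rule transition_derivative[OF c d(1) dom[OF t] d(2)])
  from has_derivative_compose[OF der[OF t, unfolded has_vector_derivative_def] this]
  have "((\<lambda>r. cmap d (cinv c (cmap c (\<gamma> r)))) has_derivative
      (\<lambda>h. tr c d (\<gamma> t) (h *\<^sub>R X t (\<gamma> t) c))) (at t within I)" .
  moreover have "tr c d (\<gamma> t) (h *\<^sub>R X t (\<gamma> t) c) = h *\<^sub>R X t (\<gamma> t) d" for h
  proof -
    have "X t (\<gamma> t) \<in> tangent_space A (\<gamma> t)" using X_tangent t I by blast
    then have "X t (\<gamma> t) d = tr c d (\<gamma> t) (X t (\<gamma> t) c)"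
      using c d dom[OF t] unfolding tangent_space_iff by blast
    then show ?thesis
      using linear_scale[OF tr_linear[OF c d(1) dom[OF t] d(2)]] by simp
  qed
  ultimately have "((\<lambda>r. cmap d (cinv c (cmap c (\<gamma> r)))) has_vector_derivative X t (\<gamma> t) d) (at t
      within I)"
    by (simp add: has_vector_derivative_def)
  then show "((\<lambda>r. cmap d (\<gamma> r)) has_vector_derivative X t (\<gamma> t) d) (at t within I)"
    by (rule has_vector_derivative_transform[OF t, rotated]) (use c dom in simp)
qed

text \<open>The pieces are relatively open in \<open>[0,1]\<close>, so the derivative within a piece
  is the derivative within the union; closed pieces would leave one-sided derivatives at the
  seams.\<close>

lemma icurve_glue:
  assumes T: "open T1" "open T2"
    and g: "icurve ({0..1} \<inter> T1) \<gamma>1" "icurve ({0..1} \<inter> T2) \<gamma>2"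
    and eq: "\<And>t. t \<in> {0..1} \<inter> T1 \<inter> T2 \<Longrightarrow> \<gamma>1 t = \<gamma>2 t"
  shows "icurve ({0..1} \<inter> (T1 \<union> T2)) (\<lambda>t. if t \<in> T1 then \<gamma>1 t else \<gamma>2 t)"
proof -
  let ?\<gamma> = "\<lambda>t. if t \<in> T1 then \<gamma>1 t else \<gamma>2 t"
  let ?I1 = "{0..1} \<inter> T1" and ?I2 = "{0..1} \<inter> T2" and ?I = "{0..1} \<inter> (T1 \<union> T2)"
  have U: "?I1 \<union> ?I2 = ?I" by auto
  have o: "openin (top_of_set ?I) ?I1" "openin (top_of_set ?I) ?I2"
    using T by (auto simp: openin_open)
  have "continuous_on (?I1 \<union> ?I2) ?\<gamma>"
    by (rule continuous_on_cases_local_open) (use o g eq in \<open>auto simp: U icurve_def\<close>)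
  moreover have "((\<lambda>r. cmap c (?\<gamma> r)) has_vector_derivative X t (?\<gamma> t) c) (at t within ?I)"
    if t: "t \<in> ?I" and c: "c \<in> A" "?\<gamma> t \<in> cdom c" for t c
  proof (cases "t \<in> T1")
    case True
    have "((\<lambda>r. cmap c (\<gamma>1 r)) has_vector_derivative X t (\<gamma>1 t) c) (at t within ?I1)"
      using g(1) t c True by (auto simp: icurve_def)
    then have "((\<lambda>r. cmap c (?\<gamma> r)) has_vector_derivative X t (\<gamma>1 t) c) (at t within ?I1)"
      by (rule has_vector_derivative_transform[rotated 2]) (use t True in auto)
    moreover have "at t within ?I1 = at t within ?I"
      by (rule at_within_nhd[OF True T(1)]) auto
    ultimately show ?thesis using True by simp
  next
    case False
    then have t2: "t \<in> T2" using t by auto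
    have "((\<lambda>r. cmap c (\<gamma>2 r)) has_vector_derivative X t (\<gamma>2 t) c) (at t within ?I2)"
      using g(2) t c False by (auto simp: icurve_def)
    then have "((\<lambda>r. cmap c (?\<gamma> r)) has_vector_derivative X t (\<gamma>2 t) c) (at t within ?I2)"
      by (rule has_vector_derivative_transform[rotated 2]) (use t t2 eq in auto)
    moreover have "at t within ?I2 = at t within ?I"
      by (rule at_within_nhd[OF t2 T(2)]) auto
    ultimately show ?thesis using False by simp
  qed
  ultimately show ?thesis by (simp add: icurve_def U)
qed

text \<open>Smoothness up to the boundary means local extendability. The extension supplies a full
  neighbourhood in time even at \<open>t = 0\<close> and \<open>t = 1\<close>.\<close>

lemma local_field_extension:
  assumes c: "c \<in> A" "p \<in> cdom c" and t: "t \<in> {0..1}"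
  obtains U F where "open U" "(t, cmap c p) \<in> U" "U \<subseteq> UNIV \<times> cimg c" "\<forall>k. Ck_on k U F"
    "\<forall>r x. (r, x) \<in> U \<longrightarrow> r \<in> {0..1} \<longrightarrow> F (r, x) = X r (cinv c x) c"
proof -
  have "(t, cmap c p) \<in> {0..1} \<times> cimg c" using t c by simp
  with X_smooth[OF c(1)] obtain U F where UF: "open U" "(t, cmap c p) \<in> U" "\<forall>k. Ck_on k U F"
    "\<forall>y\<in>U \<inter> {0..1} \<times> cimg c. F y = (case y of (t, x) \<Rightarrow> X t (cinv c x) c)"
    by (rule smooth_onE)
  let ?U = "U \<inter> UNIV \<times> cimg c"
  have "open ?U" using UF(1) chart_open(2)[OF c(1)] by (intro open_Int open_Times) auto
  moreover have "\<forall>k. Ck_on k ?U F" using UF(3) Ck_on_subset[of _ U F ?U] by simp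
  moreover have "\<forall>r x. (r, x) \<in> ?U \<longrightarrow> r \<in> {0..1} \<longrightarrow> F (r, x) = X r (cinv c x) c"
    using UF(4) by auto
  ultimately show ?thesis using UF(2) c by (intro that[of ?U F]) auto
qed

text \<open>The set where the curves agree is closed because the manifold is Hausdorff, open by
  local uniqueness in a chart, and contains \<open>s\<close>; an interval is connected.\<close>

lemma icurve_unique:
  assumes g: "icurve I \<gamma>1" "icurve I \<gamma>2" and I: "convex I" "I \<subseteq> {0..1}"
    and s: "s \<in> I" "\<gamma>1 s = \<gamma>2 s" and t: "t \<in> I"
  shows "\<gamma>1 t = \<gamma>2 t"
proof -
  define E where "E = {t \<in> I. \<gamma>1 t = \<gamma>2 t}"
  have cont: "continuous_on I \<gamma>1" "continuous_on I \<gamma>2" using g by (auto simp: icurve_def)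
  have "closedin (top_of_set I) {t \<in> topspace (top_of_set I). \<gamma>1 t = \<gamma>2 t}"
  proof (rule closedin_continuous_maps_eq[where Y = euclidean])
    show "Hausdorff_space (euclidean :: 'm topology)"
      unfolding Hausdorff_space_def disjnt_def by (simp, metis hausdorff)
  qed (use cont in auto)
  then have cl: "closedin (top_of_set I) E" by (simp add: E_def)
  have "\<exists>e>0. \<forall>r\<in>I. dist r t < e \<longrightarrow> r \<in> E" if "t \<in> E" for t
  proof -
    have t: "t \<in> I" "\<gamma>1 t = \<gamma>2 t" using that by (auto simp: E_def)
    obtain c where c: "c \<in> A" "\<gamma>1 t \<in> cdom c" using chart_ex by blast
    have t01: "t \<in> {0..1}" using t(1) I(2) by blast
    obtain U F where U: "open U" "(t, cmap c (\<gamma>1 t)) \<in> U" "U \<subseteq> UNIV \<times> cimg c" "\<forall>k. Ck_on k U F"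
      "\<forall>r x. (r, x) \<in> U \<longrightarrow> r \<in> {0..1} \<longrightarrow> F (r, x) = X r (cinv c x) c"
      using c t01 by (rule local_field_extension)
    have near: "\<exists>e>0. \<forall>r\<in>I. dist r t < e \<longrightarrow> \<gamma> r \<in> cdom c \<and> (r, cmap c (\<gamma> r)) \<in> U"
      if \<gamma>: "icurve I \<gamma>" "\<gamma> t = \<gamma>1 t" for \<gamma>
    proof -
      have c\<gamma>: "continuous_on I \<gamma>" using \<gamma>(1) by (simp add: icurve_def)
      have "openin (top_of_set I) (I \<inter> \<gamma> -` cdom c)"
        using continuous_openin_preimage_gen[OF c\<gamma> chart_open(1)[OF c(1)]] .
      then obtain e1 where e1: "e1 > 0" "\<forall>r\<in>I. dist r t < e1 \<longrightarrow> \<gamma> r \<in> cdom c"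
        unfolding openin_euclidean_subtopology_iff using t(1) c(2) \<gamma>(2) by auto
      have "((\<lambda>r. cmap c (\<gamma> r)) has_vector_derivative X t (\<gamma> t) c) (at t within I)"
        by (rule icurveD[OF \<gamma>(1) t(1) c(1)]) (simp add: \<gamma>(2) c(2))
      then have "continuous (at t within I) (\<lambda>r. (r, cmap c (\<gamma> r)))"
        by (intro continuous_intros has_vector_derivative_continuous)
      then have "((\<lambda>r. (r, cmap c (\<gamma> r))) \<longlongrightarrow> (t, cmap c (\<gamma> t))) (at t within I)"
        by (simp add: continuous_within)
      from topological_tendstoD[OF this U(1)] U(2) \<gamma>(2)
      have "\<forall>\<^sub>F r in at t within I. (r, cmap c (\<gamma> r)) \<in> U" by simp
      then obtain e2 where e2: "e2 > 0" "\<forall>r\<in>I. r \<noteq> t \<and> dist r t < e2 \<longrightarrow> (r, cmap c (\<gamma> r)) \<in> U"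
        unfolding eventually_at by blast
      have "\<gamma> r \<in> cdom c \<and> (r, cmap c (\<gamma> r)) \<in> U" if "r \<in> I" "dist r t < min e1 e2" for r
        using that e1(2) e2(2) U(2) \<gamma>(2) by (cases "r = t") auto
      then show ?thesis using e1(1) e2(1) by (intro exI[of _ "min e1 e2"]) auto
    qed
    obtain e1 where e1: "e1 > 0" "\<forall>r\<in>I. dist r t < e1 \<longrightarrow> \<gamma>1 r \<in> cdom c \<and> (r, cmap c (\<gamma>1 r)) \<in> U"
      using near[OF g(1)] by auto
    obtain e2 where e2: "e2 > 0" "\<forall>r\<in>I. dist r t < e2 \<longrightarrow> \<gamma>2 r \<in> cdom c \<and> (r, cmap c (\<gamma>2 r)) \<in> U"
      using near[OF g(2)] t(2) by auto
    define I' where "I' = I \<inter> ball t (min e1 e2)"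
    have I': "convex I'" "t \<in> I'" "I' \<subseteq> I" using I(1) t(1) e1(1) e2(1)
      by (auto simp: I'_def intro: convex_Int)
    have sol: "((\<lambda>r. cmap c (\<gamma> r)) has_vector_derivative F (r, cmap c (\<gamma> r))) (at r within I')"
      if "icurve I \<gamma>" "r \<in> I'" "\<gamma> r \<in> cdom c" "(r, cmap c (\<gamma> r)) \<in> U" for \<gamma> r
    proof -
      have r: "r \<in> I" "r \<in> {0..1}" using that(2) I' I(2) by auto
      have "((\<lambda>r. cmap c (\<gamma> r)) has_vector_derivative X r (\<gamma> r) c) (at r within I')"
        by (rule icurveD[OF icurve_subset[OF that(1) I'(3)] that(2) c(1) that(3)])
      moreover have "F (r, cmap c (\<gamma> r)) = X r (\<gamma> r) c"
        using U(5) that(3,4) r c(1) by simp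
      ultimately show ?thesis by simp
    qed
    have "\<exists>\<delta>>0. \<forall>r\<in>I'. \<bar>r - t\<bar> < \<delta> \<longrightarrow> cmap c (\<gamma>1 r) = cmap c (\<gamma>2 r)"
    proof (rule ode_unique_near[OF U(1) U(4)[rule_format] I'(1,2)])
      show "((\<lambda>r. cmap c (\<gamma>1 r)) has_vector_derivative F (r, cmap c (\<gamma>1 r))) (at r within I')"
        "((\<lambda>r. cmap c (\<gamma>2 r)) has_vector_derivative F (r, cmap c (\<gamma>2 r))) (at r within I')"
        if "r \<in> I'" for r
      proof -
        have "r \<in> I" "dist r t < e1" "dist r t < e2" using that by (auto simp: I'_def dist_commute)
        then have "\<gamma>1 r \<in> cdom c \<and> (r, cmap c (\<gamma>1 r)) \<in> U" "\<gamma>2 r \<in> cdom c \<and> (r, cmap c (\<gamma>2 r)) \<in> U"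
          using e1(2) e2(2) by blast+
        then show "((\<lambda>r. cmap c (\<gamma>1 r)) has_vector_derivative F (r, cmap c (\<gamma>1 r))) (at r within
            I')"
          "((\<lambda>r. cmap c (\<gamma>2 r)) has_vector_derivative F (r, cmap c (\<gamma>2 r))) (at r within I')"
          using sol[OF g(1) that] sol[OF g(2) that] by blast+
      qed
    qed (use t(2) U(2) in auto)
    then obtain \<delta> where \<delta>: "\<delta> > 0" "\<forall>r\<in>I'. \<bar>r - t\<bar> < \<delta> \<longrightarrow> cmap c (\<gamma>1 r) = cmap c (\<gamma>2 r)" by blast
    have "r \<in> E" if r: "r \<in> I" "dist r t < Min {e1, e2, \<delta>}" for r
    proof -
      have "r \<in> I'" using r by (simp add: I'_def dist_commute)
      then have "cmap c (\<gamma>1 r) = cmap c (\<gamma>2 r)" using \<delta>(2) r(2) by (simp add: dist_real_def)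
      moreover have "\<gamma>1 r \<in> cdom c" "\<gamma>2 r \<in> cdom c" using e1(2) e2(2) r by simp_all
      ultimately have "\<gamma>1 r = \<gamma>2 r" using cinv_cmap[OF c(1)] by metis
      then show ?thesis using r(1) by (simp add: E_def)
    qed
    then show ?thesis using e1(1) e2(1) \<delta>(1) by (intro exI[of _ "Min {e1, e2, \<delta>}"]) simp
  qed
  then have "openin (top_of_set I) E"
    unfolding openin_euclidean_subtopology_iff by (auto simp: E_def)
  moreover have "connected I" using I(1) by (rule convex_connected)
  ultimately have "E = {} \<or> E = I" using cl unfolding connected_clopen by blast
  then show ?thesis using s t by (auto simp: E_def)
qed

text \<open>\<open>F\<close> extends the coordinate field to times outside \<open>[0,1]\<close>; it is tied to \<open>X\<close> only for times in
  \<open>[0,1]\<close>.\<close>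

definition manifold_box where
  "manifold_box s \<delta> N c U F \<Psi> \<longleftrightarrow> open N \<and> c \<in> A \<and> N \<subseteq> cdom c \<and> open U \<and> U \<subseteq> UNIV \<times> cimg c \<and>
     (\<forall>k. Ck_on k U F) \<and> (\<forall>r x. (r, x) \<in> U \<longrightarrow> r \<in> {0..1} \<longrightarrow> F (r, x) = X r (cinv c x) c) \<and>
     flow_box U F {s - \<delta><..<s + \<delta>} (cmap c ` N) s \<Psi>"

section \<open>Uniform lifetime of local flows\<close>

lemma manifold_box_near:
  assumes c: "c \<in> A" "p \<in> cdom c" and t: "t \<in> {0..1}"
  shows "\<exists>\<epsilon>>0. \<exists>N. open N \<and> p \<in> N \<and> N \<subseteq> cdom c \<and>
    (\<forall>s \<delta>. \<bar>s - t\<bar> < \<epsilon> \<longrightarrow> \<delta> \<le> \<epsilon> \<longrightarrow> (\<exists>U F \<Psi>. manifold_box s \<delta> N c U F \<Psi>))"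
proof -
  obtain U F where U: "open U" "(t, cmap c p) \<in> U" "U \<subseteq> UNIV \<times> cimg c" "\<forall>k. Ck_on k U F"
    "\<forall>r x. (r, x) \<in> U \<longrightarrow> r \<in> {0..1} \<longrightarrow> F (r, x) = X r (cinv c x) c"
    using c t by (rule local_field_extension)
  obtain \<epsilon> V where \<epsilon>: "\<epsilon> > 0" "open V" "cmap c p \<in> V"
    "\<forall>s\<in>{t - \<epsilon><..<t + \<epsilon>}. \<exists>\<Psi>. flow_box U F {t - \<epsilon><..<t + \<epsilon>} V s \<Psi>"
    using local_flow[OF U(1) U(4)[rule_format] U(2)] by metis
  define N where "N = {q \<in> cdom c. cmap c q \<in> V}"
  have N: "open N" "p \<in> N" "N \<subseteq> cdom c" "cmap c ` N \<subseteq> V"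
    using open_cdom_vimage[OF c(1) \<epsilon>(2)] c(2) \<epsilon>(3) by (auto simp: N_def)
  \<comment> \<open>Halving leaves room to recentre: an interval of radius at most
    \<open>\<epsilon> / 2\<close> around such an \<open>s\<close> stays inside the interval of the
    local flow.\<close>
  have "\<exists>U F \<Psi>. manifold_box s \<delta> N c U F \<Psi>" if "\<bar>s - t\<bar> < \<epsilon> / 2" "\<delta> \<le> \<epsilon> / 2" for s \<delta>
  proof -
    have s: "s \<in> {t - \<epsilon><..<t + \<epsilon>}"
      using that(1) \<epsilon>(1) unfolding greaterThanLessThan_iff by linarith
    have sub: "{s - \<delta><..<s + \<delta>} \<subseteq> {t - \<epsilon><..<t + \<epsilon>}"
    proof
      fix r assume "r \<in> {s - \<delta><..<s + \<delta>}"
      then show "r \<in> {t - \<epsilon><..<t + \<epsilon>}"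
        using that unfolding greaterThanLessThan_iff by linarith
    qed
    from \<epsilon>(4) s obtain \<Psi> where "flow_box U F {t - \<epsilon><..<t + \<epsilon>} V s \<Psi>" by blast
    from flow_box_mono[OF this sub N(4)] have "manifold_box s \<delta> N c U F \<Psi>"
      unfolding manifold_box_def using N c U by simp
    then show ?thesis by blast
  qed
  then show ?thesis using \<epsilon>(1) N by (intro exI[of _ "\<epsilon> / 2"] conjI exI[of _ N]) auto
qed

lemma manifold_box_uniform: "\<exists>\<delta>>0. \<forall>s\<in>{0..1}. \<forall>p. \<exists>N c U F \<Psi>. p \<in> N \<and> manifold_box s \<delta> N c U F \<Psi>"
proof -
  let ?K = "{0..1::real} \<times> (UNIV :: 'm set)"
  have "\<exists>\<epsilon> N c. \<epsilon> > 0 \<and> open N \<and> snd x \<in> N \<and>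
    (\<forall>s \<delta>. \<bar>s - fst x\<bar> < \<epsilon> \<longrightarrow> \<delta> \<le> \<epsilon> \<longrightarrow> (\<exists>U F \<Psi>. manifold_box s \<delta> N c U F \<Psi>))" if "x \<in> ?K" for x
  proof -
    obtain c where c: "c \<in> A" "snd x \<in> cdom c" using chart_ex by blast
    have "fst x \<in> {0..1}" using that by auto
    from manifold_box_near[OF c this] show ?thesis by blast
  qed
  then obtain \<epsilon> N c where B: "\<And>x. x \<in> ?K \<Longrightarrow> \<epsilon> x > 0 \<and> open (N x) \<and> snd x \<in> N x \<and>
    (\<forall>s \<delta>. \<bar>s - fst x\<bar> < \<epsilon> x \<longrightarrow> \<delta> \<le> \<epsilon> x \<longrightarrow> (\<exists>U F \<Psi>. manifold_box s \<delta> (N x) (c x) U F \<Psi>))"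
    by metis
  have K: "compact ?K" using compact_M by (intro compact_Times) auto
  have opn: "open (ball (fst x) (\<epsilon> x) \<times> N x)" if "x \<in> ?K" for x
    using B[OF that] by (intro open_Times open_ball) blast
  have cov: "?K \<subseteq> (\<Union>x\<in>?K. ball (fst x) (\<epsilon> x) \<times> N x)"
  proof
    fix x assume x: "x \<in> ?K"
    then have "x \<in> ball (fst x) (\<epsilon> x) \<times> N x" using B[OF x] by (cases x) auto
    with x show "x \<in> (\<Union>x\<in>?K. ball (fst x) (\<epsilon> x) \<times> N x)" by (rule UN_I)
  qed
  obtain D where D: "D \<subseteq> ?K" "finite D" "?K \<subseteq> (\<Union>x\<in>D. ball (fst x) (\<epsilon> x) \<times> N x)"
    by (rule compactE_image[OF K opn cov])
  have "D \<noteq> {}" using D(3) by auto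
  \<comment> \<open>Boxes may be shortened in time without changing \<open>N\<close>, so the least
    radius of the finite subcover works at every point.\<close>
  define \<delta> where "\<delta> = Min (\<epsilon> ` D)"
  have "\<delta> > 0" unfolding \<delta>_def using D(1,2) \<open>D \<noteq> {}\<close> B by (subst Min_gr_iff) auto
  moreover have "\<exists>N c U F \<Psi>. p \<in> N \<and> manifold_box s \<delta> N c U F \<Psi>" if "s \<in> {0..1}" for s p
  proof -
    have "(s, p) \<in> ?K" using that by simp
    then have "(s, p) \<in> (\<Union>x\<in>D. ball (fst x) (\<epsilon> x) \<times> N x)" using D(3) by (rule rev_subsetD)
    then obtain x where x: "x \<in> D" "s \<in> ball (fst x) (\<epsilon> x)" "p \<in> N x"
      by (meson UN_E mem_Sigma_iff)
    have "\<delta> \<le> \<epsilon> x" using x(1) D(2) by (simp add: \<delta>_def)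
    moreover have "\<bar>s - fst x\<bar> < \<epsilon> x" using x(2) by (simp add: dist_real_def abs_minus_commute)
    moreover have "x \<in> ?K" using x(1) D(1) by blast
    ultimately show ?thesis using B[of x] x(3) by meson
  qed
  ultimately show ?thesis by blast
qed

definition box_time :: real where
  "box_time = (SOME \<delta>. \<delta> > 0 \<and> (\<forall>s\<in>{0..1}. \<forall>p. \<exists>N c U F \<Psi>. p \<in> N \<and> manifold_box s \<delta> N c U F \<Psi>))"

lemma box_time: "box_time > 0" "s \<in> {0..1} \<Longrightarrow> \<exists>N c U F \<Psi>. p \<in> N \<and> manifold_box s box_time N c U F \<Psi>"
  using someI_ex[OF manifold_box_uniform] unfolding box_time_def[symmetric] by blast+

lemma manifold_box_curve:
  assumes m: "manifold_box s \<delta> N c U F \<Psi>" and p: "p \<in> N"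
  shows "icurve ({0..1} \<inter> {s - \<delta><..<s + \<delta>}) (\<lambda>t. cinv c (\<Psi> (t, cmap c p)))"
    and "cinv c (\<Psi> (s, cmap c p)) = p"
    and "t \<in> {s - \<delta><..<s + \<delta>} \<Longrightarrow> \<Psi> (t, cmap c p) \<in> cimg c"
proof -
  let ?J = "{s - \<delta><..<s + \<delta>}"
  have c: "c \<in> A" and N: "N \<subseteq> cdom c" and U: "U \<subseteq> UNIV \<times> cimg c"
    and F: "\<And>r x. (r, x) \<in> U \<Longrightarrow> r \<in> {0..1} \<Longrightarrow> F (r, x) = X r (cinv c x) c"
    and fb: "flow_box U F ?J (cmap c ` N) s \<Psi>"
    using m by (auto simp: manifold_box_def)
  have y: "cmap c p \<in> cmap c ` N" using p by simp
  have inU: "(t, \<Psi> (t, cmap c p)) \<in> U" if "t \<in> ?J" for t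
    using fb that y unfolding flow_box_def by blast
  have sol: "((\<lambda>r. \<Psi> (r, cmap c p)) has_vector_derivative F (t, \<Psi> (t, cmap c p))) (at t)" if "t \<in>
      ?J" for t
    using fb that y unfolding flow_box_def by blast
  show im: "\<Psi> (t, cmap c p) \<in> cimg c" if "t \<in> ?J" for t using inU[OF that] U by auto
  have "\<Psi> (s, cmap c p) = cmap c p" using fb y unfolding flow_box_def by blast
  then show "cinv c (\<Psi> (s, cmap c p)) = p" using c p N by auto
  show "icurve ({0..1} \<inter> ?J) (\<lambda>t. cinv c (\<Psi> (t, cmap c p)))"
  proof (rule icurveI[OF _ _ c])
    have "continuous_on ({0..1} \<inter> ?J) (\<lambda>t. \<Psi> (t, cmap c p))"
      using has_vector_derivative_continuous[OF sol] by (intro continuous_at_imp_continuous_on) auto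
    then show "continuous_on ({0..1} \<inter> ?J) (\<lambda>t. cinv c (\<Psi> (t, cmap c p)))"
      by (rule continuous_on_compose2[OF cinv_cont[OF c]]) (use im in auto)
    fix t assume t: "t \<in> {0..1} \<inter> ?J"
    then show "cinv c (\<Psi> (t, cmap c p)) \<in> cdom c" using im by simp
    have "((\<lambda>r. \<Psi> (r, cmap c p)) has_vector_derivative X t (cinv c (\<Psi> (t, cmap c p))) c)
        (at t within {0..1} \<inter> ?J)"
    proof -
      have "t \<in> ?J" "t \<in> {0..1}" using t by auto
      then show ?thesis
        using has_vector_derivative_at_within[OF sol, of t] F[OF inU, of t] by metis
    qed
    then show "((\<lambda>r. cmap c (cinv c (\<Psi> (r, cmap c p)))) has_vector_derivative
        X t (cinv c (\<Psi> (t, cmap c p))) c) (at t within {0..1} \<inter> ?J)"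
      by (rule has_vector_derivative_transform[OF t, rotated]) (use im c in simp)
  qed auto
qed

section \<open>Integral curves on the whole unit interval\<close>

lemma icurve_global:
  assumes s: "s \<in> {0..1}"
  shows "\<exists>\<gamma>. icurve {0..1} \<gamma> \<and> \<gamma> s = p"
proof -
  \<comment> \<open>The times form an open convex set containing both \<open>s\<close> and
    \<open>t\<close>. Openness allows gluing, convexity gives uniqueness on overlaps.\<close>
  define R where "R t \<longleftrightarrow> (\<exists>T \<gamma>. open T \<and> convex T \<and> s \<in> T \<and> t \<in> T \<and> icurve ({0..1} \<inter> T) \<gamma> \<and> \<gamma> s =
      p)" for t
  have glue: "\<exists>\<gamma>. icurve ({0..1} \<inter> (T1 \<union> T2)) \<gamma> \<and> (\<forall>t\<in>T1. \<gamma> t = \<gamma>1 t)"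
    if T: "open T1" "convex T1" "open T2" "convex T2" and g: "icurve ({0..1} \<inter> T1) \<gamma>1" "icurve
        ({0..1} \<inter> T2) \<gamma>2"
      and r: "r \<in> {0..1} \<inter> T1 \<inter> T2" "\<gamma>1 r = \<gamma>2 r" for T1 T2 \<gamma>1 \<gamma>2 r
  proof -
    have "\<gamma>1 t = \<gamma>2 t" if "t \<in> {0..1} \<inter> T1 \<inter> T2" for t
      by (rule icurve_unique[where I = "{0..1} \<inter> T1 \<inter> T2" and s = r])
        (use g r that T in \<open>auto intro!: convex_Int intro: icurve_subset\<close>)
    from icurve_glue[OF T(1,3) g this] show ?thesis
      by (intro exI[of _ "\<lambda>t. if t \<in> T1 then \<gamma>1 t else \<gamma>2 t"]) simp
  qed
  have box: "\<exists>T \<gamma>. open T \<and> convex T \<and> {r - box_time<..<r + box_time} \<subseteq> T \<and> icurve ({0..1} \<inter> T) \<gamma>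
      \<and> \<gamma> r = q"
    if r: "r \<in> {0..1}" for r q
  proof -
    obtain N c U F \<Psi> where "q \<in> N" "manifold_box r box_time N c U F \<Psi>" using box_time(2)[OF r] by
        blast
    from manifold_box_curve(1,2)[OF this(2,1)] show ?thesis
      by (intro exI[of _ "{r - box_time<..<r + box_time}"] exI[of _ "\<lambda>t. cinv c (\<Psi> (t, cmap c
          q))"]) simp
  qed
  have convUn: "convex (S \<union> T)" if "convex S" "convex T" "r \<in> S" "r \<in> T" for S T :: "real set" and r
  proof -
    have "connected (S \<union> T)" using that by (intro connected_Un) (auto intro: convex_connected)
    then show ?thesis unfolding is_interval_convex_1[symmetric] is_interval_connected_1 .
  qed
  have "R t" if "t \<in> {0..1}" for t
  proof (rule step_induct[OF box_time(1) s _ _ that])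
    show "R s"
      using box[OF s, of p] box_time(1) unfolding R_def by fastforce
    fix r t assume rt: "r \<in> {0..1}" "t \<in> {0..1}" "R r" "\<bar>t - r\<bar> < box_time"
    from rt(3) obtain T \<gamma> where T: "open T" "convex T" "s \<in> T" "r \<in> T" "icurve ({0..1} \<inter> T) \<gamma>" "\<gamma>
        s = p"
      unfolding R_def by blast
    from box[OF rt(1), of "\<gamma> r"] obtain T2 \<gamma>2 where T2: "open T2" "convex T2"
      "{r - box_time<..<r + box_time} \<subseteq> T2" "icurve ({0..1} \<inter> T2) \<gamma>2" "\<gamma>2 r = \<gamma> r" by blast
    have rT2: "r \<in> T2" "t \<in> T2" using T2(3) box_time(1) rt(4) by (auto simp: abs_less_iff
        subset_iff)
    from glue[OF T(1,2) T2(1,2) T(5) T2(4), of r] rt(1) T(4) rT2 T2(5)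
    obtain \<gamma>' where "icurve ({0..1} \<inter> (T \<union> T2)) \<gamma>'" "\<gamma>' s = p" using T(3,6) by auto
    moreover have "convex (T \<union> T2)" by (rule convUn[OF T(2) T2(2) T(4) rT2(1)])
    ultimately show "R t"
      unfolding R_def using T(1,3) T2(1) rT2(2) by (intro exI[of _ "T \<union> T2"] exI[of _ \<gamma>']) auto
  qed
  \<comment> \<open>Reaching both ends is enough: the two domains meet at \<open>s\<close>, and
    their union is convex and covers \<open>[0,1]\<close>.\<close>
  then have "R 0" "R 1" by auto
  then obtain T0 \<gamma>0 T1 \<gamma>1 where
    T0: "open T0" "convex T0" "s \<in> T0" "0 \<in> T0" "icurve ({0..1} \<inter> T0) \<gamma>0" "\<gamma>0 s = p" and
    T1: "open T1" "convex T1" "s \<in> T1" "1 \<in> T1" "icurve ({0..1} \<inter> T1) \<gamma>1" "\<gamma>1 s = p"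
    unfolding R_def by blast
  obtain \<gamma> where \<gamma>: "icurve ({0..1} \<inter> (T0 \<union> T1)) \<gamma>" "\<gamma> s = p"
    using glue[OF T0(1,2) T1(1,2) T0(5) T1(5), of s] s T0(3,6) T1(3,6) by auto
  have "convex (T0 \<union> T1)" by (rule convUn[OF T0(2) T1(2) T0(3) T1(3)])
  then have "{0..1} \<subseteq> T0 \<union> T1"
    using T0(4) T1(4) closed_segment_subset[of 0 "T0 \<union> T1" 1] by (simp add:
        closed_segment_eq_real_ivl)
  then have "{0..1} \<inter> (T0 \<union> T1) = {0..1}" by auto
  with \<gamma> show ?thesis by auto
qed

section \<open>The evolution between two times and its smoothness\<close>

definition evolution :: "real \<Rightarrow> 'm \<Rightarrow> real \<Rightarrow> 'm" where
  "evolution s p = (SOME \<gamma>. icurve {0..1} \<gamma> \<and> \<gamma> s = p)"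

lemma evolution: "s \<in> {0..1} \<Longrightarrow> icurve {0..1} (evolution s p)" "s \<in> {0..1} \<Longrightarrow> evolution s p s = p"
  using someI_ex[OF icurve_global[of s p]] unfolding evolution_def by blast+

text \<open>Both sides are integral curves in \<open>t\<close> with the same value at
  \<open>r\<close>.\<close>

lemma evolution_cocycle:
  assumes "s \<in> {0..1}" "r \<in> {0..1}" "t \<in> {0..1}"
  shows "evolution r (evolution s p r) t = evolution s p t"
  by (rule icurve_unique[OF evolution(1)[OF assms(2)] evolution(1)[OF assms(1)] _ _ assms(2) _
      assms(3)])
    (use evolution(2)[OF assms(2)] in auto)

lemma evolution_box:
  assumes m: "manifold_box s \<delta> N c U F \<Psi>" and p: "p \<in> N" and s: "s \<in> {0..1}"
    and t: "t \<in> {0..1}" "t \<in> {s - \<delta><..<s + \<delta>}"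
  shows "evolution s p t = cinv c (\<Psi> (t, cmap c p))"
proof -
  have s': "s \<in> {0..1} \<inter> {s - \<delta><..<s + \<delta>}" using s t(2) by auto
  have "icurve ({0..1} \<inter> {s - \<delta><..<s + \<delta>}) (evolution s p)"
    by (rule icurve_subset[OF evolution(1)[OF s]]) auto
  from icurve_unique[OF this manifold_box_curve(1)[OF m p] _ _ s', of t] show ?thesis
    using evolution(2)[OF s] manifold_box_curve(2)[OF m p] t by (simp add: convex_Int)
qed

text \<open>In the applications \<open>G\<close> is the evolution up to the time \<open>s\<close>.
  Precomposing with it lets smoothness spread by steps of length \<open>box_time\<close>, since
  boxes are available around every image point of \<open>G\<close>.\<close>

lemma flow_family_smooth:
  assumes G: "smooth_map A G" and s: "s \<in> {0..1}" and c: "c \<in> A" and d: "d \<in> A"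
  shows "smooth_on {(t, x). t \<in> {0..1} \<inter> {s - box_time<..<s + box_time} \<and> x \<in> cimg c \<and> evolution s
      (G (cinv c x)) t \<in> cdom d}
    (\<lambda>(t, x). cmap d (evolution s (G (cinv c x)) t))" (is "smooth_on ?S ?f")
proof (rule smooth_on_local)
  fix z assume z: "z \<in> ?S"
  let ?J = "{s - box_time<..<s + box_time}"
  obtain N e U F \<Psi> where N: "G (cinv c (snd z)) \<in> N" and m: "manifold_box s box_time N e U F \<Psi>"
    using box_time(2)[OF s] by blast
  have e: "e \<in> A" "open N" "N \<subseteq> cdom e" and fb: "flow_box U F ?J (cmap e ` N) s \<Psi>"
    using m by (auto simp: manifold_box_def)
  have cG: "continuous_on UNIV G" using G by (simp add: smooth_map_def)
  define W where "W = {x \<in> cimg c. cinv c x \<in> G -` N}"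
  have W: "open W"
    unfolding W_def by (rule open_cimg_vimage[OF c open_vimage[OF e(2) cG]])
  have oN: "open (cmap e ` N)"
  proof -
    have "cmap e ` N = {x \<in> cimg e. cinv e x \<in> N}" using e(1,3) by (force simp: image_iff)
    then show ?thesis using open_cimg_vimage[OF e(1,2)] by simp
  qed
  let ?O = "?J \<times> W"
  have "smooth_on W (cmap e \<circ> G \<circ> cinv c)"
  proof (rule smooth_on_subset)
    show "smooth_on {x \<in> cimg c. G (cinv c x) \<in> cdom e} (cmap e \<circ> G \<circ> cinv c)"
      using G c e(1) by (simp add: smooth_map_def)
  qed (use e(3) in \<open>auto simp: W_def\<close>)
  moreover have "snd ` (?O \<inter> ?S) \<subseteq> W" by auto
  ultimately have "smooth_on (?O \<inter> ?S) (\<lambda>x. (cmap e \<circ> G \<circ> cinv c) (snd x))"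
    by (rule smooth_on_compose[OF smooth_on_bounded_linear[OF bounded_linear_snd]])
  then have "smooth_on (?O \<inter> ?S) (\<lambda>x. cmap e (G (cinv c (snd x))))" by (simp only: o_def)
  from smooth_on_Pair[OF smooth_on_bounded_linear[OF bounded_linear_fst] this]
  have 1: "smooth_on (?O \<inter> ?S) (\<lambda>x. (fst x, cmap e (G (cinv c (snd x)))))" .
  have 2: "smooth_on (?J \<times> cmap e ` N) \<Psi>"
    using fb oN unfolding flow_box_def by (intro smooth_on_openI open_Times) auto
  have "(\<lambda>x. (fst x, cmap e (G (cinv c (snd x))))) ` (?O \<inter> ?S) \<subseteq> ?J \<times> cmap e ` N"
    by (auto simp: W_def)
  from smooth_on_compose[OF 1 2 this]
  have 3: "smooth_on (?O \<inter> ?S) (\<lambda>x. \<Psi> (fst x, cmap e (G (cinv c (snd x)))))" .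
  have eq: "evolution s (G (cinv c (snd x))) (fst x) = cinv e (\<Psi> (fst x, cmap e (G (cinv c (snd
      x)))))"
    "\<Psi> (fst x, cmap e (G (cinv c (snd x)))) \<in> cimg e" if "x \<in> ?O \<inter> ?S" for x
    using evolution_box[OF m _ s] manifold_box_curve(3)[OF m] that by (auto simp: W_def)
  have im: "(\<lambda>x. \<Psi> (fst x, cmap e (G (cinv c (snd x))))) ` (?O \<inter> ?S) \<subseteq> overlap e d"
  proof
    fix y assume "y \<in> (\<lambda>x. \<Psi> (fst x, cmap e (G (cinv c (snd x))))) ` (?O \<inter> ?S)"
    then obtain x where x: "x \<in> ?O \<inter> ?S" and y: "y = \<Psi> (fst x, cmap e (G (cinv c (snd x))))" by
        blast
    have "evolution s (G (cinv c (snd x))) (fst x) \<in> cdom d" using x by auto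
    then show "y \<in> overlap e d" using eq[OF x] by (simp add: overlap_eq[OF e(1)] y)
  qed
  have 4: "smooth_on (?O \<inter> ?S) (\<lambda>x. cmap d (cinv e (\<Psi> (fst x, cmap e (G (cinv c (snd x)))))))"
    by (rule smooth_on_compose[OF 3 transition_smooth[OF e(1) d] im])
  have "smooth_on (?O \<inter> ?S) ?f"
  proof (rule smooth_on_cong[OF 4])
    fix x assume "x \<in> ?O \<inter> ?S"
    from eq(1)[OF this]
    show "cmap d (cinv e (\<Psi> (fst x, cmap e (G (cinv c (snd x)))))) = ?f x"
      by (simp only: case_prod_unfold)
  qed
  moreover have "open ?O" using W by (intro open_Times) auto
  moreover have "z \<in> ?O" using z N by (auto simp: W_def)
  ultimately show "\<exists>W. open W \<and> z \<in> W \<and> smooth_on (W \<inter> ?S) ?f" by blast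
qed

lemma flow_family_continuous:
  fixes G :: "'m \<Rightarrow> 'm"
  assumes G: "continuous_on UNIV G" and s: "s \<in> {0..1}"
  shows "continuous_on (({0..1} \<inter> {s - box_time<..<s + box_time}) \<times> UNIV) (\<lambda>x. evolution s (G (snd
      x)) (fst x))"
    (is "continuous_on ?S ?f")
proof (rule continuous_on_locally)
  fix z assume z: "z \<in> ?S"
  let ?J = "{s - box_time<..<s + box_time}"
  obtain N e U F \<Psi> where N: "G (snd z) \<in> N" and m: "manifold_box s box_time N e U F \<Psi>"
    using box_time(2)[OF s] by blast
  have e: "e \<in> A" "open N" "N \<subseteq> cdom e" and fb: "flow_box U F ?J (cmap e ` N) s \<Psi>"
    using m by (auto simp: manifold_box_def)
  let ?O = "?J \<times> (G -` N)"
  have "continuous_on ?O (\<lambda>x. G (snd x))"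
    by (intro continuous_on_compose2[OF G] continuous_intros) auto
  then have "continuous_on ?O (\<lambda>x. cmap e (G (snd x)))"
    by (rule continuous_on_compose2[OF cmap_cont[OF e(1)]]) (use e(3) in auto)
  then have 1: "continuous_on ?O (\<lambda>x. (fst x, cmap e (G (snd x))))"
    by (intro continuous_intros)
  have "Ck_on 0 (?J \<times> cmap e ` N) \<Psi>" using fb unfolding flow_box_def by blast
  then have 2: "continuous_on (?J \<times> cmap e ` N) \<Psi>" by simp
  have "continuous_on ?O (\<lambda>x. \<Psi> (fst x, cmap e (G (snd x))))"
    by (rule continuous_on_compose2[OF 2 1]) auto
  then have "continuous_on ?O (\<lambda>x. cinv e (\<Psi> (fst x, cmap e (G (snd x)))))"
    by (rule continuous_on_compose2[OF cinv_cont[OF e(1)]]) (use manifold_box_curve(3)[OF m] in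
        auto)
  then have "continuous_on (?S \<inter> ?O) (\<lambda>x. cinv e (\<Psi> (fst x, cmap e (G (snd x)))))"
    by (rule continuous_on_subset) auto
  moreover have "cinv e (\<Psi> (fst x, cmap e (G (snd x)))) = ?f x" if "x \<in> ?S \<inter> ?O" for x
    using evolution_box[OF m _ s, of "G (snd x)" "fst x"] that by auto
  ultimately have "continuous_on (?S \<inter> ?O) ?f" by (rule continuous_on_eq)
  moreover have "open ?O" using open_vimage[OF e(2) G] by (intro open_Times) auto
  moreover have "z \<in> ?O" using z N by auto
  ultimately show "\<exists>W. open W \<and> z \<in> W \<and> continuous_on (?S \<inter> W) ?f" by blast
qed

text \<open>Step induction along the cocycle rule: the evolution up to \<open>r\<close> is smooth,
  and from \<open>r\<close> to a nearby \<open>t\<close> a flow box takes over.\<close>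

lemma evolution_smooth_map:
  assumes s: "s \<in> {0..1}" and t: "t \<in> {0..1}"
  shows "smooth_map A (\<lambda>p. evolution s p t)"
proof (rule step_induct[OF box_time(1) s _ _ t])
  show "smooth_map A (\<lambda>p. evolution s p s)" using smooth_map_id evolution(2)[OF s] by simp
  fix r t assume r: "r \<in> {0..1}" and t: "t \<in> {0..1}" and G: "smooth_map A (\<lambda>p. evolution s p r)"
    and tr: "\<bar>t - r\<bar> < box_time"
  have tJ: "t \<in> {0..1} \<inter> {r - box_time<..<r + box_time}"
    using t tr by (simp add: abs_less_iff) 
  have eq: "(\<lambda>p. evolution r (evolution s p r) t) = (\<lambda>p. evolution s p t)"
    using evolution_cocycle[OF s r t] by simp
  show "smooth_map A (\<lambda>p. evolution s p t)"
    unfolding smooth_map_def eq[symmetric]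
  proof (intro conjI ballI)
    have cG: "continuous_on UNIV (\<lambda>p. evolution s p r)" using G by (simp add: smooth_map_def)
    have "continuous_on UNIV (\<lambda>p::'m. (t, p))" by (intro continuous_intros)
    from continuous_on_compose2[OF flow_family_continuous[OF cG r] this]
    have "continuous_on UNIV (\<lambda>x. evolution r (evolution s (snd (t, x)) r) (fst (t, x)))" using tJ
        by blast
    then show "continuous_on UNIV (\<lambda>p. evolution r (evolution s p r) t)" by simp
    fix c d assume cd: "c \<in> A" "d \<in> A"
    let ?S = "{x \<in> cimg c. evolution r (evolution s (cinv c x) r) t \<in> cdom d}"
    have "smooth_on ?S (\<lambda>x. (t, x))"
      by (intro smooth_on_Pair smooth_on_const smooth_on_bounded_linear bounded_linear_ident)
    from smooth_on_compose[OF this flow_family_smooth[OF G r cd]]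
    have "smooth_on ?S (\<lambda>x. cmap d (evolution r (evolution s (cinv c x) r) t))" using tJ by auto
    then show "smooth_on ?S (cmap d \<circ> (\<lambda>p. evolution r (evolution s p r) t) \<circ> cinv c)"
      by (simp add: o_def)
  qed
qed

section \<open>The flow from time zero and its derivative in time\<close>

definition flow :: "real \<Rightarrow> 'm \<Rightarrow> 'm" where
  "flow t p = evolution 0 p t"

lemma flow_evolution: "s \<in> {0..1} \<Longrightarrow> t \<in> {0..1} \<Longrightarrow> flow t p = evolution s (flow s p) t"
  unfolding flow_def using evolution_cocycle[of 0 s t p] by simp

lemma flow_smooth_map: "t \<in> {0..1} \<Longrightarrow> smooth_map A (flow t)"
  using evolution_smooth_map[of 0 t] by (simp add: flow_def[abs_def])

lemma flow_0: "flow 0 = id"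
  using evolution(2)[of 0] by (auto simp: flow_def)

text \<open>The inverse is the evolution from \<open>t\<close> back to \<open>0\<close>, smooth
  because initial times other than \<open>0\<close> were allowed throughout.\<close>

lemma flow_diffeo:
  assumes t: "t \<in> {0..1}"
  shows "diffeomorphism A (flow t)"
proof -
  have z: "(0::real) \<in> {0..1}" by simp
  have 1: "evolution t (flow t p) 0 = p" for p
    unfolding flow_def using evolution_cocycle[OF z t z] evolution(2)[OF z] by simp
  have 2: "flow t (evolution t q 0) = q" for q
    unfolding flow_def using evolution_cocycle[OF t z t] evolution(2)[OF t] by simp
  have b: "bij (flow t)" by (rule o_bij[where g = "\<lambda>q. evolution t q 0"]) (use 1 2 in auto)
  moreover have "inv (flow t) = (\<lambda>q. evolution t q 0)"
    by (rule inv_equality) (use 1 2 in auto)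
  ultimately show ?thesis
    unfolding diffeomorphism_def using flow_smooth_map[OF t] evolution_smooth_map[OF t z] by simp
qed

lemma flow_isotopy: "isotopy A flow"
  unfolding isotopy_def
proof (intro conjI ballI flow_diffeo flow_0)
  show "continuous_on ({0..1} \<times> UNIV) (\<lambda>(t, p). flow t p)" (is "continuous_on ?S ?f")
  proof (rule continuous_on_locally)
    fix z assume z: "z \<in> ?S"
    \<comment> \<open>Around the time \<open>s\<close> the flow is the evolution from
      \<open>s\<close> after \<open>flow s\<close>, to which the local results apply.\<close>
    define s where "s = fst z"
    have s: "s \<in> {0..1}" using z by (auto simp: s_def)
    let ?W = "{s - box_time<..<s + box_time} \<times> UNIV :: (real \<times> 'm) set"
    have "continuous_on UNIV (flow s)" using flow_smooth_map[OF s] by (simp add: smooth_map_def)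
    from flow_family_continuous[OF this s]
    have "continuous_on (?S \<inter> ?W) (\<lambda>x. evolution s (flow s (snd x)) (fst x))"
      by (rule continuous_on_subset) auto
    then have "continuous_on (?S \<inter> ?W) ?f"
      by (rule continuous_on_eq) (use flow_evolution[OF s] in auto)
    moreover have "open ?W" by (intro open_Times) auto
    moreover have "z \<in> ?W" using box_time(1) by (cases z) (simp add: s_def)
    ultimately show "\<exists>W. open W \<and> z \<in> W \<and> continuous_on (?S \<inter> W) ?f" by blast
  qed
  fix c d assume cd: "c \<in> A" "d \<in> A"
  show "smooth_on {(t, x). t \<in> {0..1} \<and> x \<in> cimg c \<and> flow t (cinv c x) \<in> cdom d}
      (\<lambda>(t, x). cmap d (flow t (cinv c x)))" (is "smooth_on ?S ?f")
  proof (rule smooth_on_local)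
    fix z assume z: "z \<in> ?S"
    define s where "s = fst z"
    have s: "s \<in> {0..1}" using z by (auto simp: s_def)
    let ?W = "{s - box_time<..<s + box_time} \<times> UNIV :: (real \<times> 'e) set"
    have "smooth_on (?W \<inter> ?S) (\<lambda>(t, x). cmap d (evolution s (flow s (cinv c x)) t))"
      by (rule smooth_on_subset[OF flow_family_smooth[OF flow_smooth_map[OF s] s cd]])
        (use flow_evolution[OF s] in auto)
    then have "smooth_on (?W \<inter> ?S) ?f"
      by (rule smooth_on_cong) (use flow_evolution[OF s] in auto)
    moreover have "open ?W" by (intro open_Times) auto
    moreover have "z \<in> ?W" using box_time(1) by (cases z) (simp add: s_def)
    ultimately show "\<exists>W. open W \<and> z \<in> W \<and> smooth_on (W \<inter> ?S) ?f" by blast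
  qed
qed

text \<open>\<open>D t\<close> is the tangent map of the flow in the charts \<open>c\<close> and
  \<open>d\<close>. The variational equation gives its time derivative, with \<open>Y'\<close> the
  spatial derivative of the field at the moving point.\<close>

lemma flow_in_chart:
  assumes t0: "t0 \<in> {0..1}" and c: "c \<in> A" "p \<in> cdom c" and d: "d \<in> A" "flow t0 p \<in> cdom d"
  defines "D \<equiv> \<lambda>t. frechet_derivative (cmap d \<circ> flow t \<circ> cinv c) (at (cmap c p))"
    and "y0 \<equiv> cmap d (flow t0 p)"
  obtains \<epsilon> Y' where "\<epsilon> > 0" "\<forall>t\<in>{0..1}. \<bar>t - t0\<bar> < \<epsilon> \<longrightarrow> flow t p \<in> cdom d"
    "((\<lambda>y. X t0 (cinv d y) d) has_derivative Y') (at y0)"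
    "((\<lambda>t. cmap d (flow t p)) has_vector_derivative X t0 (flow t0 p) d) (at t0 within {0..1})"
    "\<forall>v. ((\<lambda>t. D t v) has_vector_derivative Y' (D t0 v)) (at t0 within {0..1})"
proof -
  let ?q = "flow t0 p"
  obtain \<epsilon> N where \<epsilon>: "\<epsilon> > 0" and N: "open N" "?q \<in> N" "N \<subseteq> cdom d"
    and ex: "\<forall>s \<delta>. \<bar>s - t0\<bar> < \<epsilon> \<longrightarrow> \<delta> \<le> \<epsilon> \<longrightarrow> (\<exists>U F \<Psi>. manifold_box s \<delta> N d U F \<Psi>)"
    using manifold_box_near[OF d t0] by blast
  from ex \<epsilon> obtain U F \<Psi> where m: "manifold_box t0 \<epsilon> N d U F \<Psi>" by fastforce
  let ?J = "{t0 - \<epsilon><..<t0 + \<epsilon>}"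
  have U: "open U" "U \<subseteq> UNIV \<times> cimg d" "\<forall>k. Ck_on k U F"
    "\<And>r x. (r, x) \<in> U \<Longrightarrow> r \<in> {0..1} \<Longrightarrow> F (r, x) = X r (cinv d x) d"
    and fb: "flow_box U F ?J (cmap d ` N) t0 \<Psi>"
    using m by (auto simp: manifold_box_def)
  have t0J: "t0 \<in> ?J" using \<epsilon> by simp
  have y0N: "y0 \<in> cmap d ` N" using N(2) by (simp add: y0_def)
  have \<Psi>0: "\<Psi> (t0, y) = y" if "y \<in> cmap d ` N" for y using fb that unfolding flow_box_def by blast
  have y0U: "(t0, y0) \<in> U" using fb t0J y0N \<Psi>0[OF y0N] unfolding flow_box_def by metis
  have Gq: "flow t (cinv c x) = cinv d (\<Psi> (t, cmap d (flow t0 (cinv c x))))"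
    "\<Psi> (t, cmap d (flow t0 (cinv c x))) \<in> cimg d"
    if "t \<in> {0..1}" "t \<in> ?J" "flow t0 (cinv c x) \<in> N" for t x
    using evolution_box[OF m that(3) t0 that(1,2)] manifold_box_curve(3)[OF m that(3,2)]
    by (simp_all add: flow_evolution[OF t0 that(1)])
  have cp: "cinv c (cmap c p) = p" using c by simp
  have dom: "flow t p \<in> cdom d" "cmap d (flow t p) = \<Psi> (t, y0)" if "t \<in> {0..1}" "t \<in> ?J" for t
    using Gq[OF that, of "cmap c p"] N(2) d(1) by (simp_all add: cp y0_def)
  have S: "open (?J \<times> cmap d ` N)"
  proof -
    have "cmap d ` N = {x \<in> cimg d. cinv d x \<in> N}" using d(1) N(3) by (force simp: image_iff)
    then show ?thesis using open_cimg_vimage[OF d(1) N(1)] by (simp add: open_Times)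
  qed
  have \<Psi>d: "((\<lambda>y. \<Psi> (t, y)) has_derivative frechet_derivative (\<lambda>y. \<Psi> (t, y)) (at y0)) (at y0)"
    if "t \<in> ?J" for t
  proof -
    have "Ck_on (Suc 0) (?J \<times> cmap d ` N) \<Psi>" using fb unfolding flow_box_def by blast
    moreover have "(t, y0) \<in> ?J \<times> cmap d ` N" using that y0N by simp
    ultimately have "(\<Psi> has_derivative frechet_derivative \<Psi> (at (t, y0))) (at (t, y0))"
      by (rule Ck_on_SucD)
    moreover have "((\<lambda>y. (t, y)) has_derivative (\<lambda>h. (0, h))) (at y0)"
      by (auto intro!: derivative_eq_intros)
    ultimately have "((\<lambda>y. \<Psi> (t, y)) has_derivative (\<lambda>h. frechet_derivative \<Psi> (at (t, y0)) (0,
        h))) (at y0)"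
      by (rule has_derivative_compose[rotated])
    then show ?thesis by (metis frechet_derivative_at)
  qed
  have Dd: "((\<lambda>x. cmap d (flow t (cinv c x))) has_derivative D t) (at (cmap c p))"
    if "t \<in> {0..1}" "t \<in> ?J" for t
    unfolding D_def
    by (rule smooth_map_chart_derivative[OF flow_smooth_map[OF that(1)] c d(1) dom(1)[OF that]])
  \<comment> \<open>The flow is factored through time \<open>t0\<close>: the tangent map at
    \<open>t\<close> is that of the local flow from \<open>t0\<close> applied to the fixed vector
    \<open>D t0 v\<close>, so only the local flow depends on \<open>t\<close>.\<close>
  have D_eq: "D t v = frechet_derivative (\<lambda>y. \<Psi> (t, y)) (at y0) (D t0 v)"
    if t: "t \<in> {0..1}" "t \<in> ?J" for t v
  proof -
    define W where "W = {x \<in> cimg c. cinv c x \<in> flow t0 -` N}"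
    have W: "open W"
      unfolding W_def using flow_smooth_map[OF t0]
      by (intro open_cimg_vimage[OF c(1)] open_vimage N(1)) (simp add: smooth_map_def)
    have "((\<lambda>y. \<Psi> (t, y)) has_derivative frechet_derivative (\<lambda>y. \<Psi> (t, y)) (at y0))
        (at (cmap d (flow t0 (cinv c (cmap c p)))))"
      using \<Psi>d[OF t(2)] by (simp add: cp y0_def)
    from has_derivative_compose[OF Dd[OF t0 t0J] this]
    have "((\<lambda>x. \<Psi> (t, cmap d (flow t0 (cinv c x)))) has_derivative
        (\<lambda>v. frechet_derivative (\<lambda>y. \<Psi> (t, y)) (at y0) (D t0 v))) (at (cmap c p))" .
    then have "((\<lambda>x. cmap d (flow t (cinv c x))) has_derivative
        (\<lambda>v. frechet_derivative (\<lambda>y. \<Psi> (t, y)) (at y0) (D t0 v))) (at (cmap c p))"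
    proof (rule has_derivative_transform_within_open[OF _ W])
      show "cmap c p \<in> W" using c N(2) by (simp add: W_def)
      show "\<Psi> (t, cmap d (flow t0 (cinv c x))) = cmap d (flow t (cinv c x))" if "x \<in> W" for x
        using Gq[OF t, of x] that d(1) by (simp add: W_def)
    qed
    from has_derivative_unique[OF Dd[OF t] this] show ?thesis by metis
  qed
  \<comment> \<open>Computed from the extension \<open>F\<close>, this is also the derivative of
    \<open>X t0\<close>, because the two agree at time \<open>t0\<close> on a neighbourhood of
    \<open>y0\<close>.\<close>
  define Y' where "Y' h = frechet_derivative F (at (t0, y0)) (0, h)" for h
  have F': "(F has_derivative frechet_derivative F (at (t0, y0))) (at (t0, y0))"
    using U(3) y0U by (intro Ck_on_SucD[of 0 U]) auto
  have FX: "F (t0, y0) = X t0 ?q d"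
    using U(4)[OF y0U t0] d by (simp add: y0_def)
  show ?thesis
  proof (rule that[of \<epsilon> Y'])
    show "\<forall>t\<in>{0..1}. \<bar>t - t0\<bar> < \<epsilon> \<longrightarrow> flow t p \<in> cdom d"
      using dom(1) by (auto simp: abs_less_iff)
    have "((\<lambda>y. (t0, y)) has_derivative (\<lambda>h. (0, h))) (at y0)"
      by (auto intro!: derivative_eq_intros)
    from has_derivative_compose[OF this F']
    have "((\<lambda>y. F (t0, y)) has_derivative Y') (at y0)" by (simp add: Y'_def[abs_def])
    moreover have "open {y. (t0, y) \<in> U}"
      using open_vimage[OF U(1), of "\<lambda>y. (t0, y)"] by (simp add: vimage_def continuous_intros)
    ultimately show "((\<lambda>y. X t0 (cinv d y) d) has_derivative Y') (at y0)"
      by (rule has_derivative_transform_within_open) (use y0U U(4) t0 in auto)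
    have near: "t \<in> ?J" if "dist t t0 < \<epsilon>" for t
      using that by (simp add: dist_real_def abs_less_iff)
    have "((\<lambda>t. \<Psi> (t, y0)) has_vector_derivative F (t0, \<Psi> (t0, y0))) (at t0)"
      using fb t0J y0N unfolding flow_box_def by blast
    then have "((\<lambda>t. \<Psi> (t, y0)) has_vector_derivative X t0 ?q d) (at t0)"
      by (simp add: \<Psi>0[OF y0N] FX)
    then have "((\<lambda>t. \<Psi> (t, y0)) has_vector_derivative X t0 ?q d) (at t0 within {0..1})"
      by (rule has_vector_derivative_at_within)
    then show "((\<lambda>t. cmap d (flow t p)) has_vector_derivative X t0 ?q d) (at t0 within {0..1})"
      by (rule has_vector_derivative_transform_within[OF _ \<epsilon> t0]) (use dom(2) near in auto)
    show "\<forall>v. ((\<lambda>t. D t v) has_vector_derivative Y' (D t0 v)) (at t0 within {0..1})"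
    proof
      fix v
      let ?f = "\<lambda>t. frechet_derivative (\<lambda>y. \<Psi> (t, y)) (at y0) (D t0 v)"
      have "(?f has_vector_derivative frechet_derivative F (at (t0, \<Psi> (t0, y0))) (0, ?f t0)) (at
          t0)"
        using fb t0J y0N unfolding flow_box_def by blast
      moreover have "?f t0 = D t0 v" using D_eq[OF t0 t0J, of v] by simp
      ultimately have "(?f has_vector_derivative Y' (D t0 v)) (at t0)"
        by (simp add: Y'_def \<Psi>0[OF y0N])
      then have "(?f has_vector_derivative Y' (D t0 v)) (at t0 within {0..1})"
        by (rule has_vector_derivative_at_within)
      then show "((\<lambda>t. D t v) has_vector_derivative Y' (D t0 v)) (at t0 within {0..1})"
        by (rule has_vector_derivative_transform_within[OF _ \<epsilon> t0]) (use D_eq near in auto)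
    qed
  qed (rule \<epsilon>)
qed

end

section \<open>Alternating forms in odd dimension\<close>

text \<open>Splitting off hyperbolic planes: \<open>span {u, v}\<close> with
  \<open>B u v = 1\<close> is complemented by its orthogonal subspace under \<open>B\<close>, on
  which \<open>B\<close> is again nondegenerate and whose dimension is smaller by two.\<close>

lemma nondegenerate_alternating_even_dim:
  fixes B :: "'e::euclidean_space \<Rightarrow> 'e \<Rightarrow> real"
  assumes lin: "\<And>v. linear (\<lambda>u. B u v)" and alt: "\<And>u v. B u v = - B v u"
    and S: "subspace S" and nd: "\<And>x. x \<in> S \<Longrightarrow> (\<And>y. y \<in> S \<Longrightarrow> B x y = 0) \<Longrightarrow> x = 0"
  shows "even (dim S)"
  using S nd
proof (induction "dim S" arbitrary: S rule: less_induct)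
  case less
  note S = less.prems(1) and nd = less.prems(2)
  have lin2: "linear (\<lambda>v. B u v)" for u
  proof -
    have "(\<lambda>v. B u v) = (\<lambda>v. - B v u)" using alt by blast
    then show ?thesis using linear_compose_neg[OF lin[of u]] by simp
  qed
  have BL: "B (x + y) z = B x z + B y z" "B (x - y) z = B x z - B y z" "B (r *\<^sub>R x) z = r * B x z"
    "B x (y + z) = B x y + B x z" "B x (y - z) = B x y - B x z" "B x (r *\<^sub>R y) = r * B x y" for x
        y z r
    using linear_add[OF lin] linear_diff[OF lin] linear_scale[OF lin]
      linear_add[OF lin2] linear_diff[OF lin2] linear_scale[OF lin2] by simp_all
  have B0: "B 0 z = 0" for z using linear_0[OF lin] .
  have B2: "B u u = 0" for u using alt[of u u] by simp
  show ?case
  proof (cases "S \<subseteq> {0}")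
    case True
    then have 0: "dim S = 0" using dim_eq_0 by blast
    show ?thesis unfolding 0 by simp
  next
    case False
    then obtain u where u: "u \<in> S" "u \<noteq> 0" by auto
    then obtain y where y: "y \<in> S" "B u y \<noteq> 0" using nd by blast
    define v where "v = (1 / B u y) *\<^sub>R y"
    have v: "v \<in> S" "B u v = 1" "B v u = -1"
      using y S alt[of v u] by (simp_all add: v_def BL subspace_scale)
    define S' where "S' = {z \<in> S. B z u = 0 \<and> B z v = 0}"
    have S': "subspace S'"
      using S by (auto simp: S'_def subspace_def BL B0)
    define P where "P = span {u, v}"
    have P: "subspace P" by (simp add: P_def)
    have PS: "P \<subseteq> S" unfolding P_def using u v S by (intro span_minimal) auto
    \<comment> \<open>The projection along the plane; its coefficients are forced by orthogonality
      to \<open>u\<close> and \<open>v\<close>.\<close>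
    have decomp: "z - B z v *\<^sub>R u + B z u *\<^sub>R v \<in> S'" if "z \<in> S" for z
      using that u(1) v S
      by (simp add: S'_def BL B2 subspace_add subspace_diff subspace_scale)
    have inP: "a *\<^sub>R u + b *\<^sub>R v \<in> P" for a b
      unfolding P_def by (intro span_add span_scale span_base) auto
    have sum: "{x + y |x y. x \<in> S' \<and> y \<in> P} = S"
    proof (intro equalityI subsetI)
      fix z assume "z \<in> {x + y |x y. x \<in> S' \<and> y \<in> P}"
      then show "z \<in> S" using PS S by (auto simp: S'_def subspace_add)
    next
      fix z assume z: "z \<in> S"
      have "z = (z - B z v *\<^sub>R u + B z u *\<^sub>R v) + (B z v *\<^sub>R u + (- B z u) *\<^sub>R v)" by simp
      with decomp[OF z] inP show "z \<in> {x + y |x y. x \<in> S' \<and> y \<in> P}" by blast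
    qed
    have int: "S' \<inter> P \<subseteq> {0}"
    proof
      fix z assume z: "z \<in> S' \<inter> P"
      then obtain a b where ab: "z = a *\<^sub>R u + b *\<^sub>R v"
        unfolding P_def span_insert[of u "{v}"] span_singleton by (auto simp: algebra_simps)
      have "B z u = 0" "B z v = 0" using z by (auto simp: S'_def)
      then have "a = 0" "b = 0" using v(2,3) by (simp_all add: ab BL B2)
      then show "z \<in> {0}" by (simp add: ab)
    qed
    have "v \<noteq> 0" using v(2) linear_0[OF lin2] by auto
    have "u \<notin> span {v}"
    proof
      assume "u \<in> span {v}"
      then obtain k where "u = k *\<^sub>R v" by (auto simp: span_singleton)
      then show False using v(2) by (simp add: BL B2)
    qed
    then have ind: "independent {u, v}" and "u \<noteq> v"
      using \<open>v \<noteq> 0\<close> span_base[of v "{v}"] by (auto simp: independent_insert)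
    have dP: "dim P = 2"
      using dim_span_eq_card_independent[OF ind] \<open>u \<noteq> v\<close> by (simp add: P_def)
    have int0: "dim (S' \<inter> P) = 0" using int dim_eq_0 by blast
    have dS: "dim S = dim S' + 2"
      using dim_sums_Int[OF S' P] unfolding int0 dP sum by simp
    have "even (dim S')"
    proof (rule less.hyps)
      show "dim S' < dim S" using dS by simp
      show "subspace S'" by (rule S')
      fix z assume z: "z \<in> S'" "\<And>y. y \<in> S' \<Longrightarrow> B z y = 0"
      show "z = 0"
      proof (rule nd)
        show "z \<in> S" using z(1) by (simp add: S'_def)
        \<comment> \<open>Testing against \<open>S\<close> reduces to testing against
          \<open>S'\<close>, since \<open>z\<close> is already orthogonal to the plane.\<close>
        fix y assume "y \<in> S"
        from z(2)[OF decomp[OF this]] z(1) show "B z y = 0"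
          by (simp add: BL S'_def)
      qed
    qed
    then show ?thesis by (simp add: dS)
  qed
qed

lemma alternating_odd_kernel:
  fixes B :: "'e::euclidean_space \<Rightarrow> 'e \<Rightarrow> real"
  assumes "\<And>v. linear (\<lambda>u. B u v)" "\<And>u v. B u v = - B v u" "odd (DIM('e))"
  shows "\<exists>w. w \<noteq> 0 \<and> (\<forall>v. B w v = 0)"
proof (rule ccontr)
  assume "\<not> ?thesis"
  then have "even (dim (UNIV :: 'e set))"
    by (intro nondegenerate_alternating_even_dim[OF assms(1,2)]) auto
  with assms(3) show False by (simp add: dim_UNIV)
qed

section \<open>Derivatives of forms in coordinates\<close>

lemma smooth_on_has_derivative:
  assumes "open S" "smooth_on S g" "x \<in> S"
  shows "(g has_derivative frechet_derivative g (at x)) (at x)"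
  using assms Ck_on_SucD[of 0 S g x] smooth_on_open_iff[OF assms(1)] by blast

text \<open>The chain rule is applied to a local extension \<open>H\<close> of \<open>h\<close>. The
  data \<open>\<tau>\<close> and \<open>L\<close> over \<open>[0,1]\<close> determine the derivative
  of \<open>H\<close> in the time direction and in the space directions.\<close>

lemma smooth_family_derivative_along:
  fixes h :: "real \<times> 'a::euclidean_space \<Rightarrow> real"
  assumes h: "smooth_on ({0..1} \<times> V) h" and V: "open V" and t0: "t0 \<in> {0..1}" and y0: "y t0 \<in> V"
    and y: "(y has_vector_derivative y') (at t0 within {0..1})"
    and \<tau>: "((\<lambda>s. h (s, y t0)) has_real_derivative \<tau>) (at t0 within {0..1})"
    and L: "((\<lambda>x. h (t0, x)) has_derivative L) (at (y t0))"
  shows "((\<lambda>t. h (t, y t)) has_real_derivative \<tau> + L y') (at t0 within {0..1})"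
proof -
  let ?I = "{0..1::real}"
  have "(t0, y t0) \<in> ?I \<times> V" using t0 y0 by simp
  with h obtain U H where U: "open U" "(t0, y t0) \<in> U" "\<forall>k. Ck_on k U H"
    "\<forall>z\<in>U \<inter> ?I \<times> V. H z = h z" by (rule smooth_onE)
  define H' where "H' = frechet_derivative H (at (t0, y t0))"
  have H': "(H has_derivative H') (at (t0, y t0))"
    unfolding H'_def using U(3) by (intro Ck_on_SucD[OF _ U(2)]) blast
  have linH: "linear H'" using H' by (rule has_derivative_linear)
  have eqL: "L k = H' (0, k)" for k
  proof -
    have "((\<lambda>x. (t0, x)) has_derivative (\<lambda>k. (0, k))) (at (y t0))"
      by (auto intro!: derivative_eq_intros)
    from has_derivative_compose[OF this H']
    have "((\<lambda>x. H (t0, x)) has_derivative (\<lambda>k. H' (0, k))) (at (y t0))" .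
    moreover have "open ((\<lambda>x. (t0, x)) -` U \<inter> V)"
      by (intro open_Int V open_vimage U(1) continuous_intros)
    ultimately have "((\<lambda>x. h (t0, x)) has_derivative (\<lambda>k. H' (0, k))) (at (y t0))"
      by (rule has_derivative_transform_within_open) (use U(2,4) t0 y0 in auto)
    from has_derivative_unique[OF L this] show ?thesis by metis
  qed
  have curve: "((\<lambda>t. h (t, z t)) has_vector_derivative H' (1, z')) (at t0 within ?I)"
    if z: "(z has_vector_derivative z') (at t0 within ?I)" "z t0 = y t0" for z z'
  proof -
    have "((\<lambda>t. (t, z t)) has_derivative (\<lambda>k. (k, k *\<^sub>R z'))) (at t0 within ?I)"
      using z(1) unfolding has_vector_derivative_def by (intro has_derivative_Pair
          has_derivative_ident)
    moreover have "(H has_derivative H') (at (t0, z t0))" using H' z(2) by simp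
    ultimately have "((\<lambda>t. H (t, z t)) has_derivative (\<lambda>k. H' (k, k *\<^sub>R z'))) (at t0 within ?I)"
      by (rule has_derivative_compose)
    moreover have "H' (k, k *\<^sub>R z') = k *\<^sub>R H' (1, z')" for k
      using linear_scale[OF linH, of k "(1, z')"] by simp
    ultimately have d: "((\<lambda>t. H (t, z t)) has_vector_derivative H' (1, z')) (at t0 within ?I)"
      by (simp add: has_vector_derivative_def)
    have "continuous (at t0 within ?I) (\<lambda>t. (t, z t))"
      using has_vector_derivative_continuous[OF z(1)] by (intro continuous_intros)
    then have "((\<lambda>t. (t, z t)) \<longlongrightarrow> (t0, z t0)) (at t0 within ?I)" by (simp add: continuous_within)
    moreover have "open (U \<inter> UNIV \<times> V)" using U(1) V by (intro open_Int open_Times) auto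
    moreover have "(t0, z t0) \<in> U \<inter> UNIV \<times> V" using U(2) y0 z(2) by simp
    ultimately have "\<forall>\<^sub>F t in at t0 within ?I. (t, z t) \<in> U \<inter> UNIV \<times> V"
      by (rule topological_tendstoD)
    then obtain e where e: "e > 0" "\<forall>t\<in>?I. t \<noteq> t0 \<and> dist t t0 < e \<longrightarrow> (t, z t) \<in> U \<inter> UNIV \<times> V"
      unfolding eventually_at by blast
    show ?thesis
    proof (rule has_vector_derivative_transform_within[OF d e(1) t0])
      fix t assume t: "t \<in> ?I" "dist t t0 < e"
      have "(t, z t) \<in> U \<inter> ?I \<times> V"
        using e(2) t U(2) y0 z(2) by (cases "t = t0") auto
      then show "H (t, z t) = h (t, z t)" using U(4) by blast
    qed
  qed
  have "((\<lambda>t. h (t, y t0)) has_vector_derivative H' (1, 0)) (at t0 within ?I)"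
    by (rule curve) (auto intro!: derivative_eq_intros)
  moreover have "((\<lambda>t. h (t, y t0)) has_vector_derivative \<tau>) (at t0 within ?I)"
    using \<tau> by (simp add: has_real_derivative_iff_has_vector_derivative)
  \<comment> \<open>At the ends of \<open>[0,1]\<close> only one-sided derivatives are available;
    within a nondegenerate interval they are still unique.\<close>
  ultimately have "H' (1, 0) = \<tau>"
    using vector_derivative_unique_within_closed_interval[of 0 1 t0] t0 by (simp add: cbox_interval)
  moreover have "H' (1, y') = H' (1, 0) + H' (0, y')"
    using linear_add[OF linH, of "(1, 0)" "(0, y')"] by simp
  ultimately show ?thesis
    using curve[OF y] by (simp add: eqL has_real_derivative_iff_has_vector_derivative)
qed

context smooth_mfd
begin

lemma local1_has_derivative:
  assumes "\<alpha> \<in> forms1 A" "c \<in> A" "x \<in> cimg c"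
  shows "(local1 A c \<alpha> w has_derivative frechet_derivative (local1 A c \<alpha> w) (at x)) (at x)"
  by (rule smooth_on_has_derivative[OF chart_open(2)[OF assms(2)] _ assms(3)])
    (use assms(1,2) in \<open>simp add: forms1_def\<close>)

lemma local2_has_derivative:
  assumes "\<omega> \<in> forms2 A" "c \<in> A" "x \<in> cimg c"
  shows "(local2 A c \<omega> u v has_derivative frechet_derivative (local2 A c \<omega> u v) (at x)) (at x)"
  by (rule smooth_on_has_derivative[OF chart_open(2)[OF assms(2)] _ assms(3)])
    (use assms(1,2) in \<open>simp add: forms2_def\<close>)

lemma local1_joint:
  assumes \<alpha>: "\<alpha> \<in> forms1 A" and c: "c \<in> A" and x: "x \<in> cimg c"
  shows "((\<lambda>z. local1 A c \<alpha> (snd z) (fst z)) has_derivative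
    (\<lambda>h. frechet_derivative (local1 A c \<alpha> w) (at x) (fst h) + local1 A c \<alpha> (snd h) x)) (at (x, w))"
  by (rule linear_family_has_derivative[where A = "\<lambda>x w. local1 A c \<alpha> w x" and
        A' = "\<lambda>w. frechet_derivative (local1 A c \<alpha> w) (at x)", OF chart_open(2)[OF c] x])
    (use local1_linear[OF \<alpha> c] local1_has_derivative[OF \<alpha> c x] in auto)

text \<open>The product rule for linear families, applied once for each argument of the
  form.\<close>

lemma local2_joint:
  assumes \<omega>: "\<omega> \<in> forms2 A" and c: "c \<in> A" and x: "x \<in> cimg c"
  shows "((\<lambda>z. local2 A c \<omega> (fst (snd z)) (snd (snd z)) (fst z)) has_derivative
    (\<lambda>h. frechet_derivative (local2 A c \<omega> u v) (at x) (fst h) + local2 A c \<omega> (fst (snd h)) v x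
      + local2 A c \<omega> u (snd (snd h)) x)) (at (x, u, v))"
proof -
  have 1: "((\<lambda>z. local2 A c \<omega> (snd z) v (fst z)) has_derivative
    (\<lambda>h. frechet_derivative (local2 A c \<omega> u v) (at x) (fst h) + local2 A c \<omega> (snd h) v x)) (at (x,
        u))" for v
    by (rule linear_family_has_derivative[where A = "\<lambda>x u. local2 A c \<omega> u v x" and
          A' = "\<lambda>u. frechet_derivative (local2 A c \<omega> u v) (at x)", OF chart_open(2)[OF c] x])
      (use local2_linear_left[OF \<omega> c] local2_has_derivative[OF \<omega> c x] in auto)
  have S: "open (cimg c \<times> (UNIV :: 'e set))" using chart_open(2)[OF c] by (simp add: open_Times)
  have "((\<lambda>q. local2 A c \<omega> (snd (fst q)) (snd q) (fst (fst q))) has_derivative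
    (\<lambda>h. frechet_derivative (local2 A c \<omega> u v) (at x) (fst (fst h)) + local2 A c \<omega> (snd (fst h)) v x
      + local2 A c \<omega> (snd (x, u)) (snd h) (fst (x, u)))) (at ((x, u), v))"
    by (rule linear_family_has_derivative[where A = "\<lambda>z v. local2 A c \<omega> (snd z) v (fst z)" and
          A' = "\<lambda>v h. frechet_derivative (local2 A c \<omega> u v) (at x) (fst h) + local2 A c \<omega> (snd h)
              v x", OF S])
      (use x local2_linear_right[OF \<omega> c] 1 in auto)
  then have 2: "((\<lambda>q. local2 A c \<omega> (snd (fst q)) (snd q) (fst (fst q))) has_derivative
    (\<lambda>h. frechet_derivative (local2 A c \<omega> u v) (at x) (fst (fst h)) + local2 A c \<omega> (snd (fst h)) v x
      + local2 A c \<omega> u (snd h) x)) (at ((fst (x, u, v), fst (snd (x, u, v))), snd (snd (x, u,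
          v))))" by simp
  have "((\<lambda>z::'e \<times> 'e \<times> 'e. ((fst z, fst (snd z)), snd (snd z))) has_derivative
      (\<lambda>z. ((fst z, fst (snd z)), snd (snd z)))) (at (x, u, v))"
    by (auto intro!: derivative_eq_intros)
  from has_derivative_compose[OF this 2] show ?thesis by simp
qed

text \<open>By definition the exterior derivatives are evaluated in the chart
  \<open>chart_at A p\<close>, and the coordinate computations below are made in that same
  chart.\<close>

lemma d1_chart_at:
  assumes "p \<in> cdom c" "c = chart_at A p"
  shows "d1 A \<alpha> p (tvec_of A c p a) (tvec_of A c p b) =
    frechet_derivative (local1 A c \<alpha> b) (at (cmap c p)) a - frechet_derivative (local1 A c \<alpha> a)
        (at (cmap c p)) b"
  using assms chart_at(1)[of p] by (simp add: d1_def tvec_of_tangent Let_def)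

lemma d0_chart_at:
  assumes "p \<in> cdom c" "c = chart_at A p"
  shows "d0 A g p (tvec_of A c p a) = frechet_derivative (g \<circ> cinv c) (at (cmap c p)) a"
  using assms chart_at(1)[of p] by (simp add: d0_def tvec_of_tangent Let_def)

lemma d2_chart_at:
  assumes "p \<in> cdom c" "c = chart_at A p"
  shows "d2 A \<omega> p (tvec_of A c p u) (tvec_of A c p v) (tvec_of A c p w) =
    frechet_derivative (local2 A c \<omega> v w) (at (cmap c p)) u
    - frechet_derivative (local2 A c \<omega> u w) (at (cmap c p)) v
    + frechet_derivative (local2 A c \<omega> u v) (at (cmap c p)) w"
  using assms chart_at(1)[of p] by (simp add: d2_def tvec_of_tangent Let_def)

text \<open>The chain rule relates the coordinate vectors of the image in two target charts, so any
  chart \<open>d\<close> around the image point may be used; the source chart stays the chosen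
  one.\<close>

lemma tangent_map_chart:
  assumes H: "smooth_map A H" and d: "d \<in> A" "H p \<in> cdom d"
  shows "tangent_map A H p v = tvec_of A d (H p)
    (frechet_derivative (cmap d \<circ> H \<circ> cinv (chart_at A p)) (at (cmap (chart_at A p) p)) (v
        (chart_at A p)))"
proof
  fix e
  let ?c = "chart_at A p"
  note c = chart_at[of p]
  show "tangent_map A H p v e = tvec_of A d (H p)
    (frechet_derivative (cmap d \<circ> H \<circ> cinv ?c) (at (cmap ?c p)) (v ?c)) e"
  proof (cases "e \<in> A \<and> H p \<in> cdom e")
    case True
    let ?D = "\<lambda>d. frechet_derivative (cmap d \<circ> H \<circ> cinv ?c) (at (cmap ?c p))"
    have Dd: "((\<lambda>x. cmap d (H (cinv ?c x))) has_derivative ?D d) (at (cmap ?c p))"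
      by (rule smooth_map_chart_derivative[OF H c d])
    have De: "((\<lambda>x. cmap e (H (cinv ?c x))) has_derivative ?D e) (at (cmap ?c p))"
      by (rule smooth_map_chart_derivative[OF H c]) (use True in auto)
    have "((\<lambda>y. cmap e (cinv d y)) has_derivative tr d e (H p)) (at (cmap d (H (cinv ?c (cmap ?c
        p)))))"
      using transition_derivative[of d e "H p"] d True c by simp
    from has_derivative_compose[OF Dd this]
    have "((\<lambda>x. cmap e (cinv d (cmap d (H (cinv ?c x))))) has_derivative
      (\<lambda>w. tr d e (H p) (?D d w))) (at (cmap ?c p))" .
    moreover have "open {x \<in> cimg ?c. cinv ?c x \<in> H -` cdom d}"
      using H by (intro open_cimg_vimage[OF c(1)] open_vimage chart_open(1)[OF d(1)]) (simp add:
          smooth_map_def)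
    ultimately have "((\<lambda>x. cmap e (H (cinv ?c x))) has_derivative
      (\<lambda>w. tr d e (H p) (?D d w))) (at (cmap ?c p))"
      by (rule has_derivative_transform_within_open) (use c d in auto)
    from has_derivative_unique[OF De this] have "?D e (v ?c) = tr d e (H p) (?D d (v ?c))" by metis
    then show ?thesis using True by (simp add: tangent_map_def tvec_of_eq Let_def)
  next
    case False
    show ?thesis unfolding tangent_map_def tvec_of_eq if_not_P[OF False] ..
  qed
qed

end

section \<open>The Moser vector field of a cosymplectic family\<close>

locale cosymplectic_family = smooth_mfd A
  for A :: "('m::t2_space, 'e::euclidean_space) chart set" +
  fixes \<omega> :: "real \<Rightarrow> ('m, 'e) form2" and \<eta> :: "real \<Rightarrow> ('m, 'e) form1"
    and \<alpha> :: "real \<Rightarrow> ('m, 'e) form1" and f :: "real \<Rightarrow> 'm \<Rightarrow> real"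
  assumes odd_dim: "odd (DIM('e))"
    and compact_M: "compact (UNIV :: 'm set)"
    and fam_\<eta>: "smooth_family1 A \<eta>" and fam_\<omega>: "smooth_family2 A \<omega>"
    and cosym: "t \<in> {0..1} \<Longrightarrow> cosymplectic A (\<omega> t) (\<eta> t)"
    and fam_\<alpha>: "smooth_family1 A \<alpha>" and fam_f: "smooth_family0 A f"
    and dt_\<omega>: "time_derivative2 \<omega> (\<lambda>t. d1 A (\<alpha> t))"
    and dt_\<eta>: "time_derivative1 \<eta> (\<lambda>t. d0 A (f t))"
    and d_\<alpha>\<xi>: "t \<in> {0..1} \<Longrightarrow>
      d0 A (\<lambda>p. \<alpha> t p (reeb A (\<omega> t) (\<eta> t) p)) = (\<lambda>p v. 0)"
begin

lemma forms: "t \<in> {0..1} \<Longrightarrow> \<omega> t \<in> forms2 A" "t \<in> {0..1} \<Longrightarrow> \<eta> t \<in> forms1 A"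
  "t \<in> {0..1} \<Longrightarrow> \<alpha> t \<in> forms1 A"
  using fam_\<omega> fam_\<eta> fam_\<alpha> by (auto simp: smooth_family1_def smooth_family2_def)

lemma closed: "t \<in> {0..1} \<Longrightarrow> d2 A (\<omega> t) = (\<lambda>p u v w. 0)" "t \<in> {0..1} \<Longrightarrow> d1 A (\<eta> t) = (\<lambda>p u v. 0)"
  using cosym by (auto simp: cosymplectic_def closed2_def closed1_def)

lemma flat_bij: "t \<in> {0..1} \<Longrightarrow>
    bij_betw (flat (\<eta> t) (\<omega> t) p) (tangent_space A p) (cotangent_space A p)"
  using cosym by (auto simp: cosymplectic_def)

section \<open>Inverting the flat map in coordinates\<close>

definition flat_inverse :: "(real \<Rightarrow> ('m, 'e) form1) \<Rightarrow> real \<Rightarrow> 'm \<Rightarrow> ('m, 'e) tvec" where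
  "flat_inverse \<beta> t p = inv_into (tangent_space A p) (flat (\<eta> t) (\<omega> t) p) (\<beta> t p)"

lemma flat_inverse:
  assumes "t \<in> {0..1}" "\<beta> t p \<in> cotangent_space A p"
  shows "flat_inverse \<beta> t p \<in> tangent_space A p" "flat (\<eta> t) (\<omega> t) p (flat_inverse \<beta> t p) = \<beta> t p"
proof -
  have "\<beta> t p \<in> flat (\<eta> t) (\<omega> t) p ` tangent_space A p"
    using flat_bij[OF assms(1), of p] assms(2) by (simp add: bij_betw_def)
  then show "flat_inverse \<beta> t p \<in> tangent_space A p" "flat (\<eta> t) (\<omega> t) p (flat_inverse \<beta> t p) = \<beta>
      t p"
    unfolding flat_inverse_def by (rule inv_into_into, rule f_inv_into_f)
qed

text \<open>The coordinate matrix of \<open>flat\<close>, with covectors identified with vectors by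
  the inner product of the model space. Source and target then agree, as
  \<open>smooth_on_linear_solve\<close> requires.\<close>

definition flat_coord :: "('m, 'e) chart \<Rightarrow> real \<times> 'e \<Rightarrow> 'e \<Rightarrow> 'e" where
  "flat_coord c z Y = (\<Sum>b\<in>Basis. (local2 A c (\<omega> (fst z)) Y b (snd z)
     + local1 A c (\<eta> (fst z)) Y (snd z) * local1 A c (\<eta> (fst z)) b (snd z)) *\<^sub>R b)"

lemma flat_chart:
  assumes "c \<in> A" "x \<in> cimg c"
  shows "flat (\<eta> t) (\<omega> t) (cinv c x) (tvec_of A c (cinv c x) Y) (tvec_of A c (cinv c x) b)
    = local2 A c (\<omega> t) Y b x + local1 A c (\<eta> t) Y x * local1 A c (\<eta> t) b x"
  by (simp add: flat_def local1_def local2_def)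

lemma flat_coord_linear:
  assumes "c \<in> A" "z \<in> {0..1} \<times> cimg c"
  shows "linear (flat_coord c z)"
proof -
  have z: "fst z \<in> {0..1}" "snd z \<in> cimg c" using assms(2) by auto
  note 1 = local1_linear[OF forms(2)[OF z(1)] assms(1) z(2)]
  note 2 = local2_linear_left[OF forms(1)[OF z(1)] assms(1) z(2)]
  show ?thesis
    unfolding flat_coord_def
    by (rule linearI) (simp_all add: linear_add[OF 1] linear_add[OF 2] linear_scale[OF 1]
        linear_scale[OF 2]
        algebra_simps sum.distrib scaleR_sum_right)
qed

text \<open>A kernel vector gives a covector that vanishes on a basis, hence on all tangent vectors,
  and by convention elsewhere. Injectivity of \<open>flat\<close> then applies.\<close>

lemma flat_coord_inj:
  assumes c: "c \<in> A" and z: "z \<in> {0..1} \<times> cimg c"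
  shows "inj (flat_coord c z)"
proof -
  let ?t = "fst z" and ?x = "snd z"
  let ?p = "cinv c ?x"
  have t: "?t \<in> {0..1}" and x: "?x \<in> cimg c" using z by auto
  have p: "?p \<in> cdom c" using x by simp
  have "Y = 0" if Y: "flat_coord c z Y = 0" for Y
  proof -
    let ?l = "flat (\<eta> ?t) (\<omega> ?t) ?p (tvec_of A c ?p Y)"
    have tv: "tvec_of A c ?p Y \<in> tangent_space A ?p" "tvec_of A c ?p 0 \<in> tangent_space A ?p"
      using tvec_of_tangent[OF c p] by blast+
    have "?l \<in> cotangent_space A ?p" "flat (\<eta> ?t) (\<omega> ?t) ?p (tvec_of A c ?p 0) \<in> cotangent_space A
        ?p"
      using flat_bij[OF t, of ?p] tv by (auto simp: bij_betw_def)
    then have cot: "linear (\<lambda>w. ?l (tvec_of A c ?p w))" "\<And>v. v \<notin> tangent_space A ?p \<Longrightarrow> ?l v = 0"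
      using covector_linear[OF _ c p] by (auto simp: cotangent_space_def)
    have lb: "?l (tvec_of A c ?p b) = 0" if "b \<in> Basis" for b
    proof -
      have "flat_coord c z Y \<bullet> b = ?l (tvec_of A c ?p b)"
        using that by (simp add: flat_coord_def flat_chart[OF c x] inner_sum_left inner_Basis
            if_distrib cong: if_cong)
      then show ?thesis using Y by simp
    qed
    have l0: "?l v = 0" for v
    proof (cases "v \<in> tangent_space A ?p")
      case True
      have "?l (tvec_of A c ?p (v c)) = (\<Sum>b\<in>Basis. (v c \<bullet> b) *\<^sub>R ?l (tvec_of A c ?p b))"
        by (rule linear_expand_Basis[OF cot(1)])
      also have "\<dots> = 0" using lb by simp
      finally show ?thesis using tvec_of_comp[OF True c p] by simp
    qed (rule cot(2))
    \<comment> \<open>Injectivity of \<open>flat\<close> on the tangent space is not stated through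
      kernels; \<open>Y\<close> is compared with the zero tangent vector, whose image vanishes
      too.\<close>
    have "flat (\<eta> ?t) (\<omega> ?t) ?p (tvec_of A c ?p 0) = ?l"
    proof
      fix v
      have "flat (\<eta> ?t) (\<omega> ?t) ?p (tvec_of A c ?p 0) v = 0"
      proof (cases "v \<in> tangent_space A ?p")
        case True
        have "local2 A c (\<omega> ?t) 0 (v c) ?x = 0" "local1 A c (\<eta> ?t) 0 ?x = 0"
          using linear_0[OF local2_linear_left[OF forms(1)[OF t] c x]]
            linear_0[OF local1_linear[OF forms(2)[OF t] c x]] by auto
        then show ?thesis
          using flat_chart[OF c x, of ?t 0 "v c"] tvec_of_comp[OF True c p] by simp
      next
        case False
        then show ?thesis
          using \<open>flat (\<eta> ?t) (\<omega> ?t) ?p (tvec_of A c ?p 0) \<in> cotangent_space A ?p\<close>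
          by (simp add: cotangent_space_def)
      qed
      then show "flat (\<eta> ?t) (\<omega> ?t) ?p (tvec_of A c ?p 0) v = ?l v" using l0 by simp
    qed
    then have "tvec_of A c ?p 0 = tvec_of A c ?p Y"
      using flat_bij[OF t, of ?p] tv by (auto simp: bij_betw_def inj_on_def)
    then have "tvec_of A c ?p 0 c = tvec_of A c ?p Y c" by simp
    then show ?thesis using c p by simp
  qed
  then show ?thesis using linear_injective_0[OF flat_coord_linear[OF c z]] by blast
qed

text \<open>In a chart the pointwise inverse solves a linear system with the smooth injective matrix
  \<open>flat_coord\<close>.\<close>

lemma flat_inverse_smooth:
  assumes \<beta>: "\<And>t p. t \<in> {0..1} \<Longrightarrow> \<beta> t p \<in> cotangent_space A p"
    and sm: "\<And>b. smooth_on ({0..1} \<times> cimg c) (\<lambda>(t, x). local1 A c (\<beta> t) b x)" and c: "c \<in> A"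
  shows "smooth_on ({0..1} \<times> cimg c) (\<lambda>(t, x). flat_inverse \<beta> t (cinv c x) c)"
proof (rule smooth_on_linear_solve)
  let ?S = "{0..1::real} \<times> cimg c"
  show "linear (flat_coord c z)" "inj (flat_coord c z)" if "z \<in> ?S" for z
    using flat_coord_linear[OF c that] flat_coord_inj[OF c that] by auto
  have 1: "smooth_on ?S (\<lambda>z. local1 A c (\<eta> (fst z)) w (snd z))" for w
    using fam_\<eta> c by (simp add: smooth_family1_def case_prod_unfold)
  have 2: "smooth_on ?S (\<lambda>z. local2 A c (\<omega> (fst z)) u w (snd z))" for u w
    using fam_\<omega> c by (simp add: smooth_family2_def case_prod_unfold)
  show "smooth_on ?S (\<lambda>z. flat_coord c z b)" for b
    unfolding flat_coord_def
    by (intro smooth_on_sum smooth_on_bilinear[OF bounded_bilinear_scaleR] smooth_on_add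
        smooth_on_bilinear[OF bounded_bilinear_mult] 1 2 smooth_on_const)
  show "smooth_on ?S (\<lambda>z. \<Sum>b\<in>Basis. local1 A c (\<beta> (fst z)) b (snd z) *\<^sub>R b)"
    using sm by (intro smooth_on_sum smooth_on_bilinear[OF bounded_bilinear_scaleR] smooth_on_const)
      (simp add: case_prod_unfold)
  show "flat_coord c z (case z of (t, x) \<Rightarrow> flat_inverse \<beta> t (cinv c x) c) = (\<Sum>b\<in>Basis. local1 A c
      (\<beta> (fst z)) b (snd z) *\<^sub>R b)"
    if z: "z \<in> ?S" for z
  proof -
    let ?t = "fst z" and ?x = "snd z"
    have t: "?t \<in> {0..1}" and x: "?x \<in> cimg c" using z by auto
    let ?Z = "flat_inverse \<beta> ?t (cinv c ?x)"
    note s = flat_inverse[of ?t \<beta> "cinv c ?x", OF t \<beta>[OF t]]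
    have Z: "tvec_of A c (cinv c ?x) (?Z c) = ?Z"
      by (rule tvec_of_comp[OF s(1) c cinv_in[OF x]])
    have "local2 A c (\<omega> ?t) (?Z c) b ?x + local1 A c (\<eta> ?t) (?Z c) ?x * local1 A c (\<eta> ?t) b ?x
      = local1 A c (\<beta> ?t) b ?x" for b
      using flat_chart[OF c x, of ?t "?Z c" b] s(2) by (simp add: Z local1_def)
    then show ?thesis by (simp add: flat_coord_def case_prod_unfold)
  qed
qed

section \<open>The Reeb field\<close>

abbreviation \<xi> :: "real \<Rightarrow> 'm \<Rightarrow> ('m, 'e) tvec" where "\<xi> \<equiv> flat_inverse \<eta>"

lemma \<eta>_cot: "t \<in> {0..1} \<Longrightarrow> \<eta> t p \<in> cotangent_space A p"
  using forms(2) by (auto simp: forms1_def)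

lemma \<xi>: "t \<in> {0..1} \<Longrightarrow> \<xi> t p \<in> tangent_space A p"
  "t \<in> {0..1} \<Longrightarrow> flat (\<eta> t) (\<omega> t) p (\<xi> t p) = \<eta> t p"
  using flat_inverse[of t \<eta> p] \<eta>_cot by auto

lemma \<xi>_smooth: "c \<in> A \<Longrightarrow> smooth_on ({0..1} \<times> cimg c) (\<lambda>(t, x). \<xi> t (cinv c x) c)"
  by (rule flat_inverse_smooth[OF \<eta>_cot]) (use fam_\<eta> in \<open>auto simp: smooth_family1_def\<close>)

text \<open>\<open>reeb\<close> inverts \<open>Itilde\<close> on smooth vector fields,
  \<open>\<xi>\<close> inverts \<open>flat\<close> at each point. They coincide because the
  pointwise inverse is itself smooth.\<close>

lemma reeb_eq:
  assumes t: "t \<in> {0..1}"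
  shows "reeb A (\<omega> t) (\<eta> t) = \<xi> t"
  unfolding reeb_def
proof (rule the_inv_into_f_eq)
  show "inj_on (Itilde (\<eta> t) (\<omega> t)) (vector_fields A)"
  proof (rule inj_onI, rule ext)
    fix X Y p assume "X \<in> vector_fields A" "Y \<in> vector_fields A"
      and eq: "Itilde (\<eta> t) (\<omega> t) X = Itilde (\<eta> t) (\<omega> t) Y"
    then have "X p \<in> tangent_space A p" "Y p \<in> tangent_space A p" by (auto simp: vector_fields_def)
    moreover have "flat (\<eta> t) (\<omega> t) p (X p) = flat (\<eta> t) (\<omega> t) p (Y p)"
      using fun_cong[OF eq, of p] by (simp add: Itilde_def)
    ultimately show "X p = Y p" using flat_bij[OF t, of p] by (auto simp: bij_betw_def inj_on_def)
  qed
  show "Itilde (\<eta> t) (\<omega> t) (\<xi> t) = \<eta> t"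
    using \<xi>(2)[OF t] by (auto simp: Itilde_def)
  show "\<xi> t \<in> vector_fields A"
    unfolding vector_fields_def
  proof (intro CollectI conjI allI ballI)
    show "\<xi> t p \<in> tangent_space A p" for p by (rule \<xi>(1)[OF t])
    fix c assume c: "c \<in> A"
    have 1: "smooth_on (cimg c) (\<lambda>x. (t, x))"
      by (intro smooth_on_Pair smooth_on_const smooth_on_bounded_linear bounded_linear_ident)
    have "(\<lambda>x. (t, x)) ` cimg c \<subseteq> {0..1} \<times> cimg c" using t by auto
    from smooth_on_compose[OF 1 \<xi>_smooth[OF c] this]
    show "smooth_on (cimg c) (\<lambda>x. \<xi> t (cinv c x) c)" by simp
  qed
qed

section \<open>The Moser field\<close>

definition g :: "real \<Rightarrow> 'm \<Rightarrow> real" where "g t p = \<alpha> t p (\<xi> t p)"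

lemma g_smooth:
  assumes c: "c \<in> A"
  shows "smooth_on ({0..1} \<times> cimg c) (\<lambda>z::real \<times> 'e. g (fst z) (cinv c (snd z)))"
proof -
  let ?S = "{0..1::real} \<times> cimg c"
  have 1: "smooth_on ?S (\<lambda>z::real \<times> 'e. local1 A c (\<alpha> (fst z)) b (snd z))" for b
    using fam_\<alpha> c by (simp add: smooth_family1_def case_prod_unfold)
  have 2: "smooth_on ?S (\<lambda>z. \<xi> (fst z) (cinv c (snd z)) c)"
    using \<xi>_smooth[OF c] by (simp add: case_prod_unfold)
  have 3: "smooth_on ?S (\<lambda>z. \<xi> (fst z) (cinv c (snd z)) c \<bullet> b)" for b
    by (rule smooth_on_bilinear[OF bounded_bilinear_inner 2 smooth_on_const])
  have 4: "smooth_on ?S (\<lambda>z. \<Sum>b\<in>Basis. (\<xi> (fst z) (cinv c (snd z)) c \<bullet> b) * local1 A c (\<alpha> (fst z))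
      b (snd z))"
    by (rule smooth_on_sum, rule smooth_on_bilinear[OF bounded_bilinear_mult 3 1])
  show ?thesis
  proof (rule smooth_on_cong[OF 4])
    fix z assume "z \<in> ?S"
    then have t: "fst z \<in> {0..1}" and x: "snd z \<in> cimg c" by auto
    have "g (fst z) (cinv c (snd z)) = local1 A c (\<alpha> (fst z)) (\<xi> (fst z) (cinv c (snd z)) c) (snd
        z)"
      using tvec_of_comp[OF \<xi>(1)[OF t] c cinv_in[OF x]] by (simp add: g_def local1_def)
    also have "\<dots> = (\<Sum>b\<in>Basis. (\<xi> (fst z) (cinv c (snd z)) c \<bullet> b) *\<^sub>R local1 A c (\<alpha> (fst z)) b (snd
        z))"
      by (rule linear_expand_Basis[OF local1_linear[OF forms(3)[OF t] c x]])
    finally show "(\<Sum>b\<in>Basis. (\<xi> (fst z) (cinv c (snd z)) c \<bullet> b) * local1 A c (\<alpha> (fst z)) b (snd z))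
        = g (fst z) (cinv c (snd z))" by simp
  qed
qed

definition \<beta> :: "real \<Rightarrow> ('m, 'e) form1" where
  "\<beta> t p v = - \<alpha> t p v + (g t p - f t p) * \<eta> t p v"

abbreviation X :: "real \<Rightarrow> 'm \<Rightarrow> ('m, 'e) tvec" where "X \<equiv> flat_inverse \<beta>"

lemma \<beta>_cot:
  assumes "t \<in> {0..1}"
  shows "\<beta> t p \<in> cotangent_space A p"
proof -
  have "\<alpha> t p \<in> cotangent_space A p" "\<eta> t p \<in> cotangent_space A p"
    using forms(2,3)[OF assms] by (auto simp: forms1_def)
  then show ?thesis
    unfolding cotangent_space_def \<beta>_def by (auto simp: algebra_simps)
qed

lemma X_tangent: "t \<in> {0..1} \<Longrightarrow> X t p \<in> tangent_space A p"
  and X_flat: "t \<in> {0..1} \<Longrightarrow> flat (\<eta> t) (\<omega> t) p (X t p) = \<beta> t p"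
  using flat_inverse[of t \<beta> p] \<beta>_cot by auto

lemma X_smooth:
  assumes c: "c \<in> A"
  shows "smooth_on ({0..1} \<times> cimg c) (\<lambda>(t, x). X t (cinv c x) c)"
proof (rule flat_inverse_smooth[OF \<beta>_cot _ c])
  fix b
  let ?S = "{0..1::real} \<times> cimg c"
  have 1: "smooth_on ?S (\<lambda>z. local1 A c (\<alpha> (fst z)) b (snd z))" "smooth_on ?S (\<lambda>z. local1 A c (\<eta>
      (fst z)) b (snd z))"
    "smooth_on ?S (\<lambda>z. f (fst z) (cinv c (snd z)))"
    using fam_\<alpha> fam_\<eta> fam_f c by (simp_all add: smooth_family1_def smooth_family0_def
        case_prod_unfold)
  have "smooth_on ?S (\<lambda>z. (g (fst z) (cinv c (snd z)) - f (fst z) (cinv c (snd z)))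
      * local1 A c (\<eta> (fst z)) b (snd z) - local1 A c (\<alpha> (fst z)) b (snd z))"
    by (intro smooth_on_minus smooth_on_bilinear[OF bounded_bilinear_mult] g_smooth[OF c] 1)
  then show "smooth_on ?S (\<lambda>(t, x). local1 A c (\<beta> t) b x)"
    by (simp add: case_prod_unfold local1_def \<beta>_def)
qed

sublocale time_field A X
  by unfold_locales (use compact_M X_tangent X_smooth in auto)

text \<open>Here the odd dimension enters: it provides a kernel vector of \<open>\<omega>\<close>, which has to be a
  multiple of the Reeb vector.\<close>

lemma reeb_coordinates:
  assumes t: "t \<in> {0..1}" and c: "c \<in> A" and x: "x \<in> cimg c"
  defines "R \<equiv> \<xi> t (cinv c x) c"
  shows "local1 A c (\<eta> t) R x = 1" and "local2 A c (\<omega> t) R v x = 0"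
proof -
  let ?O = "\<lambda>u v. local2 A c (\<omega> t) u v x" and ?E = "\<lambda>u. local1 A c (\<eta> t) u x"
  have z: "(t, x) \<in> {0..1} \<times> cimg c" using t x by simp
  note linE = local1_linear[OF forms(2)[OF t] c x]
  note linO = local2_linear_left[OF forms(1)[OF t] c x]
  have "\<exists>w. w \<noteq> 0 \<and> (\<forall>v. ?O w v = 0)"
    by (rule alternating_odd_kernel[OF linO local2_alt[OF forms(1)[OF t]] odd_dim])
  then obtain w where w: "w \<noteq> 0" "\<And>v. ?O w v = 0" by blast
  have M: "flat_coord c (t, x) Y = (\<Sum>b\<in>Basis. (?O Y b + ?E Y * ?E b) *\<^sub>R b)" for Y by (simp add:
      flat_coord_def)
  \<comment> \<open>A kernel vector of the 2-form on which \<open>\<eta>\<close> vanishes would lie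
    in the kernel of \<open>flat\<close>.\<close>
  have "?E w \<noteq> 0"
  proof
    assume "?E w = 0"
    then have "flat_coord c (t, x) w = 0" by (simp add: M w(2))
    then show False using w(1) flat_coord_inj[OF c z] linear_injective_0[OF flat_coord_linear[OF c
        z]] by blast
  qed
  define r where "r = (1 / ?E w) *\<^sub>R w"
  have r: "?E r = 1" "\<And>v. ?O r v = 0"
    using \<open>?E w \<noteq> 0\<close> w(2) by (simp_all add: r_def linear_scale[OF linE] linear_scale[OF linO])
  have R: "?O R b + ?E R * ?E b = ?E b" for b
    using flat_chart[OF c x, of t R b] \<xi>(2)[OF t, of "cinv c x"]
      tvec_of_comp[OF \<xi>(1)[OF t] c cinv_in[OF x]] by (simp add: R_def local1_def)
  \<comment> \<open>Both \<open>R\<close> and the normalized kernel vector \<open>r\<close> are sent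
    to \<open>\<eta>\<close>.\<close>
  have "flat_coord c (t, x) R = flat_coord c (t, x) r" unfolding M using R r by simp
  then have "R = r" using flat_coord_inj[OF c z] by (simp add: inj_eq)
  with r show "?E R = 1" "?O R v = 0" by auto
qed

lemma X_coordinates:
  assumes t: "t \<in> {0..1}" and c: "c \<in> A" and x: "x \<in> cimg c"
  defines "Y \<equiv> X t (cinv c x) c"
  shows "local1 A c (\<eta> t) Y x = - f t (cinv c x)"
    and "local2 A c (\<omega> t) Y v x = - local1 A c (\<alpha> t) v x + g t (cinv c x) * local1 A c (\<eta> t) v x"
proof -
  let ?O = "\<lambda>u v. local2 A c (\<omega> t) u v x" and ?E = "\<lambda>u. local1 A c (\<eta> t) u x"
  let ?R = "\<xi> t (cinv c x) c" and ?p = "cinv c x"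
  have Y: "?O Y b + ?E Y * ?E b = - local1 A c (\<alpha> t) b x + (g t ?p - f t ?p) * ?E b" for b
    using flat_chart[OF c x, of t Y b] X_flat[OF t, of ?p]
      tvec_of_comp[OF X_tangent[OF t] c cinv_in[OF x]] by (simp add: Y_def local1_def \<beta>_def)
  have "local1 A c (\<alpha> t) ?R x = g t ?p"
    using tvec_of_comp[OF \<xi>(1)[OF t] c cinv_in[OF x]] by (simp add: g_def local1_def)
  moreover have "?O Y ?R = 0"
    using local2_alt[OF forms(1)[OF t], of c Y ?R x] reeb_coordinates(2)[OF t c x] by simp
  ultimately show E: "?E Y = - f t ?p"
    using Y[of ?R] reeb_coordinates(1)[OF t c x] by simp
  show "?O Y v = - local1 A c (\<alpha> t) v x + g t ?p * ?E v"
    using Y[of v] by (simp add: E algebra_simps)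
qed

end

section \<open>Invariance of the structure along the flow\<close>

lemma slice_derivative:
  assumes "smooth_on ({0..1} \<times> S) h" "open S" "t \<in> {0..1}" "x \<in> S"
  shows "((\<lambda>y. h (t, y)) has_derivative frechet_derivative (\<lambda>y. h (t, y)) (at x)) (at x)"
proof -
  have 1: "smooth_on S (\<lambda>y. (t, y))"
    by (intro smooth_on_Pair smooth_on_const smooth_on_bounded_linear bounded_linear_ident)
  have "(\<lambda>y. (t, y)) ` S \<subseteq> {0..1} \<times> S" using assms(3) by auto
  from smooth_on_has_derivative[OF assms(2) smooth_on_compose[OF 1 assms(1) this] assms(4)]
  show ?thesis .
qed

lemma zero_derivative_const:
  fixes H :: "real \<Rightarrow> real"
  assumes "\<And>t. t \<in> {0..1} \<Longrightarrow> (H has_real_derivative 0) (at t within {0..1})" "t \<in> {0..1}"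
  shows "H t = H 0"
proof -
  have "\<exists>k. \<forall>x\<in>{0..1}. H x = k"
    by (rule has_field_derivative_zero_constant[OF _ assms(1)]) auto
  then show ?thesis using assms(2) by force
qed

context cosymplectic_family
begin

text \<open>The brackets are the coordinate expressions of the Lie derivatives along
  \<open>X\<close>: a derivative of the coefficients along the field, plus terms with the derivative
  \<open>Y'\<close> of the field. Both identities come from differentiating the equations in
  \<open>X_coordinates\<close>.\<close>

lemma moser_identities:
  assumes t: "t \<in> {0..1}" and d: "d = chart_at A q"
    and Y': "((\<lambda>y. X t (cinv d y) d) has_derivative Y') (at (cmap d q))"
  shows "d1 A (\<alpha> t) q (tvec_of A d q a) (tvec_of A d q b)
      + (frechet_derivative (local2 A d (\<omega> t) a b) (at (cmap d q)) (X t q d)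
        + local2 A d (\<omega> t) (Y' a) b (cmap d q) + local2 A d (\<omega> t) a (Y' b) (cmap d q)) = 0"
    and "d0 A (f t) q (tvec_of A d q a)
      + (frechet_derivative (local1 A d (\<eta> t) a) (at (cmap d q)) (X t q d)
        + local1 A d (\<eta> t) (Y' a) (cmap d q)) = 0"
proof -
  let ?x = "cmap d q" and ?X = "X t q d"
  have dA: "d \<in> A" and qd: "q \<in> cdom d" using chart_at[of q] by (simp_all add: d)
  have x: "?x \<in> cimg d" using qd by simp
  have cq: "cinv d ?x = q" using dA qd by simp
  note S = chart_open(2)[OF dA]
  define DO where "DO u v w = frechet_derivative (local2 A d (\<omega> t) u v) (at ?x) w" for u v w
  define D\<alpha> where "D\<alpha> u w = frechet_derivative (local1 A d (\<alpha> t) u) (at ?x) w" for u w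
  define DE where "DE u w = frechet_derivative (local1 A d (\<eta> t) u) (at ?x) w" for u w
  let ?O = "\<lambda>u v. local2 A d (\<omega> t) u v ?x" and ?E = "\<lambda>u. local1 A d (\<eta> t) u ?x"
  have closed_\<omega>: "DO v w u - DO u w v + DO u v w = 0" for u v w
    using d2_chart_at[OF qd d, of "\<omega> t" u v w] closed(1)[OF t] by (simp add: DO_def)
  have closed_\<eta>: "DE v u = DE u v" for u v
    using d1_chart_at[OF qd d, of "\<eta> t" u v] closed(2)[OF t] by (simp add: DE_def)
  \<comment> \<open>This is assumption (iii): with \<open>reeb\<close> identified as
    \<open>\<xi>\<close>, it says that \<open>g t\<close> has zero differential.\<close>
  have g': "((\<lambda>y. g t (cinv d y)) has_derivative (\<lambda>h. 0)) (at ?x)"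
  proof -
    have "((\<lambda>y. g t (cinv d y)) has_derivative frechet_derivative (\<lambda>y. g t (cinv d y)) (at ?x))
        (at ?x)"
      using slice_derivative[OF g_smooth[OF dA] S t x] by simp
    moreover have "frechet_derivative (\<lambda>y. g t (cinv d y)) (at ?x) = (\<lambda>h. 0)"
    proof
      show "frechet_derivative (\<lambda>y. g t (cinv d y)) (at ?x) h = 0" for h
        using d0_chart_at[OF qd d, of "g t" h] d_\<alpha>\<xi>[OF t] reeb_eq[OF t]
        by (simp add: g_def[abs_def] o_def)
    qed
    ultimately show ?thesis by simp
  qed
  \<comment> \<open>The contraction of \<open>X\<close> into the 2-form, evaluated on the constant
    vector \<open>b\<close>, is differentiated in the direction \<open>a\<close>. The derivative of
    \<open>g\<close> drops out by \<open>g'\<close>.\<close>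
  have K: "DO ?X b a + ?O (Y' a) b = - D\<alpha> b a + g t q * DE b a" for a b
  proof -
    have "((\<lambda>y. (y, X t (cinv d y) d, b)) has_derivative (\<lambda>h. (h, Y' h, 0))) (at ?x)"
      by (intro has_derivative_Pair has_derivative_ident Y' has_derivative_const)
    moreover have "((\<lambda>z. local2 A d (\<omega> t) (fst (snd z)) (snd (snd z)) (fst z)) has_derivative
      (\<lambda>h. DO ?X b (fst h) + ?O (fst (snd h)) b + ?O ?X (snd (snd h)))) (at (?x, X t (cinv d ?x)
          d, b))"
      using local2_joint[OF forms(1)[OF t] dA x, of ?X b] by (simp add: cq DO_def)
    ultimately have "((\<lambda>y. local2 A d (\<omega> t) (fst (snd (y, X t (cinv d y) d, b)))
        (snd (snd (y, X t (cinv d y) d, b))) (fst (y, X t (cinv d y) d, b))) has_derivative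
      (\<lambda>h. DO ?X b (fst (h, Y' h, 0::'e)) + ?O (fst (snd (h, Y' h, 0::'e))) b
        + ?O ?X (snd (snd (h, Y' h, 0::'e))))) (at ?x)"
      by (rule has_derivative_compose)
    then have 1: "((\<lambda>y. local2 A d (\<omega> t) (X t (cinv d y) d) b y) has_derivative
        (\<lambda>h. DO ?X b h + ?O (Y' h) b)) (at ?x)"
      using linear_0[OF local2_linear_right[OF forms(1)[OF t] dA x]] by simp
    have "((\<lambda>y. - local1 A d (\<alpha> t) b y + g t (cinv d y) * local1 A d (\<eta> t) b y) has_derivative
        (\<lambda>h. - D\<alpha> b h + (g t (cinv d ?x) * DE b h + 0 * local1 A d (\<eta> t) b ?x))) (at ?x)"
      unfolding D\<alpha>_def DE_def
      by (intro has_derivative_add has_derivative_minus has_derivative_mult g'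
          local1_has_derivative[OF forms(3)[OF t] dA x] local1_has_derivative[OF forms(2)[OF t] dA
              x])
    then have "((\<lambda>y. - local1 A d (\<alpha> t) b y + g t (cinv d y) * local1 A d (\<eta> t) b y) has_derivative
        (\<lambda>h. - D\<alpha> b h + g t q * DE b h)) (at ?x)" by (simp add: cq)
    then have 2: "((\<lambda>y. local2 A d (\<omega> t) (X t (cinv d y) d) b y) has_derivative
        (\<lambda>h. - D\<alpha> b h + g t q * DE b h)) (at ?x)"
      by (rule has_derivative_transform_within_open[OF _ S x]) (simp add: X_coordinates(2)[OF t dA])
    from has_derivative_unique[OF 1 2] show ?thesis by metis
  qed
  have "d1 A (\<alpha> t) q (tvec_of A d q a) (tvec_of A d q b) = D\<alpha> b a - D\<alpha> a b"
    using d1_chart_at[OF qd d] by (simp add: D\<alpha>_def)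
  moreover have "?O a (Y' b) = - ?O (Y' b) a" by (rule local2_alt[OF forms(1)[OF t]])
  moreover have "g t q * DE b a = g t q * DE a b" by (simp add: closed_\<eta>)
  \<comment> \<open>Antisymmetrizing \<open>K\<close> in \<open>a\<close> and \<open>b\<close>
    produces the exterior derivative of \<open>\<alpha>\<close>. The terms with \<open>g\<close>
    cancel because \<open>\<eta>\<close> is closed, and closedness of \<open>\<omega>\<close>
    relates its three derivatives.\<close>
  ultimately show "d1 A (\<alpha> t) q (tvec_of A d q a) (tvec_of A d q b)
      + (frechet_derivative (local2 A d (\<omega> t) a b) (at ?x) ?X + ?O (Y' a) b + ?O a (Y' b)) = 0"
    using K[of b a] K[of a b] closed_\<omega>[of a b ?X] unfolding DO_def[symmetric] by linarith
  have f': "((\<lambda>y. f t (cinv d y)) has_derivative frechet_derivative (\<lambda>y. f t (cinv d y)) (at ?x))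
      (at ?x)"
    using slice_derivative[OF _ S t x, of "\<lambda>(t, x). f t (cinv d x)"] fam_f dA
    by (simp add: smooth_family0_def)
  have "((\<lambda>y. (y, X t (cinv d y) d)) has_derivative (\<lambda>h. (h, Y' h))) (at ?x)"
    by (intro has_derivative_Pair has_derivative_ident Y')
  moreover have "((\<lambda>z. local1 A d (\<eta> t) (snd z) (fst z)) has_derivative
      (\<lambda>h. DE ?X (fst h) + ?E (snd h))) (at (?x, X t (cinv d ?x) d))"
    using local1_joint[OF forms(2)[OF t] dA x, of ?X] by (simp add: cq DE_def)
  ultimately have "((\<lambda>y. local1 A d (\<eta> t) (snd (y, X t (cinv d y) d)) (fst (y, X t (cinv d y) d)))
      has_derivative
      (\<lambda>h. DE ?X (fst (h, Y' h)) + ?E (snd (h, Y' h)))) (at ?x)"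
    by (rule has_derivative_compose)
  then have 1: "((\<lambda>y. local1 A d (\<eta> t) (X t (cinv d y) d) y) has_derivative
      (\<lambda>h. DE ?X h + ?E (Y' h))) (at ?x)" by simp
  \<comment> \<open>The same function seen through \<open>X_coordinates\<close>, where
    \<open>\<eta>\<close> takes the value \<open>- f t\<close> on \<open>X\<close>. Comparing the
    two derivatives and using the symmetry \<open>closed_\<eta>\<close> gives the second
    identity.\<close>
  have 2: "((\<lambda>y. local1 A d (\<eta> t) (X t (cinv d y) d) y) has_derivative
      (\<lambda>h. - frechet_derivative (\<lambda>y. f t (cinv d y)) (at ?x) h)) (at ?x)"
    by (rule has_derivative_transform_within_open[OF has_derivative_minus[OF f'] S x])
      (simp add: X_coordinates(1)[OF t dA])
  have "DE ?X a + ?E (Y' a) = - frechet_derivative (\<lambda>y. f t (cinv d y)) (at ?x) a"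
    using has_derivative_unique[OF 1 2] by metis
  moreover have "d0 A (f t) q (tvec_of A d q a) = frechet_derivative (\<lambda>y. f t (cinv d y)) (at ?x) a"
    using d0_chart_at[OF qd d, of "f t" a] by (simp add: o_def)
  ultimately show "d0 A (f t) q (tvec_of A d q a)
      + (frechet_derivative (local1 A d (\<eta> t) a) (at ?x) ?X + ?E (Y' a)) = 0"
    using closed_\<eta>[of a ?X] unfolding DE_def[symmetric] by linarith
qed

text \<open>The vector argument is treated as a further coordinate, so that a form on a moving
  vector becomes a smooth function along a curve in a product space.\<close>

lemma local1_family_smooth:
  assumes d: "d \<in> A"
  shows "smooth_on ({0..1} \<times> (cimg d \<times> UNIV)) (\<lambda>(t, y, a). local1 A d (\<eta> t) a y)"
proof -
  let ?S = "{0..1::real} \<times> (cimg d \<times> (UNIV :: 'e set))"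
  have p: "smooth_on ?S (\<lambda>z. (fst z, fst (snd z)))" "smooth_on ?S (\<lambda>z. snd (snd z))"
    by (intro smooth_on_bounded_linear bounded_linear_intros)+
  have "(\<lambda>z. (fst z, fst (snd z))) ` ?S \<subseteq> {0..1} \<times> cimg d" by auto
  from smooth_on_compose[OF p(1) _ this] fam_\<eta> d
  have 1: "smooth_on ?S (\<lambda>z. local1 A d (\<eta> (fst z)) w (fst (snd z)))" for w
    by (fastforce simp: smooth_family1_def case_prod_unfold)
  have 2: "smooth_on ?S (\<lambda>z. snd (snd z) \<bullet> i)" for i
    by (rule smooth_on_bilinear[OF bounded_bilinear_inner p(2) smooth_on_const])
  have 3: "smooth_on ?S (\<lambda>z. \<Sum>i\<in>Basis. (snd (snd z) \<bullet> i) *\<^sub>R local1 A d (\<eta> (fst z)) i (fst (snd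
      z)))"
    by (rule smooth_on_sum, rule smooth_on_bilinear[OF bounded_bilinear_scaleR 2 1])
  show ?thesis
  proof (rule smooth_on_cong[OF 3])
    fix z assume z: "z \<in> ?S"
    then have "fst z \<in> {0..1}" "fst (snd z) \<in> cimg d" by auto
    from linear_expand_Basis[OF local1_linear[OF forms(2)[OF this(1)] d this(2)], of "snd (snd z)"]
    show "(\<Sum>i\<in>Basis. (snd (snd z) \<bullet> i) *\<^sub>R local1 A d (\<eta> (fst z)) i (fst (snd z)))
      = (case z of (t, y, a) \<Rightarrow> local1 A d (\<eta> t) a y)" by (simp only: case_prod_unfold)
  qed
qed

lemma local2_family_smooth:
  assumes d: "d \<in> A"
  shows "smooth_on ({0..1} \<times> (cimg d \<times> UNIV)) (\<lambda>(t, y, a, b). local2 A d (\<omega> t) a b y)"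
proof -
  let ?S = "{0..1::real} \<times> (cimg d \<times> (UNIV :: ('e \<times> 'e) set))"
  have p: "smooth_on ?S (\<lambda>z. (fst z, fst (snd z)))" "smooth_on ?S (\<lambda>z. fst (snd (snd z)))"
    "smooth_on ?S (\<lambda>z. snd (snd (snd z)))"
    by (intro smooth_on_bounded_linear bounded_linear_intros)+
  have "(\<lambda>z. (fst z, fst (snd z))) ` ?S \<subseteq> {0..1} \<times> cimg d" by auto
  from smooth_on_compose[OF p(1) _ this] fam_\<omega> d
  have 1: "smooth_on ?S (\<lambda>z. local2 A d (\<omega> (fst z)) u w (fst (snd z)))" for u w
    by (fastforce simp: smooth_family2_def case_prod_unfold)
  have 2: "smooth_on ?S (\<lambda>z. fst (snd (snd z)) \<bullet> i)" "smooth_on ?S (\<lambda>z. snd (snd (snd z)) \<bullet> i)"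
      for i
    by (rule smooth_on_bilinear[OF bounded_bilinear_inner p(2) smooth_on_const],
        rule smooth_on_bilinear[OF bounded_bilinear_inner p(3) smooth_on_const])
  have 3: "smooth_on ?S (\<lambda>z. \<Sum>i\<in>Basis. (fst (snd (snd z)) \<bullet> i) *\<^sub>R
      (\<Sum>j\<in>Basis. (snd (snd (snd z)) \<bullet> j) *\<^sub>R local2 A d (\<omega> (fst z)) i j (fst (snd z))))"
    by (rule smooth_on_sum, rule smooth_on_bilinear[OF bounded_bilinear_scaleR 2(1)],
        rule smooth_on_sum, rule smooth_on_bilinear[OF bounded_bilinear_scaleR 2(2) 1])
  show ?thesis
  proof (rule smooth_on_cong[OF 3])
    fix z assume z: "z \<in> ?S"
    then have t: "fst z \<in> {0..1}" and x: "fst (snd z) \<in> cimg d" by auto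
    have "local2 A d (\<omega> (fst z)) (fst (snd (snd z))) (snd (snd (snd z))) (fst (snd z)) =
      (\<Sum>i\<in>Basis. (fst (snd (snd z)) \<bullet> i) *\<^sub>R local2 A d (\<omega> (fst z)) i (snd (snd (snd z))) (fst
          (snd z)))"
      by (rule linear_expand_Basis[OF local2_linear_left[OF forms(1)[OF t] d x]])
    also have "\<dots> = (\<Sum>i\<in>Basis. (fst (snd (snd z)) \<bullet> i) *\<^sub>R
      (\<Sum>j\<in>Basis. (snd (snd (snd z)) \<bullet> j) *\<^sub>R local2 A d (\<omega> (fst z)) i j (fst (snd z))))"
    proof (rule sum.cong[OF refl])
      fix i :: 'e
      show "(fst (snd (snd z)) \<bullet> i) *\<^sub>R local2 A d (\<omega> (fst z)) i (snd (snd (snd z))) (fst (snd z)) =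
        (fst (snd (snd z)) \<bullet> i) *\<^sub>R
        (\<Sum>j\<in>Basis. (snd (snd (snd z)) \<bullet> j) *\<^sub>R local2 A d (\<omega> (fst z)) i j (fst (snd z)))"
        by (rule arg_cong[OF linear_expand_Basis[OF local2_linear_right[OF forms(1)[OF t] d x]]])
    qed
    finally show "(\<Sum>i\<in>Basis. (fst (snd (snd z)) \<bullet> i) *\<^sub>R
      (\<Sum>j\<in>Basis. (snd (snd (snd z)) \<bullet> j) *\<^sub>R local2 A d (\<omega> (fst z)) i j (fst (snd z))))
      = (case z of (t, y, a, b) \<Rightarrow> local2 A d (\<omega> t) a b y)" by (simp only: case_prod_unfold)
  qed
qed

text \<open>The pulled-back form is a function along the curve of the moving point and the
  transported vectors. Its derivative is the time derivative of the form plus the Lie derivative,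
  and these cancel.\<close>

lemma pullback_derivative:
  assumes t0: "t0 \<in> {0..1}"
  shows "((\<lambda>t. \<omega> t (flow t p) (tangent_map A (flow t) p u) (tangent_map A (flow t) p v))
      has_real_derivative 0) (at t0 within {0..1})" (is ?thesis2)
    and "((\<lambda>t. \<eta> t (flow t p) (tangent_map A (flow t) p u)) has_real_derivative 0) (at t0 within
        {0..1})"
      (is ?thesis1)
proof -
  define c where "c = chart_at A p"
  define q where "q = flow t0 p"
  \<comment> \<open>The chart chosen at the point reached at time \<open>t0\<close>, kept fixed
    while \<open>t\<close> varies near \<open>t0\<close>; this makes \<open>moser_identities\<close>
    applicable.\<close>
  define d where "d = chart_at A q"
  have c: "c \<in> A" "p \<in> cdom c" and d: "d \<in> A" "q \<in> cdom d" using chart_at by (simp_all add: c_def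
      d_def)
  define D where "D t = frechet_derivative (cmap d \<circ> flow t \<circ> cinv c) (at (cmap c p))" for t
  obtain \<epsilon> Y' where \<epsilon>: "\<epsilon> > 0" and near: "\<forall>t\<in>{0..1}. \<bar>t - t0\<bar> < \<epsilon> \<longrightarrow> flow t p \<in> cdom d"
    and Y': "((\<lambda>y. X t0 (cinv d y) d) has_derivative Y') (at (cmap d q))"
    and y': "((\<lambda>t. cmap d (flow t p)) has_vector_derivative X t0 q d) (at t0 within {0..1})"
    and D': "\<forall>v. ((\<lambda>t. D t v) has_vector_derivative Y' (D t0 v)) (at t0 within {0..1})"
    unfolding q_def D_def by (rule flow_in_chart[OF t0 c d(1) d(2)[unfolded q_def]])
  have T: "tangent_map A (flow t) p w = tvec_of A d (flow t p) (D t (w c))"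
    if "t \<in> {0..1}" "\<bar>t - t0\<bar> < \<epsilon>" for t w
    unfolding D_def c_def
    by (rule tangent_map_chart[OF flow_smooth_map[OF that(1)] d(1)]) (use near that in blast)
  have cq: "cinv d (cmap d q) = q" using d by simp
  have qd: "cmap d q \<in> cimg d" using d by simp
  have S: "open (cimg d \<times> (UNIV :: 'x::topological_space set))" using chart_open(2)[OF d(1)] by
      (simp add: open_Times)
  let ?a = "D t0 (u c)" and ?b = "D t0 (v c)"
  let ?h2 = "\<lambda>(t, y, a, b). local2 A d (\<omega> t) a b y"
  let ?y2 = "\<lambda>t. (cmap d (flow t p), D t (u c), D t (v c))"
  have "((\<lambda>t. ?h2 (t, ?y2 t)) has_real_derivative
      d1 A (\<alpha> t0) q (tvec_of A d q ?a) (tvec_of A d q ?b) +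
      (\<lambda>h. frechet_derivative (local2 A d (\<omega> t0) ?a ?b) (at (cmap d q)) (fst h)
        + local2 A d (\<omega> t0) (fst (snd h)) ?b (cmap d q) + local2 A d (\<omega> t0) ?a (snd (snd h)) (cmap
            d q))
      (X t0 q d, Y' ?a, Y' ?b)) (at t0 within {0..1})"
  proof (rule smooth_family_derivative_along[OF local2_family_smooth[OF d(1)] S t0])
    show "?y2 t0 \<in> cimg d \<times> UNIV" using qd by (simp add: q_def)
    show "(?y2 has_vector_derivative (X t0 q d, Y' ?a, Y' ?b)) (at t0 within {0..1})"
      using y' D' by (intro has_vector_derivative_Pair) auto
    show "((\<lambda>s. ?h2 (s, ?y2 t0)) has_real_derivative
        d1 A (\<alpha> t0) q (tvec_of A d q ?a) (tvec_of A d q ?b)) (at t0 within {0..1})"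
      using dt_\<omega> t0 by (simp add: time_derivative2_def local2_def cq q_def[symmetric])
    show "((\<lambda>x. ?h2 (t0, x)) has_derivative
      (\<lambda>h. frechet_derivative (local2 A d (\<omega> t0) ?a ?b) (at (cmap d q)) (fst h)
        + local2 A d (\<omega> t0) (fst (snd h)) ?b (cmap d q) + local2 A d (\<omega> t0) ?a (snd (snd h)) (cmap
            d q)))
      (at (?y2 t0))"
      using local2_joint[OF forms(1)[OF t0] d(1) qd, of ?a ?b] by (simp add: case_prod_unfold
          q_def[symmetric])
  qed
  then have "((\<lambda>t. ?h2 (t, ?y2 t)) has_real_derivative 0) (at t0 within {0..1})"
    using moser_identities(1)[OF t0 d_def Y', of ?a ?b] by simp
  then show ?thesis2
    by (rule has_field_derivative_transform_within[OF _ \<epsilon> t0])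
      (use T near d(1) in \<open>auto simp: dist_real_def local2_def\<close>)
  let ?h1 = "\<lambda>(t, y, a). local1 A d (\<eta> t) a y"
  let ?y1 = "\<lambda>t. (cmap d (flow t p), D t (u c))"
  have "((\<lambda>t. ?h1 (t, ?y1 t)) has_real_derivative d0 A (f t0) q (tvec_of A d q ?a) +
      (\<lambda>h. frechet_derivative (local1 A d (\<eta> t0) ?a) (at (cmap d q)) (fst h)
        + local1 A d (\<eta> t0) (snd h) (cmap d q)) (X t0 q d, Y' ?a)) (at t0 within {0..1})"
  proof (rule smooth_family_derivative_along[OF local1_family_smooth[OF d(1)] S t0])
    show "?y1 t0 \<in> cimg d \<times> UNIV" using qd by (simp add: q_def)
    show "(?y1 has_vector_derivative (X t0 q d, Y' ?a)) (at t0 within {0..1})"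
      using y' D' by (intro has_vector_derivative_Pair) auto
    show "((\<lambda>s. ?h1 (s, ?y1 t0)) has_real_derivative d0 A (f t0) q (tvec_of A d q ?a)) (at t0
        within {0..1})"
      using dt_\<eta> t0 by (simp add: time_derivative1_def local1_def cq q_def[symmetric])
    show "((\<lambda>x. ?h1 (t0, x)) has_derivative
      (\<lambda>h. frechet_derivative (local1 A d (\<eta> t0) ?a) (at (cmap d q)) (fst h)
        + local1 A d (\<eta> t0) (snd h) (cmap d q))) (at (?y1 t0))"
      using local1_joint[OF forms(2)[OF t0] d(1) qd, of ?a] by (simp add: case_prod_unfold
          q_def[symmetric])
  qed
  then have "((\<lambda>t. ?h1 (t, ?y1 t)) has_real_derivative 0) (at t0 within {0..1})"
    using moser_identities(2)[OF t0 d_def Y', of ?a] by simp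
  then show ?thesis1
    by (rule has_field_derivative_transform_within[OF _ \<epsilon> t0])
      (use T near d(1) in \<open>auto simp: dist_real_def local1_def\<close>)
qed

lemma tangent_map_id:
  assumes "u \<in> tangent_space A p"
  shows "tangent_map A id p u = u"
proof -
  have "smooth_map A id" using flow_smooth_map[of 0] by (simp add: flow_0)
  from tangent_map_chart[OF this chart_at(1)[of p], of p u]
  have "tangent_map A id p u = tvec_of A (chart_at A p) p
      (tr (chart_at A p) (chart_at A p) p (u (chart_at A p)))"
    using chart_at(2)[of p] by (simp add: tr_def)
  then show ?thesis
    using tvec_of_comp[OF assms chart_at] by (simp add: tr_self chart_at)
qed

lemma flow_pullback:
  assumes t: "t \<in> {0..1}"
  shows "pullback2 A (flow t) (\<omega> t) = \<omega> 0" "pullback1 A (flow t) (\<eta> t) = \<eta> 0"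
proof -
  have z: "(0::real) \<in> {0..1}" by simp
  show "pullback2 A (flow t) (\<omega> t) = \<omega> 0"
  proof (intro ext)
    fix p u v
    show "pullback2 A (flow t) (\<omega> t) p u v = \<omega> 0 p u v"
    proof (cases "u \<in> tangent_space A p \<and> v \<in> tangent_space A p")
      case True
      have "\<omega> t (flow t p) (tangent_map A (flow t) p u) (tangent_map A (flow t) p v)
          = \<omega> 0 (flow 0 p) (tangent_map A (flow 0) p u) (tangent_map A (flow 0) p v)"
        by (rule zero_derivative_const[OF pullback_derivative(1) t])
      then show ?thesis using True by (simp add: pullback2_def tangent_map_id flow_0)
    next
      case False
      \<comment> \<open>Outside the tangent space both sides vanish by convention; for the second
        argument of \<open>\<omega> 0\<close> this uses antisymmetry.\<close>
      have "\<omega> 0 p \<in> alternating2 A p" using forms(1)[OF z] by (simp add: forms2_def)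
      then have "(\<lambda>u. \<omega> 0 p u v) \<in> cotangent_space A p" "(\<lambda>v. \<omega> 0 p v u) \<in> cotangent_space A p"
        "\<omega> 0 p u v = - \<omega> 0 p v u"
        unfolding alternating2_def by blast+
      then have "\<omega> 0 p u v = 0" using False by (auto simp: cotangent_space_def)
      then show ?thesis unfolding pullback2_def if_not_P[OF False] by simp
    qed
  qed
  show "pullback1 A (flow t) (\<eta> t) = \<eta> 0"
  proof (intro ext)
    fix p u
    show "pullback1 A (flow t) (\<eta> t) p u = \<eta> 0 p u"
    proof (cases "u \<in> tangent_space A p")
      case True
      have "\<eta> t (flow t p) (tangent_map A (flow t) p u) = \<eta> 0 (flow 0 p) (tangent_map A (flow 0) p
          u)"
        by (rule zero_derivative_const[OF pullback_derivative(2) t])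
      then show ?thesis using True by (simp add: pullback1_def tangent_map_id flow_0)
    next
      case False
      then show ?thesis using \<eta>_cot[OF z, of p] by (simp add: pullback1_def cotangent_space_def)
    qed
  qed
qed

end

theorem theorem2p9:
  fixes A :: "('m::t2_space, 'e::euclidean_space) chart set"
    and n :: nat
    and \<omega>0 \<omega>1 :: "('m, 'e) form2" and \<eta>0 \<eta>1 :: "('m, 'e) form1"
    and \<omega> :: "real \<Rightarrow> ('m, 'e) form2" and \<eta> :: "real \<Rightarrow> ('m, 'e) form1"
    and \<xi> :: "real \<Rightarrow> 'm \<Rightarrow> ('m, 'e) tvec"
    and \<alpha> :: "real \<Rightarrow> ('m, 'e) form1" and f :: "real \<Rightarrow> 'm \<Rightarrow> real"
  assumes "closed_manifold A" and "DIM('e) = 2 * n + 1"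
    and "cosymplectic A \<omega>0 \<eta>0" and "cosymplectic A \<omega>1 \<eta>1"
    and "smooth_family1 A \<eta>" and "\<forall>t\<in>{0..1}. closed1 A (\<eta> t)" and "\<eta> 0 = \<eta>0" and "\<eta> 1 = \<eta>1"
    and "smooth_family2 A \<omega>" and "\<forall>t\<in>{0..1}. closed2 A (\<omega> t)" and "\<omega> 0 = \<omega>0" and "\<omega> 1 = \<omega>1"
    and "\<forall>t\<in>{0..1}. cosymplectic A (\<omega> t) (\<eta> t)"
    and "\<forall>t\<in>{0..1}. \<xi> t = reeb A (\<omega> t) (\<eta> t)"
    and "smooth_family1 A \<alpha>" and "smooth_family0 A f"
    and "time_derivative2 \<omega> (\<lambda>t. d1 A (\<alpha> t))"
    and "time_derivative1 \<eta> (\<lambda>t. d0 A (f t))"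
    and "\<forall>t\<in>{0..1}. d0 A (\<lambda>p. \<alpha> t p (\<xi> t p)) = (\<lambda>p v. 0)"
  shows "\<exists>\<phi>. isotopy A \<phi> \<and>
    (\<forall>t\<in>{0..1}. pullback2 A (\<phi> t) (\<omega> t) = \<omega>0 \<and> pullback1 A (\<phi> t) (\<eta> t) = \<eta>0)"
proof -
  interpret cosymplectic_family A \<omega> \<eta> \<alpha> f
    by unfold_locales (use assms in \<open>auto simp: closed_manifold_def\<close>)
  show ?thesis
    using flow_isotopy flow_pullback assms(7,11) by (intro exI[of _ flow]) auto
qed

end
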